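(* Let $\lambda\vdash n+1$ and let $f_\lambda:\widetilde H\to\mathsf R[\zeta_\lambda]$ be the function $f_\lambda(h)=\chi_\lambda(hC_{\mathsf w_{\lambda'}})$. Then $f_\lambda(h)\in\mathsf R[\zeta_\lambda]^{G_\lambda}$ for all $h\in\widetilde H$.
   Context: Root data. Fix $n\ge1$. $V=\{v\in\mathbb R^{n+1}: v\cdot\mathbf 1=0\}$, $\mathbf 1=(1,\dots,1)$, with the standard inner product $\langle\cdot,\cdot\rangle$; $e_i\in V$ is the $i$-th standard basis vector minus $\frac1{n+1}\mathbf 1$ (so $\sum e_i=0$). $\Phi^+=\{e_i-e_j:1\le i<j\le n+1\}$, $\Phi=\Phi^+\cup(-\Phi^+)$, $\alpha_i=e_i-e_{i+1}$. $W=\mathfrak S_{n+1}$ acts by $we_i=e_{w(i)}$, with simple reflections $s_1,\dots,s_n$ and length $\ell$. $P=\sum_i\mathbb Ze_i$, $Q=\mathbb Z\Phi$. Partitions. For a partition $\lambda=(\lambda_1\ge\dots\ge\lambda_{r(\lambda)}>0)$ of $n+1$ let $\lambda(i)=\lambda_1+\dots+\lambda_i$, let $\lambda'$ be the transposed partition, $\mathbf t_r(\lambda)$ the standard tableau of shape $\lambda$ filled with $1,2,\dots,n+1$ row by row, $J_\lambda=\{1,\dots,n+1\}\setminus\{\lambda(1),\dots,\lambda(r(\lambda))\}$, $W_\lambda=\langle s_j:j\in J_\lambda\rangle$ with longest element $\mathsf w_\lambda$, $\Phi_\lambda$ the set of roots $e_i-e_j$ with $i,j$ in a common row of $\mathbf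 t_r(\lambda)$, $\Phi_\lambda^+=\Phi_\lambda\cap\Phi^+$, ${}^\lambda W$ the set of minimal length representatives of the cosets $W_\lambda\backslash W$, $\rho_\lambda=\frac12\sum_{\alpha\in\Phi_\lambda^+}\alpha$, $Q_\lambda=\sum_{j\in J_\lambda}\mathbb Z\alpha_j$. The same notation is applied to $\lambda'$. Extended affine Weyl group. $\widetilde W=P\rtimes W$, with $t_\gamma$ the translation by $\gamma\in P$; $W_{\rm aff}=Q\rtimes W$ is a Coxeter group with generators $s_0=t_\varphi s_\varphi,s_1,\dots,s_n$ ($\varphi=e_1-e_{n+1}$); $\widetilde W=W_{\rm aff}\rtimes\Sigma$ with $\Sigma$ the stabiliser of the fundamental alcove $\{x\in V:0\le\langle x,\alpha\rangle\le1\ \forall\alpha\in\Phi^+\}$, and $\ell(w\pi)=\ell(w)$ for $w\in W_{\rm aff},\pi\in\Sigma$. Hecke algebra. $\widetilde H$ is the $\mathsf R$-algebra, $\mathsf R=\mathbb Z[\mathsf q,\mathsf q^{-1}]$, with basis $T_w$ ($w\in\widetilde W$), $T_wT_v=T_{wv}$ if $\ell(wv)=\ell(w)+\ell(v)$, and $T_wT_s=T_{ws}+(\mathsf q-\mathsf q^{-1})T_w$ if $s\in\{s_0,\dots,s_n\}$ and $\ell(ws)=\ell(w)-1$. For $\gamma=\mu-\nu\in P$ with $\mu,\nu\in P$ dominant, $X^\gamma=T_{t_\mu}T_{t_\nu}^{-1}$; for $u\in W$, $X_u=T_{u^{-1}}^{-1}$. For $J\subseteq\{1,\dots,n\}$ with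 parabolic subgroup $W_J$ and longest element $\mathsf w_J$, the Kazhdan–Lusztig basis element is $C_{\mathsf w_J}=\mathsf q^{-\ell(\mathsf w_J)}\sum_{w\in W_J}\mathsf q^{\ell(w)}T_w$. Representation $\pi_\lambda$. $\mathsf R[\zeta_\lambda]$ is the group ring $\mathsf R[P/Q_\lambda]$, with basis elements written $\zeta_\lambda^\gamma$ ($\gamma\in P$; depends only on $\gamma+Q_\lambda$). Let $\mathcal L_\lambda\subseteq\widetilde H$ be the subalgebra generated by $T_j=T_{s_j}$ ($j\in J_\lambda$) and $X^\gamma$ ($\gamma\in P$), and $\psi_\lambda:\mathcal L_\lambda\to\mathsf R[\zeta_\lambda]$ the character with $\psi_\lambda(T_j)=-\mathsf q^{-1}$, $\psi_\lambda(X^\gamma)=(-\mathsf q^{-1})^{\langle\gamma,2\rho_\lambda\rangle}\zeta_\lambda^\gamma$. $M_\lambda=(\mathsf R[\zeta_\lambda]\xi_\lambda)\otimes_{\mathcal L_\lambda}\widetilde H$ is the induced right module, where $\xi_\lambda\cdot h=\psi_\lambda(h)\xi_\lambda$; it is free over $\mathsf R[\zeta_\lambda]$ with basis $\{\xi_\lambda\otimes X_u:u\in{}^\lambda W\}$. $\chi_\lambda$ is its character (trace). Symmetry. $G_\lambda=\{g\in W:g\mathcal A_\lambda=\mathcal A_\lambda\}$ where $\mathcal A_\lambda=\{v\in V:0\le\langle v,\alpha\rangle\le1\ \forall\alpha\in\Phi_\lambda^+\}$; equivalently $G_\lambda=\{g\in W:g\Phi_\lambda^+=\Phi_\lambda^+\}$.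 It acts on $\mathsf R[\zeta_\lambda]$ by $g\cdot\zeta_\lambda^\gamma=\zeta_\lambda^{g\gamma}$, and $\mathsf R[\zeta_\lambda]^{G_\lambda}$ denotes the invariants. *)

theory Defs
  imports
    Complex_Main
    "HOL-Library.Poly_Mapping"
    "HOL-Library.Set_Algebras"
    "HOL-Library.Function_Algebras"
    "HOL-Combinatorics.Permutations"
begin

section \<open>Root data of type A\<close>

text \<open>
  A vector of \<open>\<real>\<^sup>n\<^sup>+\<^sup>1\<close> is a function \<open>nat \<Rightarrow> real\<close> that vanishes outside \<open>{1..n + 1}\<close>; the number
  \<open>n\<close> is an explicit parameter throughout. Addition and zero of vectors are the pointwise ones of
  \<^theory>\<open>HOL-Library.Function_Algebras\<close>.
\<close>

type_synonym weight = "nat \<Rightarrow> real"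

definition ambient :: "nat \<Rightarrow> weight set" where
  "ambient n = {v. (\<forall>j. j \<notin> {1..n + 1} \<longrightarrow> v j = 0) \<and> (\<Sum>j = 1..n + 1. v j) = 0}"

definition inprod :: "nat \<Rightarrow> weight \<Rightarrow> weight \<Rightarrow> real" where
  "inprod n v w = (\<Sum>j = 1..n + 1. v j * w j)"

definition eps :: "nat \<Rightarrow> nat \<Rightarrow> weight" where
  "eps n i = (\<lambda>j. if j \<in> {1..n + 1} then (if j = i then 1 else 0) - 1 / real (n + 1) else 0)"

definition pos_roots :: "nat \<Rightarrow> weight set" where
  "pos_roots n = {eps n i - eps n j | i j. 1 \<le> i \<and> i < j \<and> j \<le> n + 1}"

definition simple_root :: "nat \<Rightarrow> nat \<Rightarrow> weight" where
  "simple_root n i = eps n i - eps n (i + 1)"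

text \<open>The \<open>\<int>\<close>-span of a finite set of vectors.\<close>

definition zspan :: "weight set \<Rightarrow> weight set" where
  "zspan B = {v. \<exists>c :: weight \<Rightarrow> int. v = (\<lambda>j. \<Sum>b\<in>B. of_int (c b) * b j)}"

definition weights :: "nat \<Rightarrow> weight set" where
  "weights n = zspan (eps n ` {1..n + 1})"

definition dominant :: "nat \<Rightarrow> weight set" where
  "dominant n = {\<gamma> \<in> weights n. \<forall>\<alpha>\<in>pos_roots n. 0 \<le> inprod n \<gamma> \<alpha>}"

definition weyl :: "nat \<Rightarrow> (nat \<Rightarrow> nat) set" where
  "weyl n = {w. w permutes {1..n + 1}}"

text \<open>The linear action determined by \<open>w e\<^sub>i = e\<^bsub>w(i)\<^esub>\<close>.\<close>

definition act :: "(nat \<Rightarrow> nat) \<Rightarrow> weight \<Rightarrow> weight" where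
  "act w v = (\<lambda>j. v (inv w j))"

definition weyl_word :: "nat list \<Rightarrow> nat \<Rightarrow> nat" where
  "weyl_word is = foldr (\<circ>) (map (\<lambda>i. transpose i (i + 1)) is) id"

definition weyl_length :: "nat \<Rightarrow> (nat \<Rightarrow> nat) \<Rightarrow> nat" where
  "weyl_length n w = (LEAST k. \<exists>is. length is = k \<and> set is \<subseteq> {1..n} \<and> w = weyl_word is)"

definition parabolic :: "nat set \<Rightarrow> (nat \<Rightarrow> nat) set" where
  "parabolic J = {weyl_word is | is. set is \<subseteq> J}"

definition longest :: "nat \<Rightarrow> nat set \<Rightarrow> nat \<Rightarrow> nat" where
  "longest n J = (ARG_MAX (weyl_length n) w. w \<in> parabolic J)"


section \<open>Partitions\<close>

definition partition_of :: "nat list \<Rightarrow> nat \<Rightarrow> bool" where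
  "partition_of lam m \<longleftrightarrow> sorted_wrt (\<ge>) lam \<and> (\<forall>x\<in>set lam. 0 < x) \<and> sum_list lam = m"

definition transposed :: "nat list \<Rightarrow> nat list" where
  "transposed lam = map (\<lambda>j. length (filter (\<lambda>x. j \<le> x) lam)) [1..<Suc (hd lam)]"

definition psum :: "nat list \<Rightarrow> nat \<Rightarrow> nat" where
  "psum lam i = sum_list (take i lam)"

definition J_of :: "nat \<Rightarrow> nat list \<Rightarrow> nat set" where
  "J_of n lam = {1..n + 1} - psum lam ` {1..length lam}"

text \<open>
  Row \<open>k + 1\<close> of the standard tableau obtained by filling the shape row by row consists of the
  entries \<open>\<lambda>(k) + 1, \<dots>, \<lambda>(k + 1)\<close>.
\<close>

definition same_row :: "nat list \<Rightarrow> nat \<Rightarrow> nat \<Rightarrow> bool" where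
  "same_row lam i j \<longleftrightarrow>
     (\<exists>k < length lam. {i, j} \<subseteq> {psum lam k <.. psum lam (k + 1)})"

definition roots_of :: "nat \<Rightarrow> nat list \<Rightarrow> weight set" where
  "roots_of n lam =
     {eps n i - eps n j | i j. i \<in> {1..n + 1} \<and> j \<in> {1..n + 1} \<and> i \<noteq> j \<and> same_row lam i j}"

definition pos_roots_of :: "nat \<Rightarrow> nat list \<Rightarrow> weight set" where
  "pos_roots_of n lam = roots_of n lam \<inter> pos_roots n"

definition rho_of :: "nat \<Rightarrow> nat list \<Rightarrow> weight" where
  "rho_of n lam = (\<lambda>j. 1 / 2 * (\<Sum>\<alpha>\<in>pos_roots_of n lam. \<alpha> j))"

definition Q_of :: "nat \<Rightarrow> nat list \<Rightarrow> weight set" where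
  "Q_of n lam = zspan (simple_root n ` J_of n lam)"

text \<open>Minimal length representatives of the cosets \<open>W\<^sub>\<lambda> u\<close>.\<close>

definition min_reps :: "nat \<Rightarrow> nat list \<Rightarrow> (nat \<Rightarrow> nat) set" where
  "min_reps n lam =
     {u \<in> weyl n. \<forall>w\<in>parabolic (J_of n lam). weyl_length n u \<le> weyl_length n (w \<circ> u)}"

definition alcove_of :: "nat \<Rightarrow> nat list \<Rightarrow> weight set" where
  "alcove_of n lam =
     {v \<in> ambient n. \<forall>\<alpha>\<in>pos_roots_of n lam. 0 \<le> inprod n v \<alpha> \<and> inprod n v \<alpha> \<le> 1}"

definition G_of :: "nat \<Rightarrow> nat list \<Rightarrow> (nat \<Rightarrow> nat) set" where
  "G_of n lam = {g \<in> weyl n. act g ` alcove_of n lam = alcove_of n lam}"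


section \<open>The extended affine Weyl group\<close>

text \<open>The pair \<open>(\<gamma>, w)\<close> is \<open>t\<^sub>\<gamma> w\<close>, the affine map \<open>v \<mapsto> \<gamma> + w v\<close>.\<close>

type_synonym aff = "weight \<times> (nat \<Rightarrow> nat)"

definition ext_weyl :: "nat \<Rightarrow> aff set" where
  "ext_weyl n = weights n \<times> weyl n"

definition aff_mult :: "aff \<Rightarrow> aff \<Rightarrow> aff" where
  "aff_mult x y = (fst x + act (snd x) (fst y), snd x \<circ> snd y)"

definition aff_act :: "aff \<Rightarrow> weight \<Rightarrow> weight" where
  "aff_act x v = fst x + act (snd x) v"

definition transl :: "weight \<Rightarrow> aff" where
  "transl \<gamma> = (\<gamma>, id)"

definition fin :: "(nat \<Rightarrow> nat) \<Rightarrow> aff" where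
  "fin w = (0, w)"

definition aff_gen :: "nat \<Rightarrow> nat \<Rightarrow> aff" where
  "aff_gen n i =
     (if i = 0 then aff_mult (transl (eps n 1 - eps n (n + 1))) (fin (transpose 1 (n + 1)))
      else fin (transpose i (i + 1)))"

definition fund_alcove :: "nat \<Rightarrow> weight set" where
  "fund_alcove n = {x \<in> ambient n. \<forall>\<alpha>\<in>pos_roots n. 0 \<le> inprod n x \<alpha> \<and> inprod n x \<alpha> \<le> 1}"

definition Sigma_grp :: "nat \<Rightarrow> aff set" where
  "Sigma_grp n = {x \<in> ext_weyl n. aff_act x ` fund_alcove n = fund_alcove n}"

definition aff_word :: "nat \<Rightarrow> nat list \<Rightarrow> aff" where
  "aff_word n is = foldr aff_mult (map (aff_gen n) is) (fin id)"

text \<open>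
  The Coxeter length of the affine Weyl group with respect to \<open>s\<^sub>0, \<dots>, s\<^sub>n\<close>, extended by
  \<open>\<ell>(w \<pi>) = \<ell>(w)\<close> for \<open>\<pi> \<in> \<Sigma>\<close>.
\<close>

definition ext_length :: "nat \<Rightarrow> aff \<Rightarrow> nat" where
  "ext_length n x =
     (LEAST k. \<exists>is \<pi>. length is = k \<and> set is \<subseteq> {0..n} \<and> \<pi> \<in> Sigma_grp n \<and>
        x = aff_mult (aff_word n is) \<pi>)"


section \<open>The extended affine Hecke algebra\<close>

text \<open>The ring \<open>\<int>[q, q\<^sup>-\<^sup>1]\<close>, as the group ring of \<open>\<int>\<close> over \<open>\<int>\<close>.\<close>

type_synonym laurent = "int \<Rightarrow>\<^sub>0 int"

definition qpow :: "int \<Rightarrow> laurent" where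
  "qpow k = Poly_Mapping.single k 1"

text \<open>The element \<open>(- q\<^sup>-\<^sup>1)\<^sup>k\<close> for an arbitrary integer \<open>k\<close>.\<close>

definition neg_qinv_pow :: "int \<Rightarrow> laurent" where
  "neg_qinv_pow k = (if even k then qpow (- k) else - qpow (- k))"

text \<open>
  The locale says that the ring \<open>'h\<close> with scalar multiplication \<open>scale\<close> is the unital algebra over
  \<open>\<int>[q, q\<^sup>-\<^sup>1]\<close> with basis \<open>T\<^sub>w\<close> (\<open>w\<close> in the extended affine Weyl group) and the given
  multiplication rules; these determine it up to unique isomorphism. Values of \<open>T\<close> outside the
  group are irrelevant.
\<close>

locale hecke_algebra = module scale
  for scale :: "laurent \<Rightarrow> 'h::ring_1 \<Rightarrow> 'h" +
  fixes n :: nat and T :: "aff \<Rightarrow> 'h"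
  assumes scale_mult_left: "scale r (x * y) = scale r x * y"
    and scale_mult_right: "scale r (x * y) = x * scale r y"
    and T_inj: "inj_on T (ext_weyl n)"
    and T_independent: "independent (T ` ext_weyl n)"
    and T_span: "span (T ` ext_weyl n) = UNIV"
    and T_mult: "\<lbrakk>w \<in> ext_weyl n; v \<in> ext_weyl n;
        ext_length n (aff_mult w v) = ext_length n w + ext_length n v\<rbrakk>
      \<Longrightarrow> T w * T v = T (aff_mult w v)"
    and T_quadratic: "\<lbrakk>w \<in> ext_weyl n; i \<in> {0..n};
        ext_length n w = ext_length n (aff_mult w (aff_gen n i)) + 1\<rbrakk>
      \<Longrightarrow> T w * T (aff_gen n i) = T (aff_mult w (aff_gen n i)) + scale (qpow 1 - qpow (- 1)) (T w)"

definition ring_inv :: "'h::ring_1 \<Rightarrow> 'h" where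
  "ring_inv x = (THE y. x * y = 1 \<and> y * x = 1)"

definition X_wt :: "nat \<Rightarrow> (aff \<Rightarrow> 'h::ring_1) \<Rightarrow> weight \<Rightarrow> 'h" where
  "X_wt n T \<gamma> = (THE x. \<exists>\<mu>\<in>dominant n. \<exists>\<nu>\<in>dominant n.
      \<gamma> = \<mu> - \<nu> \<and> x = T (transl \<mu>) * ring_inv (T (transl \<nu>)))"

definition X_fin :: "(aff \<Rightarrow> 'h::ring_1) \<Rightarrow> (nat \<Rightarrow> nat) \<Rightarrow> 'h" where
  "X_fin T u = ring_inv (T (fin (inv u)))"

definition C_longest ::
  "nat \<Rightarrow> (laurent \<Rightarrow> 'h::ring_1 \<Rightarrow> 'h) \<Rightarrow> (aff \<Rightarrow> 'h) \<Rightarrow> nat set \<Rightarrow> 'h" where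
  "C_longest n scale T J =
     scale (qpow (- int (weyl_length n (longest n J))))
       (\<Sum>w\<in>parabolic J. scale (qpow (int (weyl_length n w))) (T (fin w)))"


section \<open>The group ring of \<open>P/Q\<^sub>\<lambda>\<close>\<close>

text \<open>
  Elements of \<open>R[P/Q\<^sub>\<lambda>]\<close> are finitely supported functions from cosets \<open>\<gamma> + Q\<^sub>\<lambda>\<close> to
  \<open>R = \<int>[q, q\<^sup>-\<^sup>1]\<close>. Their product is the convolution product of \<open>poly_mapping\<close>, formed with the
  elementwise addition of sets of \<^theory>\<open>HOL-Library.Set_Algebras\<close>, which on cosets is the addition
  of \<open>P/Q\<^sub>\<lambda>\<close>. The unit element of \<open>R[P/Q\<^sub>\<lambda>]\<close> is \<open>zeta n \<lambda> 0\<close>, supported on the coset \<open>Q\<^sub>\<lambda>\<close>; it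
  differs from the constant \<open>1\<close> of the ambient type, which is supported on the singleton \<open>{0}\<close>.
\<close>

type_synonym zring = "weight set \<Rightarrow>\<^sub>0 laurent"

definition zeta :: "nat \<Rightarrow> nat list \<Rightarrow> weight \<Rightarrow> zring" where
  "zeta n lam \<gamma> = Poly_Mapping.single (\<gamma> +o Q_of n lam) 1"

definition zeta_ring :: "nat \<Rightarrow> nat list \<Rightarrow> zring set" where
  "zeta_ring n lam = {a. Poly_Mapping.keys a \<subseteq> (\<lambda>\<gamma>. \<gamma> +o Q_of n lam) ` weights n}"

definition zscale :: "laurent \<Rightarrow> zring \<Rightarrow> zring" where
  "zscale r a = Poly_Mapping.map ((*) r) a"

text \<open>The linear extension of \<open>g \<cdot> \<zeta>\<^sup>\<gamma> = \<zeta>\<^bsup>g\<gamma>\<^esup>\<close>, where \<open>g\<close> acts on cosets by taking images.\<close>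

definition zact :: "(nat \<Rightarrow> nat) \<Rightarrow> zring \<Rightarrow> zring" where
  "zact g a = (\<Sum>\<kappa>\<in>Poly_Mapping.keys a. Poly_Mapping.single (act g ` \<kappa>) (Poly_Mapping.lookup a \<kappa>))"

definition zeta_invariants :: "nat \<Rightarrow> nat list \<Rightarrow> zring set" where
  "zeta_invariants n lam = {a \<in> zeta_ring n lam. \<forall>g\<in>G_of n lam. zact g a = a}"


section \<open>The induced module and its character\<close>

inductive_set levi_subalgebra ::
  "nat \<Rightarrow> (laurent \<Rightarrow> 'h::ring_1 \<Rightarrow> 'h) \<Rightarrow> (aff \<Rightarrow> 'h) \<Rightarrow> nat list \<Rightarrow> 'h set"
  for n scale T lam where
  one: "1 \<in> levi_subalgebra n scale T lam"
| T_gen: "j \<in> J_of n lam \<Longrightarrow> T (aff_gen n j) \<in> levi_subalgebra n scale T lam"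
| X_gen: "\<gamma> \<in> weights n \<Longrightarrow> X_wt n T \<gamma> \<in> levi_subalgebra n scale T lam"
| add: "\<lbrakk>x \<in> levi_subalgebra n scale T lam; y \<in> levi_subalgebra n scale T lam\<rbrakk>
    \<Longrightarrow> x + y \<in> levi_subalgebra n scale T lam"
| mult: "\<lbrakk>x \<in> levi_subalgebra n scale T lam; y \<in> levi_subalgebra n scale T lam\<rbrakk>
    \<Longrightarrow> x * y \<in> levi_subalgebra n scale T lam"
| scale: "x \<in> levi_subalgebra n scale T lam \<Longrightarrow> scale r x \<in> levi_subalgebra n scale T lam"

text \<open>
  The real number \<open>\<langle>\<gamma>, 2\<rho>\<^sub>\<lambda>\<rangle>\<close> is an integer for \<open>\<gamma> \<in> P\<close>, so the floor below only converts its type.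
  The conditions determine \<open>\<psi>\<close> uniquely on the Levi subalgebra, and no other values of \<open>\<psi>\<close> are used.
\<close>

definition is_psi ::
  "nat \<Rightarrow> (laurent \<Rightarrow> 'h::ring_1 \<Rightarrow> 'h) \<Rightarrow> (aff \<Rightarrow> 'h) \<Rightarrow> nat list \<Rightarrow> ('h \<Rightarrow> zring) \<Rightarrow> bool" where
  "is_psi n scale T lam \<psi> \<longleftrightarrow>
     (\<forall>x\<in>levi_subalgebra n scale T lam. \<psi> x \<in> zeta_ring n lam) \<and>
     \<psi> 1 = zeta n lam 0 \<and>
     (\<forall>x\<in>levi_subalgebra n scale T lam. \<forall>y\<in>levi_subalgebra n scale T lam.
        \<psi> (x + y) = \<psi> x + \<psi> y \<and> \<psi> (x * y) = \<psi> x * \<psi> y) \<and>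
     (\<forall>r. \<forall>x\<in>levi_subalgebra n scale T lam. \<psi> (scale r x) = zscale r (\<psi> x)) \<and>
     (\<forall>j\<in>J_of n lam. \<psi> (T (aff_gen n j)) = zscale (- qpow (- 1)) (zeta n lam 0)) \<and>
     (\<forall>\<gamma>\<in>weights n. \<psi> (X_wt n T \<gamma>) =
        zscale (neg_qinv_pow \<lfloor>inprod n \<gamma> (\<lambda>j. 2 * rho_of n lam j)\<rfloor>) (zeta n lam \<gamma>))"

text \<open>
  The tensor product of the rank one module \<open>R[\<zeta>\<^sub>\<lambda>] \<xi>\<^sub>\<lambda>\<close> with the Hecke algebra over the Levi
  subalgebra is the quotient of the group \<open>formal_tensors\<close> of formal sums \<open>\<Sum> a \<xi> \<otimes> h\<close> by its subgroup
  \<open>tensor_null\<close> of tensor product relations. The formal symbol \<open>a \<xi> \<otimes> h\<close> is \<open>single h a\<close>, which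
  makes it additive in \<open>a\<close> already.
\<close>

definition formal_tensors :: "nat \<Rightarrow> nat list \<Rightarrow> ('h \<Rightarrow>\<^sub>0 zring) set" where
  "formal_tensors n lam = {m. \<forall>h. Poly_Mapping.lookup m h \<in> zeta_ring n lam}"

inductive_set tensor_null ::
  "nat \<Rightarrow> (laurent \<Rightarrow> 'h::ring_1 \<Rightarrow> 'h) \<Rightarrow> (aff \<Rightarrow> 'h) \<Rightarrow> nat list \<Rightarrow> ('h \<Rightarrow> zring)
     \<Rightarrow> ('h \<Rightarrow>\<^sub>0 zring) set"
  for n scale T lam \<psi> where
  zero: "0 \<in> tensor_null n scale T lam \<psi>"
| diff: "\<lbrakk>m \<in> tensor_null n scale T lam \<psi>; m' \<in> tensor_null n scale T lam \<psi>\<rbrakk>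
    \<Longrightarrow> m - m' \<in> tensor_null n scale T lam \<psi>"
| biadditive: "a \<in> zeta_ring n lam \<Longrightarrow>
    Poly_Mapping.single (h + h') a - Poly_Mapping.single h a - Poly_Mapping.single h' a
      \<in> tensor_null n scale T lam \<psi>"
| balanced: "\<lbrakk>a \<in> zeta_ring n lam; l \<in> levi_subalgebra n scale T lam\<rbrakk> \<Longrightarrow>
    Poly_Mapping.single h (a * \<psi> l) - Poly_Mapping.single (l * h) a
      \<in> tensor_null n scale T lam \<psi>"

text \<open>
  \<open>is_coords n scale T \<lambda> \<psi> m c\<close>: in the induced module, the class of \<open>m\<close> equals
  \<open>\<Sum>u. c u \<cdot> (\<xi> \<otimes> X\<^sub>u)\<close>, with \<open>u\<close> running through the minimal length representatives.
\<close>

definition is_coords ::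
  "nat \<Rightarrow> (laurent \<Rightarrow> 'h::ring_1 \<Rightarrow> 'h) \<Rightarrow> (aff \<Rightarrow> 'h) \<Rightarrow> nat list \<Rightarrow> ('h \<Rightarrow> zring)
     \<Rightarrow> ('h \<Rightarrow>\<^sub>0 zring) \<Rightarrow> ((nat \<Rightarrow> nat) \<Rightarrow> zring) \<Rightarrow> bool" where
  "is_coords n scale T lam \<psi> m c \<longleftrightarrow>
     (\<forall>u\<in>min_reps n lam. c u \<in> zeta_ring n lam) \<and> (\<forall>u. u \<notin> min_reps n lam \<longrightarrow> c u = 0) \<and>
     m - (\<Sum>u\<in>min_reps n lam. Poly_Mapping.single (X_fin T u) (c u)) \<in> tensor_null n scale T lam \<psi>"

text \<open>
  The trace of right multiplication by \<open>h\<close>, in the basis \<open>\<xi> \<otimes> X\<^sub>u\<close>. As with the library's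
  \<open>representation\<close>, the value is \<open>0\<close> by convention should the \<open>\<xi> \<otimes> X\<^sub>u\<close> not form a basis,
  which never occurs for a Hecke algebra and its character \<open>\<psi>\<close>.
\<close>

definition chi ::
  "nat \<Rightarrow> (laurent \<Rightarrow> 'h::ring_1 \<Rightarrow> 'h) \<Rightarrow> (aff \<Rightarrow> 'h) \<Rightarrow> nat list \<Rightarrow> ('h \<Rightarrow> zring) \<Rightarrow> 'h \<Rightarrow> zring" where
  "chi n scale T lam \<psi> h =
     (if \<forall>m\<in>formal_tensors n lam. \<exists>!c. is_coords n scale T lam \<psi> m c
      then \<Sum>u\<in>min_reps n lam.
        (THE c. is_coords n scale T lam \<psi> (Poly_Mapping.single (X_fin T u * h) (zeta n lam 0)) c) u
      else 0)"

definition f_fun ::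
  "nat \<Rightarrow> (laurent \<Rightarrow> 'h::ring_1 \<Rightarrow> 'h) \<Rightarrow> (aff \<Rightarrow> 'h) \<Rightarrow> nat list \<Rightarrow> ('h \<Rightarrow> zring) \<Rightarrow> 'h \<Rightarrow> zring" where
  "f_fun n scale T lam \<psi> h =
     chi n scale T lam \<psi> (h * C_longest n scale T (J_of n (transposed lam)))"

end

theory Submission
  imports Defs
begin

text \<open>
  If the \<open>\<xi> \<otimes> X\<^sub>u\<close> are not a basis, then \<open>chi\<close> is \<open>0\<close> by convention. Otherwise the trace \<open>\<chi>\<close> itself
  is invariant, and the factor \<open>C\<close> plays no role.

  Write \<open>x\<^sub>i\<close> for \<open>X\<^bsup>e\<^sub>i\<^esup>\<close>. The discriminant \<open>D = \<Prod>\<^bsub>i \<noteq> j\<^esub> (x\<^sub>i - x\<^sub>j)\<close> is central and hence acts on the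
  induced module by the scalar \<open>d = \<psi>(D)\<close>, which is invariant and not a zero divisor. For \<open>w \<in> W\<close> there is
  an intertwiner \<open>\<tau>\<^sub>w = p X\<^sub>w + (lower terms)\<close> with \<open>p\<close> dividing a power of \<open>D\<close> and \<open>\<tau>\<^sub>w x\<^sub>i = x\<^bsub>w(i)\<^esub> \<tau>\<^sub>w\<close>. If
  \<open>w(i) \<noteq> i\<close>, the trace property shows that \<open>\<chi>\<close> vanishes on \<open>(x\<^sub>i - x\<^bsub>w(i)\<^esub>) p' \<tau>\<^sub>w\<close> for every polynomial
  \<open>p'\<close> in the \<open>x\<^sub>j\<close>, so that \<open>d \<chi>(p' \<tau>\<^sub>w) = 0\<close> and \<open>\<chi>(p' \<tau>\<^sub>w) = 0\<close>. By induction on the length of \<open>w\<close> the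
  invariance of \<open>\<chi>(p' X\<^sub>w)\<close> is thereby reduced to \<open>w = 1\<close>, where \<open>\<chi>(p')\<close> is the sum of the
  \<open>\<psi>(u p')\<close> over the minimal length representatives \<open>u\<close>, which \<open>G\<^sub>\<lambda>\<close> permutes.
\<close>

section \<open>Weights and the Weyl group\<close>

text \<open>Two obstacles shape the proof. The group P/Q_lambda has torsion when the parts of lambda
  have a common divisor greater than 1; the group ring then has zero divisors, so regularity of d is
  proved factor by factor. For i, j in one row, \<psi>(x_i) and \<psi>(x_j) differ by a nonzero
  power of q; for different rows, multiplication by \<psi>(x_j)/\<psi>(x_i) moves supports strictly
  in a torsion-free grading. Regularity also replaces localisation: the usual intertwiners have
  denominators x_i - x_j, which are cleared here and divided out only after the trace has been
  taken. The second obstacle is that the Hecke relations are conditional on a length defined through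
  shortest words. Counting separating hyperplanes gives this length a closed form. From it come the
  additivity of length on dominant translations and the Bernstein relations, which need only
  fundamental weights because each e_k is a difference of two of them.\<close>

lemma weyl_inv: "w \<in> weyl n \<Longrightarrow> inv w \<in> weyl n"
  by (simp add: weyl_def permutes_inv)

lemma weyl_comp: "v \<in> weyl n \<Longrightarrow> w \<in> weyl n \<Longrightarrow> v \<circ> w \<in> weyl n"
  by (simp add: weyl_def permutes_compose)

lemma weyl_id: "id \<in> weyl n"
  by (simp add: weyl_def permutes_id)

lemma weyl_transpose: "a \<in> {1..n + 1} \<Longrightarrow> b \<in> {1..n + 1} \<Longrightarrow> transpose a b \<in> weyl n"
  by (simp add: weyl_def permutes_swap_id)

lemma weyl_bij: "w \<in> weyl n \<Longrightarrow> bij w"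
  by (auto simp: weyl_def permutes_bij)

lemma weyl_inv_inv: "w \<in> weyl n \<Longrightarrow> inv (inv w) = w"
  by (simp add: weyl_bij inv_inv_eq)

lemma weyl_inverses [simp]:
  assumes "w \<in> weyl n"
  shows "inv w (w a) = a" "w (inv w a) = a" "inv w \<circ> w = id" "w \<circ> inv w = id"
  using weyl_bij[OF assms] by (auto simp: bij_is_inj bij_is_surj surj_f_inv_f surj_iff)

lemma weyl_in_range: "w \<in> weyl n \<Longrightarrow> w a \<in> {1..n + 1} \<longleftrightarrow> a \<in> {1..n + 1}"
  unfolding weyl_def by (metis mem_Collect_eq permutes_in_image)

lemma weyl_eq_iff: "w \<in> weyl n \<Longrightarrow> w a = w b \<longleftrightarrow> a = b"
  by (metis weyl_inverses(1))

lemma weyl_inv_comp: "v \<in> weyl n \<Longrightarrow> w \<in> weyl n \<Longrightarrow> inv (v \<circ> w) = inv w \<circ> inv v"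
  by (simp add: weyl_bij o_inv_distrib)

lemma weyl_sum: "w \<in> weyl n \<Longrightarrow> (\<Sum>a = 1..n + 1. f (w a)) = (\<Sum>a = 1..n + 1. f a)"
  unfolding weyl_def using sum.permute[of w "{1..n + 1}" f] by (simp add: comp_def)

lemma finite_weyl: "finite (weyl n)"
  unfolding weyl_def by (simp add: finite_permutations)

section \<open>Action of W on vectors and the weight lattice\<close>

lemma act_id [simp]: "act id v = v"
  by (simp add: act_def)

lemma act_comp: "v \<in> weyl n \<Longrightarrow> w \<in> weyl n \<Longrightarrow> act (v \<circ> w) \<gamma> = act v (act w \<gamma>)"
  by (simp add: act_def weyl_inv_comp fun_eq_iff)

lemma act_add: "act w (\<gamma> + \<delta>) = act w \<gamma> + act w \<delta>"
  by (simp add: act_def fun_eq_iff)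

lemma act_diff: "act w (\<gamma> - \<delta>) = act w \<gamma> - act w \<delta>"
  by (simp add: act_def fun_eq_iff)

lemma act_zero [simp]: "act w 0 = 0"
  by (simp add: act_def fun_eq_iff)

lemma act_inv [simp]:
  assumes "w \<in> weyl n"
  shows "act w (act (inv w) \<gamma>) = \<gamma>" "act (inv w) (act w \<gamma>) = \<gamma>"
  using act_comp[OF assms weyl_inv[OF assms], of \<gamma>] act_comp[OF weyl_inv[OF assms] assms, of \<gamma>] assms
  by simp_all

lemma act_eps:
  assumes "w \<in> weyl n"
  shows "act w (eps n i) = eps n (w i)"
proof
  fix j
  have "inv w j \<in> {1..n + 1} \<longleftrightarrow> j \<in> {1..n + 1}" "inv w j = i \<longleftrightarrow> j = w i"
    using weyl_in_range[OF weyl_inv[OF assms]] weyl_inverses(1,2)[OF assms] by metis+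
  then show "act w (eps n i) j = eps n (w i) j"
    by (simp add: act_def eps_def)
qed

lemma inj_eps: "inj_on (eps n) {1..n + 1}"
proof (rule inj_onI)
  fix i j assume i: "i \<in> {1..n + 1}" and eq: "eps n i = eps n j"
  have "eps n i i = eps n j i" by (simp only: eq)
  with i show "i = j" by (simp add: eps_def split: if_splits)
qed

text \<open>\<open>zspan\<close> indexes coefficients by vectors; injectivity of
  \<open>eps n\<close> on {1..n + 1} turns them into coefficients indexed by numbers.\<close>

lemma weights_iff:
  "\<gamma> \<in> weights n \<longleftrightarrow> (\<exists>c :: nat \<Rightarrow> int. \<gamma> = (\<lambda>a. \<Sum>i = 1..n + 1. of_int (c i) * eps n i a))"
proof
  assume "\<gamma> \<in> weights n"
  then obtain c :: "weight \<Rightarrow> int"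
    where "\<gamma> = (\<lambda>a. \<Sum>b\<in>eps n ` {1..n + 1}. of_int (c b) * b a)"
    by (auto simp: weights_def zspan_def)
  then have "\<gamma> = (\<lambda>a. \<Sum>i = 1..n + 1. of_int ((c \<circ> eps n) i) * eps n i a)"
    by (simp only: sum.reindex[OF inj_eps] comp_def)
  then show "\<exists>c :: nat \<Rightarrow> int. \<gamma> = (\<lambda>a. \<Sum>i = 1..n + 1. of_int (c i) * eps n i a)"
    by blast
next
  assume "\<exists>c :: nat \<Rightarrow> int. \<gamma> = (\<lambda>a. \<Sum>i = 1..n + 1. of_int (c i) * eps n i a)"
  then obtain c :: "nat \<Rightarrow> int" where c: "\<gamma> = (\<lambda>a. \<Sum>i = 1..n + 1. of_int (c i) * eps n i a)"
    by blast
  define d where "d = c \<circ> inv_into {1..n + 1} (eps n)"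
  have "d (eps n i) = c i" if "i \<in> {1..n + 1}" for i
    unfolding d_def comp_def by (simp only: inv_into_f_f[OF inj_eps that])
  then have "\<gamma> = (\<lambda>a. \<Sum>b\<in>eps n ` {1..n + 1}. of_int (d b) * b a)"
    unfolding c by (simp only: sum.reindex[OF inj_eps] comp_def) simp
  then show "\<gamma> \<in> weights n"
    unfolding weights_def zspan_def by blast
qed

lemma weights_add: "\<gamma> \<in> weights n \<Longrightarrow> \<delta> \<in> weights n \<Longrightarrow> \<gamma> + \<delta> \<in> weights n"
proof -
  assume "\<gamma> \<in> weights n" "\<delta> \<in> weights n"
  then obtain c d :: "nat \<Rightarrow> int"
    where "\<gamma> = (\<lambda>a. \<Sum>i = 1..n + 1. of_int (c i) * eps n i a)"
      "\<delta> = (\<lambda>a. \<Sum>i = 1..n + 1. of_int (d i) * eps n i a)"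
    unfolding weights_iff by blast
  then have "\<gamma> + \<delta> = (\<lambda>a. \<Sum>i = 1..n + 1. of_int (c i + d i) * eps n i a)"
    by (simp only: fun_eq_iff plus_fun_apply of_int_add distrib_right sum.distrib) simp
  then show ?thesis unfolding weights_iff by (intro exI[of _ "\<lambda>i. c i + d i"])
qed

lemma weights_diff: "\<gamma> \<in> weights n \<Longrightarrow> \<delta> \<in> weights n \<Longrightarrow> \<gamma> - \<delta> \<in> weights n"
proof -
  assume "\<gamma> \<in> weights n" "\<delta> \<in> weights n"
  then obtain c d :: "nat \<Rightarrow> int"
    where "\<gamma> = (\<lambda>a. \<Sum>i = 1..n + 1. of_int (c i) * eps n i a)"
      "\<delta> = (\<lambda>a. \<Sum>i = 1..n + 1. of_int (d i) * eps n i a)"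
    unfolding weights_iff by blast
  then have "\<gamma> - \<delta> = (\<lambda>a. \<Sum>i = 1..n + 1. of_int (c i - d i) * eps n i a)"
    by (simp only: fun_eq_iff fun_diff_def of_int_diff left_diff_distrib sum_subtractf) simp
  then show ?thesis unfolding weights_iff by (intro exI[of _ "\<lambda>i. c i - d i"])
qed

lemma weights_zero: "0 \<in> weights n"
  unfolding weights_iff by (intro exI[of _ "\<lambda>_. 0"]) (simp add: fun_eq_iff)

lemma weights_eps: "i \<in> {1..n + 1} \<Longrightarrow> eps n i \<in> weights n"
  unfolding weights_iff
  by (intro exI[of _ "\<lambda>j. if j = i then 1 else 0"])
     (simp add: fun_eq_iff if_distrib[of of_int] if_distrib[of "\<lambda>x. x * _"] cong: if_cong)

lemma weights_act:
  assumes "w \<in> weyl n" "\<gamma> \<in> weights n"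
  shows "act w \<gamma> \<in> weights n"
proof -
  obtain c :: "nat \<Rightarrow> int" where c: "\<gamma> = (\<lambda>a. \<Sum>i = 1..n + 1. of_int (c i) * eps n i a)"
    using assms(2) weights_iff by blast
  have "act w \<gamma> = (\<lambda>a. \<Sum>i = 1..n + 1. of_int (c (inv w (w i))) * eps n (w i) a)"
    using fun_cong[OF act_eps[OF assms(1)]] assms(1)
    by (simp add: c fun_eq_iff act_def[of _ "\<lambda>a. sum _ _"]) (simp add: act_def)
  also have "\<dots> = (\<lambda>a. \<Sum>i = 1..n + 1. of_int (c (inv w i)) * eps n i a)"
    by (rule ext) (rule weyl_sum[OF assms(1)])
  finally show ?thesis
    unfolding weights_iff by (intro exI[of _ "\<lambda>i. c (inv w i)"])
qed

lemma weights_outside: "\<gamma> \<in> weights n \<Longrightarrow> a \<notin> {1..n + 1} \<Longrightarrow> \<gamma> a = 0"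
  unfolding weights_iff by (auto simp: eps_def)

lemma sum_eps: "i \<in> {1..n + 1} \<Longrightarrow> (\<Sum>a = 1..n + 1. eps n i a) = 0"
  by (simp add: eps_def sum_subtractf sum.delta del: of_nat_Suc)

lemma weights_sum:
  assumes "\<gamma> \<in> weights n"
  shows "(\<Sum>a = 1..n + 1. \<gamma> a) = 0"
proof -
  obtain c :: "nat \<Rightarrow> int" where c: "\<gamma> = (\<lambda>a. \<Sum>i = 1..n + 1. of_int (c i) * eps n i a)"
    using assms weights_iff by blast
  have "(\<Sum>a = 1..n + 1. \<gamma> a) = (\<Sum>i = 1..n + 1. of_int (c i) * (\<Sum>a = 1..n + 1. eps n i a))"
    unfolding c by (subst sum.swap) (simp only: sum_distrib_left)
  also have "\<dots> = 0"
    by (intro sum.neutral ballI) (simp only: sum_eps mult_zero_right)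
  finally show ?thesis .
qed

lemma weights_ambient: "\<gamma> \<in> weights n \<Longrightarrow> \<gamma> \<in> ambient n"
  using weights_sum weights_outside by (simp add: ambient_def)

text \<open>Coordinates of a vector in V sum to zero, so averaging the differences over b recovers
  each coordinate. In differences the summand 1/(n + 1) of \<open>eps\<close> cancels, which keeps
  later comparisons of weights integral.\<close>

lemma weights_eqI:
  assumes "\<gamma> \<in> ambient n" "\<delta> \<in> ambient n"
    and eq: "\<And>a b. a \<in> {1..n + 1} \<Longrightarrow> b \<in> {1..n + 1} \<Longrightarrow> \<gamma> a - \<gamma> b = \<delta> a - \<delta> b"
  shows "\<gamma> = \<delta>"
proof
  fix a
  show "\<gamma> a = \<delta> a"
  proof (cases "a \<in> {1..n + 1}")
    case True
    have "(\<Sum>b = 1..n + 1. \<gamma> a - \<gamma> b) = (\<Sum>b = 1..n + 1. \<delta> a - \<delta> b)"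
      using eq[OF True] by (intro sum.cong) auto
    then have "real (n + 1) * \<gamma> a = real (n + 1) * \<delta> a"
      using assms(1,2) by (simp add: sum_subtractf ambient_def)
    then show ?thesis by (simp del: of_nat_Suc)
  next
    case False
    then show ?thesis using assms(1,2) by (auto simp: ambient_def)
  qed
qed

lemma weights_diff_int:
  assumes "\<gamma> \<in> weights n" "a \<in> {1..n + 1}" "b \<in> {1..n + 1}"
  shows "\<gamma> a - \<gamma> b \<in> \<int>"
proof -
  obtain c :: "nat \<Rightarrow> int" where c: "\<gamma> = (\<lambda>a. \<Sum>i = 1..n + 1. of_int (c i) * eps n i a)"
    using assms weights_iff by blast
  have "\<gamma> a - \<gamma> b = (\<Sum>i = 1..n + 1. of_int (c i) * (eps n i a - eps n i b))"
    unfolding c by (simp only: sum_subtractf right_diff_distrib)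
  moreover have "eps n i a - eps n i b \<in> \<int>" for i
    using assms(2,3) by (auto simp: eps_def)
  ultimately show ?thesis
    by (auto intro!: Ints_sum Ints_mult simp del: sum.cl_ivl_Suc)
qed

lemma inprod_eps_diff:
  assumes "i \<in> {1..n + 1}" "j \<in> {1..n + 1}"
  shows "inprod n \<gamma> (eps n i - eps n j) = \<gamma> i - \<gamma> j"
proof -
  have "inprod n \<gamma> (eps n i - eps n j)
      = (\<Sum>a = 1..n + 1. (if a = i then \<gamma> a else 0) - (if a = j then \<gamma> a else 0))"
    unfolding inprod_def by (intro sum.cong) (auto simp: eps_def algebra_simps)
  also have "\<dots> = \<gamma> i - \<gamma> j"
    using assms by (simp only: sum_subtractf sum.delta finite_atLeastAtMost if_True)
  finally show ?thesis .
qed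

lemma dominant_iff:
  "\<gamma> \<in> dominant n \<longleftrightarrow> \<gamma> \<in> weights n \<and> (\<forall>i j. 1 \<le> i \<longrightarrow> i < j \<longrightarrow> j \<le> n + 1 \<longrightarrow> \<gamma> j \<le> \<gamma> i)"
proof -
  have "0 \<le> inprod n \<gamma> (eps n i - eps n j) \<longleftrightarrow> \<gamma> j \<le> \<gamma> i" if "1 \<le> i" "i < j" "j \<le> n + 1" for i j
    using that by (subst inprod_eps_diff) auto
  then show ?thesis unfolding dominant_def pos_roots_def by auto blast+
qed

lemma dominant_add: "\<mu> \<in> dominant n \<Longrightarrow> \<nu> \<in> dominant n \<Longrightarrow> \<mu> + \<nu> \<in> dominant n"
  by (auto simp: dominant_iff weights_add add_mono)

section \<open>The length function\<close>

definition pairs :: "nat \<Rightarrow> (nat \<times> nat) set" where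
  "pairs n = {(a, b). 1 \<le> a \<and> a < b \<and> b \<le> n + 1}"

lemma finite_pairs [simp]: "finite (pairs n)"
  by (rule finite_subset[of _ "{1..n + 1} \<times> {1..n + 1}"]) (auto simp: pairs_def)

text \<open>The alcove \<open>x A\<^sub>0\<close> lies between the hyperplanes \<open>\<langle>v, e\<^sub>a - e\<^sub>b\<rangle> = strip x a b\<close> and \<open>strip x a b + 1\<close>,
  so that the sum of the \<open>\<bar>strip x a b\<bar>\<close> counts the hyperplanes separating it from \<open>A\<^sub>0\<close>.\<close>

definition strip :: "aff \<Rightarrow> nat \<Rightarrow> nat \<Rightarrow> real" where
  "strip x a b = fst x a - fst x b - (if inv (snd x) b < inv (snd x) a then 1 else 0)"

definition hyp_count :: "nat \<Rightarrow> aff \<Rightarrow> real" where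
  "hyp_count n x = (\<Sum>(a, b)\<in>pairs n. \<bar>strip x a b\<bar>)"

lemma ext_weylI: "\<gamma> \<in> weights n \<Longrightarrow> w \<in> weyl n \<Longrightarrow> (\<gamma>, w) \<in> ext_weyl n"
  by (simp add: ext_weyl_def)

lemma ext_weyl_mult: "x \<in> ext_weyl n \<Longrightarrow> y \<in> ext_weyl n \<Longrightarrow> aff_mult x y \<in> ext_weyl n"
  by (auto simp: ext_weyl_def aff_mult_def weights_add weights_act weyl_comp)

lemma aff_mult_assoc:
  "x \<in> ext_weyl n \<Longrightarrow> y \<in> ext_weyl n \<Longrightarrow> aff_mult (aff_mult x y) z = aff_mult x (aff_mult y z)"
  by (auto simp: ext_weyl_def aff_mult_def act_comp act_add add.assoc comp_assoc)

lemma aff_mult_fin_id [simp]: "aff_mult (fin id) x = x" "aff_mult x (fin id) = x"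
  by (simp_all add: aff_mult_def fin_def)

lemma fin_mem: "w \<in> weyl n \<Longrightarrow> fin w \<in> ext_weyl n"
  by (simp add: fin_def ext_weylI weights_zero)

lemma transl_mem: "\<gamma> \<in> weights n \<Longrightarrow> transl \<gamma> \<in> ext_weyl n"
  by (simp add: transl_def ext_weylI weyl_id)

lemma fin_mult: "aff_mult (fin v) (fin w) = fin (v \<circ> w)"
  by (simp add: aff_mult_def fin_def)

lemma transl_mult: "aff_mult (transl \<gamma>) (transl \<delta>) = transl (\<gamma> + \<delta>)"
  by (simp add: aff_mult_def transl_def)

lemma aff_gen_fin: "1 \<le> i \<Longrightarrow> aff_gen n i = fin (transpose i (i + 1))"
  by (simp add: aff_gen_def)

lemma weyl_simple: "1 \<le> i \<Longrightarrow> i \<le> n \<Longrightarrow> transpose i (i + 1) \<in> weyl n"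
  by (rule weyl_transpose) auto

lemma aff_gen_mult_fin:
  "1 \<le> i \<Longrightarrow> aff_mult (aff_gen n i) x = (act (transpose i (i + 1)) (fst x), transpose i (i + 1) \<circ> snd x)"
  by (simp add: aff_gen_def aff_mult_def fin_def)

lemma aff_gen_mult_0:
  "aff_mult (aff_gen n 0) x =
     (eps n 1 - eps n (n + 1) + act (transpose 1 (n + 1)) (fst x), transpose 1 (n + 1) \<circ> snd x)"
  by (simp add: aff_gen_def aff_mult_def fin_def transl_def)

lemma aff_gen_mem: "i \<le> n \<Longrightarrow> aff_gen n i \<in> ext_weyl n"
  unfolding aff_gen_def
  by (auto intro!: ext_weyl_mult transl_mem fin_mem weights_diff weights_eps weyl_transpose)

lemma aff_gen_square: "i \<le> n \<Longrightarrow> aff_mult (aff_gen n i) (aff_gen n i) = fin id"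
proof (cases "i = 0")
  case True
  have t: "transpose 1 (n + 1) \<in> weyl n" by (rule weyl_transpose) auto
  have "act (transpose 1 (n + 1)) (eps n 1 - eps n (n + 1)) = eps n (n + 1) - eps n 1"
    by (simp only: act_diff act_eps[OF t] transpose_apply_first transpose_apply_second)
  then show ?thesis
    unfolding True aff_gen_mult_0 by (simp add: aff_gen_def aff_mult_def transl_def fin_def)
next
  case False
  then show ?thesis
    by (simp add: aff_gen_fin fin_mult)
qed

lemma aff_gen_cancel:
  "i \<le> n \<Longrightarrow> x \<in> ext_weyl n \<Longrightarrow> aff_mult (aff_gen n i) (aff_mult (aff_gen n i) x) = x"
  by (simp add: aff_mult_assoc[symmetric, OF aff_gen_mem aff_gen_mem] aff_gen_square)

section \<open>Effect of a generator on the hyperplane count\<close>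

lemma strip_int:
  assumes "x \<in> ext_weyl n" "a \<in> {1..n + 1}" "b \<in> {1..n + 1}"
  shows "strip x a b \<in> \<int>"
proof -
  have "fst x a - fst x b \<in> \<int>"
    using assms by (intro weights_diff_int[of _ n]) (auto simp: ext_weyl_def)
  then show ?thesis unfolding strip_def by simp
qed

text \<open>For the negative root, values between k and k + 1 become values between -k - 1 and
  -k.\<close>

lemma strip_swap:
  assumes "x \<in> ext_weyl n" "a \<noteq> b"
  shows "strip x b a = - strip x a b - 1"
proof -
  have "inv (snd x) a \<noteq> inv (snd x) b"
    using assms weyl_eq_iff[OF weyl_inv] by (auto simp: ext_weyl_def)
  then show ?thesis by (auto simp: strip_def)
qed

lemma strip_fin:
  assumes "x \<in> ext_weyl n" "1 \<le> i" "i \<le> n"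
  shows "strip (aff_mult (aff_gen n i) x) a b = strip x (transpose i (i + 1) a) (transpose i (i + 1) b)"
proof -
  have "inv (transpose i (i + 1) \<circ> snd x) = inv (snd x) \<circ> transpose i (i + 1)"
    using assms weyl_inv_comp[OF weyl_simple[OF assms(2,3)]] by (auto simp: ext_weyl_def)
  then show ?thesis
    using assms(2) by (simp add: strip_def aff_gen_mult_fin act_def)
qed

lemma strip_0:
  assumes "x \<in> ext_weyl n"
  shows "strip (aff_mult (aff_gen n 0) x) a b =
    strip x (transpose 1 (n + 1) a) (transpose 1 (n + 1) b) + (eps n 1 a - eps n 1 b)
      - (eps n (n + 1) a - eps n (n + 1) b)"
proof -
  have t: "transpose 1 (n + 1) \<in> weyl n" by (rule weyl_transpose) auto
  have "inv (transpose 1 (n + 1) \<circ> snd x) = inv (snd x) \<circ> transpose 1 (n + 1)"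
    using assms weyl_inv_comp[OF t] by (auto simp: ext_weyl_def)
  then show ?thesis
    by (simp add: strip_def aff_gen_mult_0 act_def)
qed

text \<open>The simple reflection s_i permutes the positive roots other than alpha_i; being an
  involution, it only has to preserve this set.\<close>

lemma pairs_simple:
  assumes "1 \<le> i" "i \<le> n" "(a, b) \<in> pairs n - {(i, i + 1)}"
  shows "(transpose i (i + 1) a, transpose i (i + 1) b) \<in> pairs n - {(i, i + 1)}"
  using assms by (auto simp: pairs_def transpose_def)

lemma hyp_count_fin:
  assumes x: "x \<in> ext_weyl n" and i: "1 \<le> i" "i \<le> n"
  shows "hyp_count n (aff_mult (aff_gen n i) x)
       = hyp_count n x - \<bar>strip x i (i + 1)\<bar> + \<bar>strip x i (i + 1) + 1\<bar>"
proof -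
  let ?t = "transpose i (i + 1)" and ?P = "pairs n - {(i, i + 1)}"
  have mem: "(i, i + 1) \<in> pairs n" using i by (simp add: pairs_def)
  have "(\<Sum>(a, b)\<in>?P. \<bar>strip x (?t a) (?t b)\<bar>) = (\<Sum>(a, b)\<in>?P. \<bar>strip x a b\<bar>)"
    by (rule sum.reindex_bij_witness[of _ "\<lambda>(a, b). (?t a, ?t b)" "\<lambda>(a, b). (?t a, ?t b)"])
       (use pairs_simple[OF i] in auto)
  moreover have "strip x (i + 1) i = - strip x i (i + 1) - 1"
    using strip_swap[OF x, of i "i + 1"] by simp
  ultimately show ?thesis
    unfolding hyp_count_def strip_fin[OF x i] by (simp add: sum.remove[OF finite_pairs mem])
qed

lemma hyp_count_0:
  assumes x: "x \<in> ext_weyl n" and n: "1 \<le> n"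
  shows "hyp_count n (aff_mult (aff_gen n 0) x)
       = hyp_count n x - \<bar>strip x 1 (n + 1)\<bar> + \<bar>strip x 1 (n + 1) - 1\<bar>"
proof -
  let ?t = "transpose 1 (n + 1)" and ?P = "pairs n - {(1, n + 1)}"
  let ?y = "aff_mult (aff_gen n 0) x"
  \<comment> \<open>This involution exchanges e_1 - e_b with e_b - e_(n+1). The shift by 1 from the
    translation part of s_0 cancels the -1 of \<open>strip_swap\<close>, so absolute values are
    preserved on \<open>?P\<close>.\<close>
  let ?f = "\<lambda>(a, b). if a = 1 then (b, n + 1) else if b = n + 1 then (1, a) else (a, b)"
  have mem: "(1, n + 1) \<in> pairs n" using n by (simp add: pairs_def)
  have y: "\<bar>strip ?y a b\<bar> = \<bar>strip x (fst (?f (a, b))) (snd (?f (a, b)))\<bar>" if "(a, b) \<in> ?P" for a b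
  proof -
    from that have ab: "1 \<le> a" "a < b" "b \<le> n + 1" "\<not> (a = 1 \<and> b = n + 1)" by (auto simp: pairs_def)
    consider "a = 1" "b \<noteq> n + 1" | "a \<noteq> 1" "b = n + 1" | "a \<noteq> 1" "b \<noteq> n + 1" using ab by blast
    then show ?thesis
    proof cases
      case 1
      with ab strip_swap[OF x, of b "n + 1"] show ?thesis
        by (simp add: strip_0[OF x] eps_def)
    next
      case 2
      with ab strip_swap[OF x, of a 1] show ?thesis
        by (simp add: strip_0[OF x] eps_def)
    next
      case 3
      with ab show ?thesis by (simp add: strip_0[OF x] eps_def)
    qed
  qed
  have "(\<Sum>(a, b)\<in>?P. \<bar>strip ?y a b\<bar>) = (\<Sum>p\<in>?P. \<bar>strip x (fst (?f p)) (snd (?f p))\<bar>)"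
    by (rule sum.cong) (use y in auto)
  also have "\<dots> = (\<Sum>(a, b)\<in>?P. \<bar>strip x a b\<bar>)"
    by (rule sum.reindex_bij_witness[of _ ?f ?f]) (auto simp: pairs_def split: if_splits)
  finally have P: "(\<Sum>(a, b)\<in>?P. \<bar>strip ?y a b\<bar>) = (\<Sum>(a, b)\<in>?P. \<bar>strip x a b\<bar>)" .
  have "\<bar>strip ?y 1 (n + 1)\<bar> = \<bar>strip x 1 (n + 1) - 1\<bar>"
    using n strip_swap[OF x, of 1 "n + 1"] by (simp add: strip_0[OF x] eps_def)
  with P show ?thesis
    unfolding hyp_count_def by (simp add: sum.remove[OF finite_pairs mem])
qed

lemma hyp_count_step:
  assumes "x \<in> ext_weyl n" "1 \<le> n" "i \<le> n"
  shows "hyp_count n (aff_mult (aff_gen n i) x) \<le> hyp_count n x + 1"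
  using hyp_count_0[OF assms(1,2)] hyp_count_fin[OF assms(1) _ assms(3)]
  by (cases "i = 0") auto

lemma hyp_count_nonneg: "0 \<le> hyp_count n x"
  unfolding hyp_count_def by (intro sum_nonneg) auto

text \<open>Integrality excludes the values where the absolute value would change by less than one;
  hence every generator changes the count by exactly 1.\<close>

lemma Ints_abs_add_one:
  fixes m :: real
  assumes "m \<in> \<int>"
  shows "\<bar>m + 1\<bar> = \<bar>m\<bar> + (if 0 \<le> m then 1 else - 1)" "\<bar>m - 1\<bar> = \<bar>m\<bar> + (if m \<le> 0 then 1 else - 1)"
proof -
  obtain k :: int where "m = of_int k" using assms by (auto elim: Ints_cases)
  moreover have "\<bar>k + 1\<bar> = \<bar>k\<bar> + (if 0 \<le> k then 1 else - 1)"
    "\<bar>k - 1\<bar> = \<bar>k\<bar> + (if k \<le> 0 then 1 else - 1)" by auto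
  ultimately show "\<bar>m + 1\<bar> = \<bar>m\<bar> + (if 0 \<le> m then 1 else - 1)"
    "\<bar>m - 1\<bar> = \<bar>m\<bar> + (if m \<le> 0 then 1 else - 1)"
    by (simp_all flip: of_int_add of_int_abs of_int_diff add: of_int_add[symmetric] split: if_splits)
qed

lemma hyp_count_gen:
  assumes "x \<in> ext_weyl n" "1 \<le> i" "i \<le> n"
  shows "hyp_count n (aff_mult (aff_gen n i) x) = hyp_count n x + (if 0 \<le> strip x i (i + 1) then 1 else - 1)"
  using hyp_count_fin[OF assms] Ints_abs_add_one(1)[OF strip_int[OF assms(1), of i "i + 1"]] assms(2,3)
  by simp

lemma hyp_count_gen_0:
  assumes "x \<in> ext_weyl n" "1 \<le> n"
  shows "hyp_count n (aff_mult (aff_gen n 0) x) = hyp_count n x + (if strip x 1 (n + 1) \<le> 0 then 1 else - 1)"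
  using hyp_count_0[OF assms] Ints_abs_add_one(2)[OF strip_int[OF assms(1), of 1 "n + 1"]] assms(2)
  by simp

text \<open>The translation parts add up exactly, and an inversion of (a, c) forces an inversion of
  (a, b) or of (b, c).\<close>

lemma strip_superadditive: "strip x a b + strip x b c \<le> strip x a c"
  by (auto simp: strip_def)

lemma strip_nonneg:
  assumes "\<And>i. 1 \<le> i \<Longrightarrow> i \<le> n \<Longrightarrow> 0 \<le> strip x i (i + 1)"
  shows "1 \<le> a \<Longrightarrow> a < b \<Longrightarrow> b \<le> n + 1 \<Longrightarrow> 0 \<le> strip x a b"
proof (induction b)
  case (Suc b)
  show ?case
  proof (cases "a = b")
    case True
    then show ?thesis using assms[of a] Suc.prems by simp
  next
    case False
    then have "0 \<le> strip x a b" "0 \<le> strip x b (Suc b)"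
      using Suc.IH Suc.prems assms[of b] by auto
    then show ?thesis using strip_superadditive[of x a b "Suc b"] by linarith
  qed
qed simp

lemma hyp_count_eq_0_iff:
  "hyp_count n x = 0 \<longleftrightarrow> (\<forall>a b. 1 \<le> a \<longrightarrow> a < b \<longrightarrow> b \<le> n + 1 \<longrightarrow> strip x a b = 0)"
  unfolding hyp_count_def
  by (subst sum_nonneg_eq_0_iff[OF finite_pairs]) (auto simp: pairs_def)

text \<open>If no s_i with i > 0 descends, all strips are nonnegative and superadditivity makes the
  strip of the highest root the largest one. If s_0 does not descend either, that strip is at most
  0, so all strips vanish.\<close>

lemma hyp_count_descent:
  assumes "x \<in> ext_weyl n" "1 \<le> n" "hyp_count n x \<noteq> 0"
  obtains i where "i \<le> n" "hyp_count n (aff_mult (aff_gen n i) x) = hyp_count n x - 1"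
proof (cases "\<exists>i. 1 \<le> i \<and> i \<le> n \<and> strip x i (i + 1) < 0")
  case True
  then obtain i where "1 \<le> i" "i \<le> n" "strip x i (i + 1) < 0" by blast
  then show thesis using that[of i] hyp_count_gen[OF assms(1), of i] by auto
next
  case False
  then have nonneg: "0 \<le> strip x a b" if "1 \<le> a" "a < b" "b \<le> n + 1" for a b
    using strip_nonneg[of n x a b] that by force
  have "\<not> strip x 1 (n + 1) \<le> 0"
  proof
    assume le: "strip x 1 (n + 1) \<le> 0"
    have "strip x a b = 0" if ab: "1 \<le> a" "a < b" "b \<le> n + 1" for a b
    proof -
      have "strip x a b \<le> strip x 1 b"
        using ab strip_superadditive[of x 1 a b] nonneg[of 1 a] by (cases "a = 1") auto
      also have "\<dots> \<le> strip x 1 (n + 1)"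
        using ab strip_superadditive[of x 1 b "n + 1"] nonneg[of b "n + 1"] by (cases "b = n + 1") auto
      finally show ?thesis using le nonneg[OF ab] by linarith
    qed
    then show False using assms(3) hyp_count_eq_0_iff by blast
  qed
  then show thesis using that[of 0] hyp_count_gen_0[OF assms(1,2)] by simp
qed

section \<open>The stabiliser of the fundamental alcove\<close>

definition aff_inv :: "aff \<Rightarrow> aff" where
  "aff_inv x = (- act (inv (snd x)) (fst x), inv (snd x))"

lemma aff_inv_mem: "x \<in> ext_weyl n \<Longrightarrow> aff_inv x \<in> ext_weyl n"
  using weights_diff[OF weights_zero] weights_act[OF weyl_inv]
  by (auto simp: ext_weyl_def aff_inv_def weyl_inv)

lemma aff_inv_mult:
  assumes "x \<in> ext_weyl n"
  shows "aff_mult x (aff_inv x) = fin id" "aff_mult (aff_inv x) x = fin id"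
proof -
  have w: "snd x \<in> weyl n" using assms by (auto simp: ext_weyl_def)
  have "act (snd x) (- act (inv (snd x)) (fst x)) = - fst x"
    using act_diff[of "snd x" 0 "act (inv (snd x)) (fst x)"] w by simp
  then show "aff_mult x (aff_inv x) = fin id" "aff_mult (aff_inv x) x = fin id"
    using w by (simp_all add: aff_mult_def aff_inv_def fin_def)
qed

text \<open>Vanishing strips of x express differences of the translation part as indicators of
  inversions; these are read off at (w a, w b), in whichever order is increasing. The result serves
  to show that x maps the alcove onto itself and, later, to invert T_x for x in Sigma.\<close>

lemma hyp_count_inv_0:
  assumes x: "x \<in> ext_weyl n" and "hyp_count n x = 0"
  shows "hyp_count n (aff_inv x) = 0"
  unfolding hyp_count_eq_0_iff
proof (intro allI impI)
  fix a b assume ab: "1 \<le> a" "a < b" "b \<le> n + 1"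
  define w where "w = snd x"
  have w: "w \<in> weyl n" using x by (auto simp: ext_weyl_def w_def)
  have range: "1 \<le> w a" "1 \<le> w b" "w a \<le> n + 1" "w b \<le> n + 1"
    using weyl_in_range[OF w, of a] weyl_in_range[OF w, of b] ab by auto
  have zero: "strip x c d = 0" if "1 \<le> c" "c < d" "d \<le> n + 1" for c d
    using assms(2) that hyp_count_eq_0_iff by blast
  have "strip (aff_inv x) a b = fst x (w b) - fst x (w a) - (if w b < w a then 1 else 0)"
    using weyl_inv_inv[OF w] by (simp add: strip_def aff_inv_def act_def flip: w_def)
  moreover have "w a \<noteq> w b" using weyl_eq_iff[OF w] ab by simp
  moreover have "fst x (w a) - fst x (w b) = 0" if "w a < w b"
    using zero[OF range(1) that range(4)] ab w by (simp add: strip_def flip: w_def)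
  moreover have "fst x (w b) - fst x (w a) = 1" if "w b < w a"
    using zero[OF range(2) that range(3)] ab w by (simp add: strip_def flip: w_def)
  ultimately show "strip (aff_inv x) a b = 0" by force
qed

lemma fund_alcove_iff:
  "v \<in> fund_alcove n \<longleftrightarrow>
     v \<in> ambient n \<and> (\<forall>a b. 1 \<le> a \<longrightarrow> a < b \<longrightarrow> b \<le> n + 1 \<longrightarrow> 0 \<le> v a - v b \<and> v a - v b \<le> 1)"
proof -
  have key: "inprod n v (eps n i - eps n j) = v i - v j" if "1 \<le> i" "i < j" "j \<le> n + 1" for i j
    using that by (subst inprod_eps_diff) auto
  have eq: "(\<forall>\<alpha>\<in>pos_roots n. R (inprod n v \<alpha>)) \<longleftrightarrow>
      (\<forall>a b. 1 \<le> a \<longrightarrow> a < b \<longrightarrow> b \<le> n + 1 \<longrightarrow> R (v a - v b))" for R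
  proof -
    have "(\<forall>\<alpha>\<in>pos_roots n. R (inprod n v \<alpha>)) \<longleftrightarrow>
      (\<forall>a b. 1 \<le> a \<longrightarrow> a < b \<longrightarrow> b \<le> n + 1 \<longrightarrow> R (inprod n v (eps n a - eps n b)))"
      unfolding pos_roots_def by blast
    also have "\<dots> \<longleftrightarrow> (\<forall>a b. 1 \<le> a \<longrightarrow> a < b \<longrightarrow> b \<le> n + 1 \<longrightarrow> R (v a - v b))"
      by (simp add: key cong: imp_cong)
    finally show ?thesis .
  qed
  show ?thesis
    unfolding fund_alcove_def using eq[of "\<lambda>t. 0 \<le> t \<and> t \<le> 1"] by simp
qed

lemma ambient_act:
  assumes "w \<in> weyl n" "v \<in> ambient n"
  shows "act w v \<in> ambient n"
proof -
  have "(\<Sum>j = 1..n + 1. v (inv w j)) = (\<Sum>j = 1..n + 1. v j)"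
    by (rule weyl_sum[OF weyl_inv[OF assms(1)]])
  moreover have "v (inv w j) = 0" if "j \<notin> {1..n + 1}" for j
    using that weyl_in_range[OF weyl_inv[OF assms(1)], of j] assms(2) unfolding ambient_def by blast
  ultimately show ?thesis using assms(2) by (simp add: ambient_def act_def)
qed

lemma aff_act_ambient:
  assumes "x \<in> ext_weyl n" "v \<in> ambient n"
  shows "aff_act x v \<in> ambient n"
proof -
  have "fst x \<in> ambient n" "act (snd x) v \<in> ambient n"
    using assms weights_ambient ambient_act by (auto simp: ext_weyl_def)
  then show ?thesis by (simp add: ambient_def aff_act_def sum.distrib del: sum.cl_ivl_Suc)
qed

lemma aff_act_mult: "x \<in> ext_weyl n \<Longrightarrow> y \<in> ext_weyl n \<Longrightarrow> aff_act (aff_mult x y) v = aff_act x (aff_act y v)"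
  by (auto simp: ext_weyl_def aff_mult_def aff_act_def act_comp act_add add.assoc)

lemma aff_act_alcove:
  assumes x: "x \<in> ext_weyl n" and "hyp_count n x = 0" and v: "v \<in> fund_alcove n"
  shows "aff_act x v \<in> fund_alcove n"
  unfolding fund_alcove_iff
proof (intro conjI allI impI)
  show "aff_act x v \<in> ambient n"
    using v aff_act_ambient[OF x] by (simp add: fund_alcove_iff)
  fix a b assume ab: "1 \<le> a" "a < b" "b \<le> n + 1"
  let ?u = "inv (snd x)"
  have u: "?u \<in> weyl n" using x weyl_inv by (auto simp: ext_weyl_def)
  have r: "1 \<le> ?u a" "1 \<le> ?u b" "?u a \<le> n + 1" "?u b \<le> n + 1"
    using weyl_in_range[OF u, of a] weyl_in_range[OF u, of b] ab by auto
  have "?u a \<noteq> ?u b" using weyl_eq_iff[OF u] ab by simp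
  then consider "?u a < ?u b" | "?u b < ?u a" by linarith
  then have "0 \<le> aff_act x v a - aff_act x v b \<and> aff_act x v a - aff_act x v b \<le> 1"
  proof cases
    case 1
    have "0 \<le> v (?u a) - v (?u b) \<and> v (?u a) - v (?u b) \<le> 1"
      using v r 1 by (auto simp: fund_alcove_iff)
    moreover have "strip x a b = 0" using assms(2) ab by (auto simp: hyp_count_eq_0_iff)
    ultimately show ?thesis using 1 by (simp add: aff_act_def act_def strip_def)
  next
    case 2
    have "0 \<le> v (?u b) - v (?u a) \<and> v (?u b) - v (?u a) \<le> 1"
      using v r 2 by (auto simp: fund_alcove_iff)
    moreover have "strip x a b = 0" using assms(2) ab by (auto simp: hyp_count_eq_0_iff)
    ultimately show ?thesis using 2 by (simp add: aff_act_def act_def strip_def)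
  qed
  then show "0 \<le> aff_act x v a - aff_act x v b" "aff_act x v a - aff_act x v b \<le> 1" by auto
qed

text \<open>This is half the sum of the positive roots, divided by n + 2. A positive root of height
  m takes the value m/(n + 2) with 1 \<le> m \<le> n, strictly between 0 and 1.\<close>

definition interior_point :: "nat \<Rightarrow> weight" where
  "interior_point n a = (if a \<in> {1..n + 1} then 1 / 2 - real a / real (n + 2) else 0)"

lemma interior_point_ambient: "interior_point n \<in> ambient n"
proof -
  have "(\<Sum>a = 1..n + 1. interior_point n a) = (\<Sum>a = 1..n + 1. 1 / 2 - real a / real (n + 2))"
    by (rule sum.cong) (auto simp: interior_point_def)
  also have "\<dots> = real (n + 1) / 2 - (\<Sum>a = 1..n + 1. real a) / real (n + 2)"
    by (simp only: sum_subtractf sum_divide_distrib) simp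
  also have "(\<Sum>a = 1..n + 1. real a) = real (n + 1) * real (n + 2) / 2"
    using double_gauss_sum_from_Suc_0[of "n + 1", where ?'a = real] by simp
  also have "real (n + 1) / 2 - real (n + 1) * real (n + 2) / 2 / real (n + 2) = 0"
    by (simp add: divide_simps del: of_nat_Suc of_nat_add)
  finally show ?thesis by (simp add: ambient_def interior_point_def)
qed

lemma interior_point_diff:
  assumes "1 \<le> a" "a < b" "b \<le> n + 1"
  shows "0 < interior_point n a - interior_point n b" "interior_point n a - interior_point n b < 1"
  using assms by (simp_all add: interior_point_def divide_simps)

text \<open>If no hyperplane separates the two alcoves, x and its inverse both map the closed alcove
  into itself. Conversely, the image of one interior point already forces all strips to
  vanish.\<close>

lemma Sigma_iff:
  assumes x: "x \<in> ext_weyl n"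
  shows "x \<in> Sigma_grp n \<longleftrightarrow> hyp_count n x = 0"
proof
  assume zero: "hyp_count n x = 0"
  have "aff_act x ` fund_alcove n = fund_alcove n"
  proof (intro equalityI subsetI)
    fix v assume "v \<in> aff_act x ` fund_alcove n"
    then show "v \<in> fund_alcove n" using aff_act_alcove[OF x zero] by blast
  next
    fix v assume "v \<in> fund_alcove n"
    then have "aff_act (aff_inv x) v \<in> fund_alcove n"
      using aff_act_alcove[OF aff_inv_mem[OF x] hyp_count_inv_0[OF x zero]] by blast
    moreover have "v = aff_act x (aff_act (aff_inv x) v)"
      using aff_act_mult[OF x aff_inv_mem[OF x], of v] aff_inv_mult(1)[OF x]
      by (simp add: aff_act_def fin_def)
    ultimately show "v \<in> aff_act x ` fund_alcove n" by blast
  qed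
  then show "x \<in> Sigma_grp n" using x by (simp add: Sigma_grp_def)
next
  assume "x \<in> Sigma_grp n"
  moreover have "interior_point n \<in> fund_alcove n"
    unfolding fund_alcove_iff using interior_point_ambient interior_point_diff by (auto simp: less_imp_le)
  ultimately have im: "aff_act x (interior_point n) \<in> fund_alcove n" by (auto simp: Sigma_grp_def)
  show "hyp_count n x = 0"
    unfolding hyp_count_eq_0_iff
  proof (intro allI impI)
    fix a b assume ab: "1 \<le> a" "a < b" "b \<le> n + 1"
    let ?u = "inv (snd x)"
    have u: "?u \<in> weyl n" using x weyl_inv by (auto simp: ext_weyl_def)
    have r: "1 \<le> ?u a" "1 \<le> ?u b" "?u a \<le> n + 1" "?u b \<le> n + 1"
      using weyl_in_range[OF u, of a] weyl_in_range[OF u, of b] ab by auto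
    have "?u a \<noteq> ?u b" using weyl_eq_iff[OF u] ab by simp
    then consider "?u a < ?u b" | "?u b < ?u a" by linarith
    moreover obtain k :: int where k: "strip x a b = of_int k"
      using strip_int[OF x, of a b] ab by (auto elim: Ints_cases)
    moreover have "0 \<le> aff_act x (interior_point n) a - aff_act x (interior_point n) b"
      "aff_act x (interior_point n) a - aff_act x (interior_point n) b \<le> 1"
      using im ab by (auto simp: fund_alcove_iff)
    \<comment> \<open>The value at the image point lies in the open interval (k, k + 1) and also in
      [0, 1].\<close>
    ultimately have "of_int (- 1) < (of_int k :: real) \<and> (of_int k :: real) < of_int 1"
      using interior_point_diff[of "?u a" "?u b" n] interior_point_diff[of "?u b" "?u a" n] r
      by cases (auto simp: aff_act_def act_def strip_def)
    then have "k = 0" by (simp only: of_int_less_iff) linarith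
    then show "strip x a b = 0" using k by simp
  qed
qed

lemma hyp_count_int: "x \<in> ext_weyl n \<Longrightarrow> hyp_count n x \<in> \<int>"
  unfolding hyp_count_def by (intro Ints_sum) (auto simp: pairs_def intro!: Ints_abs strip_int)

lemma hyp_count_nat:
  assumes "x \<in> ext_weyl n"
  obtains k where "hyp_count n x = real k"
  using hyp_count_int[OF assms] hyp_count_nonneg[of n x]
  by (metis Ints_cases of_int_0_le_iff of_int_of_nat_eq zero_le_imp_eq_int)

lemma aff_word_mem: "set is \<subseteq> {0..n} \<Longrightarrow> aff_word n is \<in> ext_weyl n"
  by (induction "is") (auto simp: aff_word_def fin_mem weyl_id intro!: ext_weyl_mult aff_gen_mem)

lemma aff_word_Cons:
  assumes "set (i # is) \<subseteq> {0..n}"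
  shows "aff_mult (aff_word n (i # is)) \<pi> = aff_mult (aff_gen n i) (aff_mult (aff_word n is) \<pi>)"
  using aff_mult_assoc[OF aff_gen_mem[of i n] aff_word_mem[of "is" n]] assms
  by (simp add: aff_word_def)

text \<open>Greedy descent yields a word with as many letters as there are separating hyperplanes.
  No word is shorter, since a letter raises the count by at most one and Sigma has count
  zero.\<close>

lemma ext_length_eq:
  assumes n: "1 \<le> n" and x: "x \<in> ext_weyl n"
  shows "real (ext_length n x) = hyp_count n x"
proof -
  define P where "P x k \<longleftrightarrow> (\<exists>is \<pi>. length is = k \<and> set is \<subseteq> {0..n} \<and> \<pi> \<in> Sigma_grp n \<and>
        x = aff_mult (aff_word n is) \<pi>)" for x k
  have upper: "P x k" if "x \<in> ext_weyl n" "hyp_count n x = real k" for x k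
    using that
  proof (induction k arbitrary: x)
    case 0
    then show ?case
      using Sigma_iff[of x n] unfolding P_def by (intro exI[of _ "[]"] exI[of _ x]) (simp add: aff_word_def)
  next
    case (Suc k)
    obtain i where i: "i \<le> n" "hyp_count n (aff_mult (aff_gen n i) x) = hyp_count n x - 1"
      using hyp_count_descent[OF Suc.prems(1) n] Suc.prems(2) by auto
    then have "P (aff_mult (aff_gen n i) x) k"
      using Suc.prems by (intro Suc.IH ext_weyl_mult aff_gen_mem) auto
    then obtain "is" \<pi> where w: "length is = k" "set is \<subseteq> {0..n}" "\<pi> \<in> Sigma_grp n"
      "aff_mult (aff_gen n i) x = aff_mult (aff_word n is) \<pi>"
      unfolding P_def by blast
    then have "x = aff_mult (aff_word n (i # is)) \<pi>"
      using aff_gen_cancel[OF i(1) Suc.prems(1)] i(1) by (simp add: aff_word_Cons)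
    then show ?case unfolding P_def using w i(1) by (intro exI[of _ "i # is"] exI[of _ \<pi>]) auto
  qed
  have lower: "hyp_count n x \<le> real k" if "P x k" for x k
  proof -
    have "hyp_count n (aff_mult (aff_word n is) \<pi>) \<le> real (length is)"
      if "set is \<subseteq> {0..n}" and \<pi>: "\<pi> \<in> Sigma_grp n" for "is" \<pi>
      using that(1)
    proof (induction "is")
      case Nil
      then show ?case using \<pi> Sigma_iff[of \<pi> n] by (simp add: aff_word_def Sigma_grp_def)
    next
      case (Cons i "is")
      have "aff_mult (aff_word n is) \<pi> \<in> ext_weyl n"
        using Cons.prems \<pi> by (intro ext_weyl_mult aff_word_mem) (auto simp: Sigma_grp_def)
      then have "hyp_count n (aff_mult (aff_gen n i) (aff_mult (aff_word n is) \<pi>))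
          \<le> hyp_count n (aff_mult (aff_word n is) \<pi>) + 1"
        using Cons.prems n by (intro hyp_count_step) auto
      moreover have "hyp_count n (aff_mult (aff_word n is) \<pi>) \<le> real (length is)"
        using Cons by simp
      ultimately show ?case
        unfolding aff_word_Cons[OF Cons.prems] by simp
    qed
    then show ?thesis using that unfolding P_def by blast
  qed
  obtain k where k: "hyp_count n x = real k" using hyp_count_nat[OF x] .
  have "ext_length n x = (LEAST k. P x k)"
    unfolding ext_length_def P_def ..
  also have "\<dots> = k"
    using upper[OF x k] lower[of x] k by (intro Least_equality) auto
  finally show ?thesis using k by simp
qed

section \<open>Length in the finite Weyl group\<close>

lemma strip_fin_le: "strip (fin w) a b \<le> 0"
  by (simp add: strip_def fin_def)

text \<open>Count zero means that the inverse is increasing on {1..n + 1}, hence a \<le> v a there;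
  since a permutation preserves the total sum, all these inequalities are equalities.\<close>

lemma weyl_eq_id:
  assumes w: "w \<in> weyl n" and zero: "hyp_count n (fin w) = 0"
  shows "w = id"
proof -
  define v where "v = inv w"
  have v: "v \<in> weyl n" unfolding v_def by (rule weyl_inv[OF w])
  have mono: "v a < v b" if "1 \<le> a" "a < b" "b \<le> n + 1" for a b
  proof -
    have "strip (fin w) a b = 0" using zero that hyp_count_eq_0_iff by blast
    then show ?thesis
      using that weyl_eq_iff[OF v, of a b] by (auto simp: strip_def fin_def v_def split: if_splits)
  qed
  have le: "1 \<le> a \<Longrightarrow> a \<le> n + 1 \<Longrightarrow> a \<le> v a" for a
  proof (induction a)
    case (Suc a)
    show ?case
    proof (cases "a = 0")
      case True
      then show ?thesis using weyl_in_range[OF v, of "Suc a"] Suc.prems by auto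
    next
      case False
      then show ?thesis using Suc mono[of a "Suc a"] by auto
    qed
  qed simp
  have "v a = a" for a
  proof (cases "a \<in> {1..n + 1}")
    case True
    then show ?thesis
      using sum_mono_inv[of "\<lambda>a. a" "{1..n + 1}" v a] le weyl_sum[OF v, of "\<lambda>a. a"] by auto
  next
    case False
    then show ?thesis using v by (auto simp: weyl_def permutes_def)
  qed
  then have "v = id" by (simp add: fun_eq_iff)
  then show ?thesis using weyl_inv_inv[OF w] by (simp add: v_def)
qed

text \<open>Strips of finite elements are never positive, so all of them vanish when no simple one
  is negative.\<close>

lemma weyl_descent:
  assumes w: "w \<in> weyl n" and "w \<noteq> id"
  obtains i where "1 \<le> i" "i \<le> n" "strip (fin w) i (i + 1) < 0"
proof (cases "\<exists>i. 1 \<le> i \<and> i \<le> n \<and> strip (fin w) i (i + 1) < 0")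
  case False
  then have "strip (fin w) a b = 0" if "1 \<le> a" "a < b" "b \<le> n + 1" for a b
    using strip_nonneg[of n "fin w" a b] that strip_fin_le[of w a b] by force
  then show ?thesis using weyl_eq_id[OF w] assms(2) hyp_count_eq_0_iff by blast
qed (use that in blast)

lemma weyl_word_Nil: "weyl_word [] = id"
  by (simp add: weyl_word_def fun_eq_iff)

lemma weyl_word_Cons: "weyl_word (i # is) = transpose i (i + 1) \<circ> weyl_word is"
  by (simp add: weyl_word_def)

lemma weyl_word_mem: "set is \<subseteq> {1..n} \<Longrightarrow> weyl_word is \<in> weyl n"
proof (induction "is")
  case Nil
  show ?case unfolding weyl_word_Nil by (rule weyl_id)
next
  case (Cons i "is")
  then show ?case unfolding weyl_word_Cons by (intro weyl_comp weyl_simple) auto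
qed

lemma hyp_count_simple:
  assumes "w \<in> weyl n" "1 \<le> i" "i \<le> n"
  shows "hyp_count n (fin (transpose i (i + 1) \<circ> w))
       = hyp_count n (fin w) + (if 0 \<le> strip (fin w) i (i + 1) then 1 else - 1)"
  using hyp_count_gen[OF fin_mem[OF assms(1)] assms(2,3)] assms(2)
  by (simp add: aff_gen_fin fin_mult)

lemma simple_cancel [simp]: "transpose i j \<circ> (transpose i j \<circ> w) = w"
  by (simp add: comp_assoc[symmetric])

text \<open>Minimal representatives are defined by the length in W, the relations for T by the
  length in the extended group; computing both by one count makes them comparable.\<close>

lemma weyl_length_eq:
  assumes w: "w \<in> weyl n"
  shows "real (weyl_length n w) = hyp_count n (fin w)"
proof -
  define P where "P w k \<longleftrightarrow> (\<exists>is. length is = k \<and> set is \<subseteq> {1..n} \<and> w = weyl_word is)" for w k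
  have upper: "P w k" if "w \<in> weyl n" "hyp_count n (fin w) = real k" for w k
    using that
  proof (induction k arbitrary: w)
    case 0
    then have "w = id" using weyl_eq_id by simp
    then show ?case unfolding P_def by (intro exI[of _ "[]"]) (simp only: weyl_word_Nil, simp)
  next
    case (Suc k)
    have "hyp_count n (fin id) = 0" by (simp add: hyp_count_eq_0_iff strip_def fin_def)
    then have "w \<noteq> id" using Suc.prems by auto
    then obtain i where i: "1 \<le> i" "i \<le> n" "strip (fin w) i (i + 1) < 0"
      using weyl_descent[OF Suc.prems(1)] by blast
    have "hyp_count n (fin (transpose i (i + 1) \<circ> w)) = real k"
      using Suc.prems i hyp_count_simple[OF Suc.prems(1) i(1,2)] by simp
    then have "P (transpose i (i + 1) \<circ> w) k"
      by (intro Suc.IH weyl_comp weyl_simple Suc.prems i)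
    then obtain "is" where "length is = k" "set is \<subseteq> {1..n}" "transpose i (i + 1) \<circ> w = weyl_word is"
      unfolding P_def by blast
    then show ?case
      unfolding P_def using i simple_cancel[of i "i + 1" w]
      by (intro exI[of _ "i # is"]) (auto simp: weyl_word_Cons)
  qed
  have lower: "hyp_count n (fin w) \<le> real k" if "P w k" for w k
  proof -
    have "hyp_count n (fin (weyl_word is)) \<le> real (length is)" if "set is \<subseteq> {1..n}" for "is"
      using that
    proof (induction "is")
      case Nil
      have "hyp_count n (fin id) \<le> real (length ([] :: nat list))"
        by (simp add: hyp_count_eq_0_iff strip_def fin_def le_less)
      then show ?case by (simp only: weyl_word_Nil)
    next
      case (Cons i "is")
      then have "hyp_count n (fin (weyl_word is)) \<le> real (length is)"
        "hyp_count n (fin (weyl_word (i # is))) \<le> hyp_count n (fin (weyl_word is)) + 1"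
        using hyp_count_simple[OF weyl_word_mem[of "is" n], of i] unfolding weyl_word_Cons by auto
      then show ?case by simp
    qed
    then show ?thesis using that unfolding P_def by blast
  qed
  obtain k where k: "hyp_count n (fin w) = real k" using hyp_count_nat[OF fin_mem[OF w]] .
  have "weyl_length n w = (LEAST k. P w k)"
    unfolding weyl_length_def P_def ..
  also have "\<dots> = k"
    using upper[OF w k] lower[of w] k by (intro Least_equality) auto
  finally show ?thesis using k by simp
qed

lemma hyp_count_fin_sum:
  "hyp_count n (fin w) = (\<Sum>(a, b)\<in>pairs n. if inv w b < inv w a then 1 else 0)"
  unfolding hyp_count_def by (intro sum.cong) (auto simp: strip_def fin_def)

text \<open>The map (a, b) \<mapsto> (w b, w a) carries inversions of w to inversions of its
  inverse. It is needed because X_u is built from T of the inverse of u.\<close>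

lemma hyp_count_fin_inv:
  assumes w: "w \<in> weyl n"
  shows "hyp_count n (fin (inv w)) = hyp_count n (fin w)"
proof -
  have card: "hyp_count n (fin w) = real (card {(a, b). (a, b) \<in> pairs n \<and> inv w b < inv w a})" for w
  proof -
    have "hyp_count n (fin w) = (\<Sum>p\<in>pairs n. if inv w (snd p) < inv w (fst p) then 1 else 0)"
      unfolding hyp_count_fin_sum by (intro sum.cong) auto
    also have "\<dots> = real (card {p \<in> pairs n. inv w (snd p) < inv w (fst p)})"
      by (subst sum.inter_filter[symmetric]) auto
    finally show ?thesis by (simp add: case_prod_unfold)
  qed
  have r: "Suc 0 \<le> w a" "w a \<le> Suc n" "Suc 0 \<le> inv w a" "inv w a \<le> Suc n"
    if "Suc 0 \<le> a" "a \<le> Suc n" for a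
    using that weyl_in_range[OF w, of a] weyl_in_range[OF weyl_inv[OF w], of a] by auto
  have "bij_betw (\<lambda>(a, b). (w b, w a)) {(a, b). (a, b) \<in> pairs n \<and> w b < w a}
      {(a, b). (a, b) \<in> pairs n \<and> inv w b < inv w a}"
    by (rule bij_betw_byWitness[where f' = "\<lambda>(a, b). (inv w b, inv w a)"])
       (use w in \<open>auto simp: pairs_def r\<close>)
  then have "card {(a, b). (a, b) \<in> pairs n \<and> w b < w a} = card {(a, b). (a, b) \<in> pairs n \<and> inv w b < inv w a}"
    by (rule bij_betw_same_card)
  then show ?thesis
    by (simp add: card weyl_inv_inv[OF w])
qed

text \<open>All strips of a dominant translation are nonnegative, so the absolute values disappear
  and the length becomes linear in \<mu>.\<close>

lemma hyp_count_dominant: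
  "\<mu> \<in> dominant n \<Longrightarrow> hyp_count n (transl \<mu>) = (\<Sum>(a, b)\<in>pairs n. \<mu> a - \<mu> b)"
  unfolding hyp_count_def
  by (intro sum.cong) (auto simp: strip_def transl_def dominant_iff pairs_def)

lemma hyp_count_dominant_add:
  "\<mu> \<in> dominant n \<Longrightarrow> \<nu> \<in> dominant n \<Longrightarrow>
     hyp_count n (transl (\<mu> + \<nu>)) = hyp_count n (transl \<mu>) + hyp_count n (transl \<nu>)"
  by (simp add: hyp_count_dominant dominant_add case_prod_unfold sum.distrib[symmetric] algebra_simps)

text \<open>The hypothesis says that x = t_\<mu> v is shortest in its coset W x. All strips are then
  nonnegative, and the inversion indicators subtracted in them sum to the length of v; thus lengths
  add in t_\<mu> = x v^-1.\<close>

lemma hyp_count_left_minimal: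
  assumes "\<mu> \<in> weights n" "v \<in> weyl n" and nonneg: "\<And>i. 1 \<le> i \<Longrightarrow> i \<le> n \<Longrightarrow> 0 \<le> strip (\<mu>, v) i (i + 1)"
  shows "\<mu> \<in> dominant n"
    "hyp_count n (\<mu>, v) + hyp_count n (fin (inv v)) = hyp_count n (transl \<mu>)"
proof -
  have strip: "0 \<le> strip (\<mu>, v) a b" if "1 \<le> a" "a < b" "b \<le> n + 1" for a b
    using strip_nonneg[of n "(\<mu>, v)", OF nonneg that] by simp
  show dom: "\<mu> \<in> dominant n"
    unfolding dominant_iff
  proof (intro conjI allI impI assms(1))
    fix i j assume "1 \<le> i" "i < j" "j \<le> n + 1"
    then show "\<mu> j \<le> \<mu> i" using strip[of i j] by (auto simp: strip_def split: if_splits)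
  qed
  have "hyp_count n (\<mu>, v) = (\<Sum>(a, b)\<in>pairs n. strip (\<mu>, v) a b)"
    unfolding hyp_count_def by (intro sum.cong) (use strip in \<open>auto simp: pairs_def\<close>)
  then show "hyp_count n (\<mu>, v) + hyp_count n (fin (inv v)) = hyp_count n (transl \<mu>)"
    unfolding hyp_count_fin_inv[OF assms(2)] unfolding hyp_count_dominant[OF dom] hyp_count_fin_sum
    by (simp add: case_prod_unfold sum.distrib[symmetric] strip_def)
qed

section \<open>Dominant weights\<close>

definition lin :: "nat \<Rightarrow> (nat \<Rightarrow> int) \<Rightarrow> weight" where
  "lin n c = (\<lambda>a. \<Sum>i = 1..n + 1. of_int (c i) * eps n i a)"

lemma lin_weights: "lin n c \<in> weights n"
  unfolding lin_def weights_iff by blast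

lemma lin_diff:
  assumes "a \<in> {1..n + 1}" "b \<in> {1..n + 1}"
  shows "lin n c a - lin n c b = of_int (c a) - of_int (c b)"
proof -
  have "lin n c a - lin n c b = (\<Sum>i = 1..n + 1. of_int (c i) * (eps n i a - eps n i b))"
    unfolding lin_def by (simp only: sum_subtractf right_diff_distrib)
  also have "\<dots> = (\<Sum>i = 1..n + 1. (if a = i then of_int (c i) else 0) - (if b = i then of_int (c i) else 0))"
    using assms by (intro sum.cong) (auto simp: eps_def)
  also have "\<dots> = of_int (c a) - of_int (c b)"
    using assms by (simp only: sum_subtractf sum.delta' finite_atLeastAtMost if_True)
  finally show ?thesis .
qed

lemma eps_diff:
  "a \<in> {1..n + 1} \<Longrightarrow> b \<in> {1..n + 1} \<Longrightarrow>
     eps n i a - eps n i b = (if a = i then 1 else 0) - (if b = i then 1 else 0)"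
  by (simp add: eps_def)

lemma dominant_decomp:
  assumes "\<gamma> \<in> weights n"
  obtains \<mu> \<nu> where "\<mu> \<in> dominant n" "\<nu> \<in> dominant n" "\<gamma> = \<mu> - \<nu>"
proof -
  obtain K :: nat where K: "(\<Sum>(a, b)\<in>pairs n. \<bar>\<gamma> a - \<gamma> b\<bar>) \<le> real K"
    using real_arch_simple by blast
  \<comment> \<open>Modulo the relation that the e_i sum to zero, \<nu> is K times half the sum of
    the positive roots. It pairs with each simple root to K, which dominates every difference of
    coordinates of \<gamma>.\<close>
  define \<nu> where "\<nu> = lin n (\<lambda>i. - int K * int i)"
  have diff: "\<nu> a - \<nu> b = real K * (real b - real a)" if "a \<in> {1..n + 1}" "b \<in> {1..n + 1}" for a b
    unfolding \<nu>_def lin_diff[OF that] by (simp add: algebra_simps)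
  have \<nu>: "\<nu> \<in> dominant n"
    unfolding dominant_iff
  proof (intro conjI allI impI)
    fix i j assume ij: "1 \<le> i" "i < j" "j \<le> n + 1"
    then have "0 \<le> real K * (real j - real i)" by (intro mult_nonneg_nonneg) auto
    also have "\<dots> = \<nu> i - \<nu> j" using diff[of i j] ij by simp
    finally show "\<nu> j \<le> \<nu> i" by simp
  qed (simp add: \<nu>_def lin_weights)
  have "\<gamma> + \<nu> \<in> dominant n"
    unfolding dominant_iff
  proof (intro conjI allI impI)
    show "\<gamma> + \<nu> \<in> weights n" using assms \<nu> by (auto simp: dominant_iff intro: weights_add)
    fix i j assume ij: "1 \<le> i" "i < j" "j \<le> n + 1"
    have "\<bar>\<gamma> i - \<gamma> j\<bar> \<le> (\<Sum>(a, b)\<in>pairs n. \<bar>\<gamma> a - \<gamma> b\<bar>)"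
      using member_le_sum[of "(i, j)" "pairs n" "\<lambda>(a, b). \<bar>\<gamma> a - \<gamma> b\<bar>", OF _ _ finite_pairs] ij
      by (auto simp: pairs_def)
    also have "\<dots> \<le> real K" by (rule K)
    also have "\<dots> \<le> real K * (real j - real i)"
      using mult_left_mono[of 1 "real j - real i" "real K"] ij by auto
    also have "\<dots> = \<nu> i - \<nu> j" using diff[of i j] ij by auto
    finally show "(\<gamma> + \<nu>) j \<le> (\<gamma> + \<nu>) i" by (auto simp: abs_le_iff)
  qed
  with \<nu> show thesis using that[of "\<gamma> + \<nu>" \<nu>] by simp
qed

text \<open>The index runs over all naturals: k = 0 and k = n + 1 both give 0, so the formulas for
  e_k and for the reflection of a fundamental weight have no boundary cases.\<close>

definition fund_weight :: "nat \<Rightarrow> nat \<Rightarrow> weight" where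
  "fund_weight n k = lin n (\<lambda>i. if i \<le> k then 1 else 0)"

lemma fund_weight_diff:
  "a \<in> {1..n + 1} \<Longrightarrow> b \<in> {1..n + 1} \<Longrightarrow>
     fund_weight n k a - fund_weight n k b = (if a \<le> k then 1 else 0) - (if b \<le> k then 1 else 0)"
  unfolding fund_weight_def by (simp only: lin_diff) simp

lemma fund_weight_dominant: "fund_weight n k \<in> dominant n"
  unfolding dominant_iff
proof (intro conjI allI impI)
  show "fund_weight n k \<in> weights n" by (simp add: fund_weight_def lin_weights)
  fix i j assume "1 \<le> i" "i < j" "j \<le> n + 1"
  then show "fund_weight n k j \<le> fund_weight n k i"
    using fund_weight_diff[of i n j k] by (auto split: if_splits)
qed

lemma fund_weight_weights: "fund_weight n k \<in> weights n"
  using fund_weight_dominant by (auto simp: dominant_iff)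

lemma eps_fund_weight:
  assumes "1 \<le> k" "k \<le> n + 1"
  shows "eps n k = fund_weight n k - fund_weight n (k - 1)"
proof (rule weights_eqI)
  show "eps n k \<in> ambient n" "fund_weight n k - fund_weight n (k - 1) \<in> ambient n"
    using assms by (auto intro!: weights_ambient weights_diff weights_eps fund_weight_weights)
  fix a b assume ab: "a \<in> {1..n + 1}" "b \<in> {1..n + 1}"
  have "(fund_weight n k a - fund_weight n k b) - (fund_weight n (k - 1) a - fund_weight n (k - 1) b)
      = eps n k a - eps n k b"
    unfolding fund_weight_diff[OF ab] eps_diff[OF ab] using assms by auto
  then show "eps n k a - eps n k b
      = (fund_weight n k - fund_weight n (k - 1)) a - (fund_weight n k - fund_weight n (k - 1)) b"
    by simp
qed

section \<open>The affine Hecke algebra\<close>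

lemma ring_inv_eq: "x * y = 1 \<Longrightarrow> y * x = 1 \<Longrightarrow> ring_inv x = y"
  unfolding ring_inv_def
  by (rule the_equality) (auto, metis mult.assoc mult.left_neutral mult.right_neutral)

locale type_A_hecke = hecke_algebra scale n T
  for scale :: "laurent \<Rightarrow> 'h::ring_1 \<Rightarrow> 'h" and n :: nat and T :: "aff \<Rightarrow> 'h" +
  assumes n_pos: "1 \<le> n"
begin

abbreviation W :: "(nat \<Rightarrow> nat) set" where "W \<equiv> weyl n"
abbreviation s :: "nat \<Rightarrow> nat \<Rightarrow> nat" where "s i \<equiv> transpose i (i + 1)"
abbreviation len :: "(nat \<Rightarrow> nat) \<Rightarrow> real" where "len w \<equiv> hyp_count n (fin w)"
abbreviation Ts :: "nat \<Rightarrow> 'h" where "Ts i \<equiv> T (aff_gen n i)"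
abbreviation qq :: laurent where "qq \<equiv> qpow 1 - qpow (- 1)"
text \<open>By the quadratic relation this is the inverse of T_i, that is, X_u for u = s_i; products
  of these along reduced words give the X_u.\<close>

abbreviation Si :: "nat \<Rightarrow> 'h" where "Si i \<equiv> Ts i - scale qq 1"
abbreviation X :: "weight \<Rightarrow> 'h" where "X \<equiv> X_wt n T"
abbreviation Xf :: "(nat \<Rightarrow> nat) \<Rightarrow> 'h" where "Xf \<equiv> X_fin T"

section \<open>Units among the basis elements\<close>

lemma scale_one_mult: "scale r x = scale r 1 * x" "scale r x = x * scale r 1"
  using scale_mult_left[of r 1 x] scale_mult_right[of r x 1] by simp_all

lemma scale_one_commute: "scale r 1 * x = x * scale r 1"
  by (simp flip: scale_one_mult)

lemma length_eq: "x \<in> ext_weyl n \<Longrightarrow> real (ext_length n x) = hyp_count n x"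
  using ext_length_eq n_pos by blast

lemma T_mult_count:
  assumes "x \<in> ext_weyl n" "y \<in> ext_weyl n" "hyp_count n (aff_mult x y) = hyp_count n x + hyp_count n y"
  shows "T x * T y = T (aff_mult x y)"
proof (rule T_mult[OF assms(1,2)])
  have "real (ext_length n (aff_mult x y)) = real (ext_length n x + ext_length n y)"
    using assms by (simp add: length_eq ext_weyl_mult)
  then show "ext_length n (aff_mult x y) = ext_length n x + ext_length n y" by linarith
qed

lemma count_fin_id [simp]: "hyp_count n (fin id) = 0"
  by (simp add: hyp_count_eq_0_iff strip_def fin_def)

text \<open>The element is a left unit on the basis, hence on its span, and is then applied to
  1.\<close>

lemma T_id [simp]: "T (fin id) = 1"
proof -
  have "subspace {h. T (fin id) * h = h}"
    by (rule subspaceI) (auto simp: distrib_left simp flip: scale_mult_right)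
  moreover have "T ` ext_weyl n \<subseteq> {h. T (fin id) * h = h}"
    using T_mult_count[OF fin_mem[OF weyl_id]] by auto
  ultimately have "span (T ` ext_weyl n) \<subseteq> {h. T (fin id) * h = h}"
    by (intro span_minimal)
  then have "T (fin id) * 1 = 1" unfolding T_span by blast
  then show ?thesis by simp
qed

lemma count_gen: "i \<le> n \<Longrightarrow> hyp_count n (aff_gen n i) = 1"
  using hyp_count_gen[OF fin_mem[OF weyl_id], of i] hyp_count_gen_0[OF fin_mem[OF weyl_id] n_pos]
  by (cases "i = 0") (simp_all, simp_all add: strip_def fin_def)

lemma T_gen_square:
  assumes "i \<le> n"
  shows "Ts i * Ts i = 1 + scale qq (Ts i)"
proof -
  have "real (ext_length n (aff_gen n i)) = real (ext_length n (aff_mult (aff_gen n i) (aff_gen n i)) + 1)"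
    using assms by (simp add: aff_gen_square length_eq fin_mem weyl_id count_gen aff_gen_mem)
  then have "ext_length n (aff_gen n i) = ext_length n (aff_mult (aff_gen n i) (aff_gen n i)) + 1"
    by linarith
  then show ?thesis
    using T_quadratic[OF aff_gen_mem[OF assms], of i] assms by (simp add: aff_gen_square)
qed

lemma T_gen_inverse:
  assumes "i \<le> n"
  shows "Ts i * Si i = 1" "Si i * Ts i = 1"
  using T_gen_square[OF assms]
  by (simp_all add: left_diff_distrib right_diff_distrib flip: scale_one_mult)

lemma T_gen_up:
  assumes "i \<le> n" "x \<in> ext_weyl n" "hyp_count n (aff_mult (aff_gen n i) x) = hyp_count n x + 1"
  shows "T (aff_mult (aff_gen n i) x) = Ts i * T x"
  using T_mult_count[OF aff_gen_mem[OF assms(1)] assms(2)] assms by (simp add: count_gen)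

text \<open>Descent to an element of Sigma, whose group inverse also has length zero; each letter
  removed on the way is a unit by the quadratic relation.\<close>

lemma T_invertible:
  assumes "x \<in> ext_weyl n"
  shows "\<exists>y. T x * y = 1 \<and> y * T x = 1"
proof -
  obtain k where "hyp_count n x = real k" using hyp_count_nat[OF assms] .
  then show ?thesis using assms
  proof (induction k arbitrary: x)
    case 0
    then have "hyp_count n (aff_inv x) = 0" using hyp_count_inv_0 by simp
    then show ?case
      using T_mult_count[of x "aff_inv x"] T_mult_count[of "aff_inv x" x] 0
      by (intro exI[of _ "T (aff_inv x)"]) (simp add: aff_inv_mult aff_inv_mem)
  next
    case (Suc k)
    then obtain i where i: "i \<le> n" "hyp_count n (aff_mult (aff_gen n i) x) = hyp_count n x - 1"
      using hyp_count_descent[OF Suc.prems(2) n_pos] by auto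
    let ?y = "aff_mult (aff_gen n i) x"
    have y: "?y \<in> ext_weyl n" using i(1) Suc.prems by (intro ext_weyl_mult aff_gen_mem)
    then obtain z where z: "T ?y * z = 1" "z * T ?y = 1"
      using Suc.IH[of ?y] i Suc.prems by auto
    have x: "T x = Ts i * T ?y"
      using T_gen_up[OF i(1) y] i Suc.prems by (simp add: aff_gen_cancel)
    have "T x * (z * Si i) = Ts i * (T ?y * z) * Si i"
      "(z * Si i) * T x = z * (Si i * Ts i) * T ?y"
      unfolding x by (simp_all only: mult.assoc)
    then show ?case using z T_gen_inverse[OF i(1)] by (intro exI[of _ "z * Si i"]) simp
  qed
qed

lemma T_inverse:
  assumes "x \<in> ext_weyl n"
  shows "T x * ring_inv (T x) = 1" "ring_inv (T x) * T x = 1"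
  using T_invertible[OF assms] ring_inv_eq by auto

lemma inverse_commute:
  assumes "x \<in> ext_weyl n" "T x * h = h * T x"
  shows "ring_inv (T x) * h = h * ring_inv (T x)"
proof -
  have "ring_inv (T x) * h = ring_inv (T x) * (h * T x) * ring_inv (T x)"
    using T_inverse(1)[OF assms(1)] by (simp add: mult.assoc)
  also have "\<dots> = ring_inv (T x) * T x * h * ring_inv (T x)"
    unfolding assms(2)[symmetric] by (simp only: mult.assoc)
  finally show ?thesis using T_inverse(2)[OF assms(1)] by simp
qed

section \<open>The commutative subalgebra of the X^\<gamma>\<close>

lemma dominant_mem: "\<mu> \<in> dominant n \<Longrightarrow> transl \<mu> \<in> ext_weyl n"
  by (simp add: transl_mem dominant_iff)

lemma T_dominant_add:
  assumes "\<mu> \<in> dominant n" "\<nu> \<in> dominant n"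
  shows "T (transl \<mu>) * T (transl \<nu>) = T (transl (\<mu> + \<nu>))"
  using T_mult_count[OF dominant_mem[OF assms(1)] dominant_mem[OF assms(2)]] hyp_count_dominant_add[OF assms]
  by (simp add: transl_mult)

lemma T_dominant_commute:
  "\<mu> \<in> dominant n \<Longrightarrow> \<nu> \<in> dominant n \<Longrightarrow> T (transl \<mu>) * T (transl \<nu>) = T (transl \<nu>) * T (transl \<mu>)"
  by (simp add: T_dominant_add add.commute)

abbreviation Tinv :: "weight \<Rightarrow> 'h" where "Tinv \<mu> \<equiv> ring_inv (T (transl \<mu>))"

lemma Tinv_commute:
  assumes "\<mu> \<in> dominant n" "\<nu> \<in> dominant n"
  shows "Tinv \<mu> * T (transl \<nu>) = T (transl \<nu>) * Tinv \<mu>" "Tinv \<mu> * Tinv \<nu> = Tinv \<nu> * Tinv \<mu>"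
proof -
  show c: "Tinv \<mu> * T (transl \<nu>) = T (transl \<nu>) * Tinv \<mu>"
    by (rule inverse_commute[OF dominant_mem[OF assms(1)] T_dominant_commute[OF assms]])
  show "Tinv \<mu> * Tinv \<nu> = Tinv \<nu> * Tinv \<mu>"
    by (rule inverse_commute[OF dominant_mem[OF assms(2)] c[symmetric], symmetric])
qed

lemma fraction_mult:
  assumes "\<mu> \<in> dominant n" "\<nu> \<in> dominant n" "\<mu>' \<in> dominant n" "\<nu>' \<in> dominant n"
  shows "T (transl \<mu>) * Tinv \<nu> * (T (transl \<mu>') * Tinv \<nu>') = T (transl (\<mu> + \<mu>')) * Tinv (\<nu> + \<nu>')"
proof -
  have "Tinv (\<nu> + \<nu>') = Tinv \<nu>' * Tinv \<nu>"
  proof (rule ring_inv_eq)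
    have "T (transl \<nu>) * T (transl \<nu>') * (Tinv \<nu>' * Tinv \<nu>)
        = T (transl \<nu>) * (T (transl \<nu>') * Tinv \<nu>') * Tinv \<nu>"
      "Tinv \<nu>' * Tinv \<nu> * (T (transl \<nu>) * T (transl \<nu>')) = Tinv \<nu>' * (Tinv \<nu> * T (transl \<nu>)) * T (transl \<nu>')"
      by (simp_all only: mult.assoc)
    then show "T (transl (\<nu> + \<nu>')) * (Tinv \<nu>' * Tinv \<nu>) = 1" "Tinv \<nu>' * Tinv \<nu> * T (transl (\<nu> + \<nu>')) = 1"
      using T_inverse assms dominant_mem by (simp_all add: T_dominant_add)
  qed
  then have "T (transl (\<mu> + \<mu>')) * Tinv (\<nu> + \<nu>') = T (transl \<mu>) * T (transl \<mu>') * (Tinv \<nu> * Tinv \<nu>')"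
    using assms by (simp add: T_dominant_add Tinv_commute)
  also have "\<dots> = T (transl \<mu>) * (T (transl \<mu>') * Tinv \<nu>) * Tinv \<nu>'"
    by (simp only: mult.assoc)
  also have "\<dots> = T (transl \<mu>) * Tinv \<nu> * (T (transl \<mu>') * Tinv \<nu>')"
    unfolding Tinv_commute(1)[OF assms(2,3), symmetric] by (simp only: mult.assoc)
  finally show ?thesis by simp
qed

lemma X_fraction:
  assumes "\<mu> \<in> dominant n" "\<nu> \<in> dominant n"
  shows "X (\<mu> - \<nu>) = T (transl \<mu>) * Tinv \<nu>"
  unfolding X_wt_def
proof (rule the_equality)
  show "\<exists>\<mu>'\<in>dominant n. \<exists>\<nu>'\<in>dominant n. \<mu> - \<nu> = \<mu>' - \<nu>' \<and> T (transl \<mu>) * Tinv \<nu> = T (transl \<mu>') * Tinv \<nu>'"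
    using assms by blast
  fix x assume "\<exists>\<mu>'\<in>dominant n. \<exists>\<nu>'\<in>dominant n. \<mu> - \<nu> = \<mu>' - \<nu>' \<and> x = T (transl \<mu>') * Tinv \<nu>'"
  then obtain \<mu>' \<nu>' where d: "\<mu>' \<in> dominant n" "\<nu>' \<in> dominant n" and eq: "\<mu> - \<nu> = \<mu>' - \<nu>'"
    and x: "x = T (transl \<mu>') * Tinv \<nu>'" by blast
  have "\<mu> + \<nu>' = \<mu>' + \<nu>" using eq by (simp add: algebra_simps fun_eq_iff)
  \<comment> \<open>Each fraction is extended by the denominator of the other, after which
    numerators and denominators agree.\<close>
  moreover have "T (transl \<mu>) * Tinv \<nu> = T (transl \<mu>) * Tinv \<nu> * (T (transl \<nu>') * Tinv \<nu>')"
    "x = T (transl \<mu>') * Tinv \<nu>' * (T (transl \<nu>) * Tinv \<nu>)"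
    using T_inverse dominant_mem d assms by (simp_all add: x)
  ultimately show "x = T (transl \<mu>) * Tinv \<nu>"
    using fraction_mult assms d by (simp add: add.commute)
qed

lemma X_add:
  assumes "\<gamma> \<in> weights n" "\<delta> \<in> weights n"
  shows "X (\<gamma> + \<delta>) = X \<gamma> * X \<delta>"
proof -
  obtain \<mu> \<nu> \<mu>' \<nu>' where d: "\<mu> \<in> dominant n" "\<nu> \<in> dominant n" "\<mu>' \<in> dominant n" "\<nu>' \<in> dominant n"
    and "\<gamma> = \<mu> - \<nu>" "\<delta> = \<mu>' - \<nu>'"
    using dominant_decomp assms by metis
  moreover have "\<mu> - \<nu> + (\<mu>' - \<nu>') = (\<mu> + \<mu>') - (\<nu> + \<nu>')" by simp
  ultimately show ?thesis
    using fraction_mult[OF d] by (simp only: X_fraction dominant_add)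
qed

lemma zero_dominant: "0 \<in> dominant n"
  by (simp add: dominant_iff weights_zero)

lemma X_zero [simp]: "X 0 = 1"
  using X_fraction[OF zero_dominant zero_dominant] T_inverse[OF dominant_mem[OF zero_dominant]] by simp

lemma X_dominant: "\<mu> \<in> dominant n \<Longrightarrow> X \<mu> = T (transl \<mu>)"
proof -
  assume d: "\<mu> \<in> dominant n"
  have "transl 0 = fin id" by (simp add: transl_def fin_def)
  then have "Tinv 0 = 1" using ring_inv_eq[of "1 :: 'h" 1] by simp
  then show ?thesis using X_fraction[OF d zero_dominant] by simp
qed

section \<open>Commutation of the T_i with the X^\<gamma>\<close>

lemma simple_transl:
  assumes "\<mu> i = \<mu> (i + 1)" "1 \<le> i"
  shows "aff_mult (aff_gen n i) (transl \<mu>) = (\<mu>, s i)" "aff_mult (transl \<mu>) (aff_gen n i) = (\<mu>, s i)"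
proof -
  have "act (s i) \<mu> = \<mu>"
    using assms(1) by (auto simp: act_def fun_eq_iff transpose_def)
  then show "aff_mult (aff_gen n i) (transl \<mu>) = (\<mu>, s i)" "aff_mult (transl \<mu>) (aff_gen n i) = (\<mu>, s i)"
    using assms(2) by (simp_all add: aff_gen_mult_fin transl_def aff_gen_fin aff_mult_def fin_def)
qed

lemma count_simple_transl:
  assumes "\<mu> \<in> dominant n" "\<mu> i = \<mu> (i + 1)" "1 \<le> i" "i \<le> n"
  shows "hyp_count n (\<mu>, s i) = hyp_count n (transl \<mu>) + 1"
proof -
  have "strip (transl \<mu>) i (i + 1) = 0" using assms(2) by (simp add: strip_def transl_def)
  then show ?thesis
    using hyp_count_gen[OF dominant_mem[OF assms(1)] assms(3,4)] simple_transl[OF assms(2,3)] by simp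
qed

text \<open>When s_i fixes \<mu>, both products add lengths and end at the same group element, so
  T_i commutes with T of the translation.\<close>

lemma T_simple_transl:
  assumes "\<mu> \<in> dominant n" "\<mu> i = \<mu> (i + 1)" "1 \<le> i" "i \<le> n"
  shows "Ts i * T (transl \<mu>) = T (\<mu>, s i)" "T (transl \<mu>) * Ts i = T (\<mu>, s i)"
  using T_mult_count[OF aff_gen_mem[OF assms(4)] dominant_mem[OF assms(1)]]
    T_mult_count[OF dominant_mem[OF assms(1)] aff_gen_mem[OF assms(4)]]
    count_simple_transl[OF assms] simple_transl[OF assms(2,3)] count_gen[OF assms(4)] by simp_all

lemma fund_weight_simple:
  assumes "1 \<le> i" "i \<le> n" "k \<noteq> i"
  shows "fund_weight n k i = fund_weight n k (i + 1)"
  using fund_weight_diff[of i n "i + 1" k] assms by (cases i k rule: linorder_cases) simp_all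

lemma T_fund_weight_commute:
  assumes "1 \<le> i" "i \<le> n" "k \<noteq> i"
  shows "T (transl (fund_weight n k)) * Ts i = Ts i * T (transl (fund_weight n k))"
  using T_simple_transl[OF fund_weight_dominant fund_weight_simple[OF assms] assms(1,2)] by simp

text \<open>Here e_j is the difference of the fundamental weights of index j and j - 1, neither of
  which is i.\<close>

lemma bernstein_far:
  assumes "1 \<le> i" "i \<le> n" "1 \<le> j" "j \<le> n + 1" "j \<noteq> i" "j \<noteq> i + 1"
  shows "Ts i * X (eps n j) = X (eps n j) * Ts i"
proof -
  have 1: "T (transl (fund_weight n j)) * Ts i = Ts i * T (transl (fund_weight n j))"
    and 2: "Tinv (fund_weight n (j - 1)) * Ts i = Ts i * Tinv (fund_weight n (j - 1))"
    using assms by (auto intro!: T_fund_weight_commute inverse_commute[OF dominant_mem[OF fund_weight_dominant]])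
  have "X (eps n j) * Ts i = T (transl (fund_weight n j)) * (Ts i * Tinv (fund_weight n (j - 1)))"
    using X_fraction[OF fund_weight_dominant fund_weight_dominant] 2 assms
    by (simp add: eps_fund_weight mult.assoc)
  also have "\<dots> = Ts i * X (eps n j)"
    using X_fraction[OF fund_weight_dominant fund_weight_dominant] 1 assms
    by (simp add: eps_fund_weight flip: mult.assoc)
  finally show ?thesis ..
qed

text \<open>The element t_\<omega> s_i has only nonnegative simple strips, so
  \<open>hyp_count_left_minimal\<close> makes it one shorter than t_\<omega>.\<close>

lemma T_fund_weight_simple:
  assumes i: "1 \<le> i" "i \<le> n"
  defines "\<omega> \<equiv> fund_weight n i"
  shows "T (transl \<omega>) * Si i = T (\<omega>, s i)" "hyp_count n (\<omega>, s i) = hyp_count n (transl \<omega>) - 1"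
proof -
  have si: "s i \<in> W" by (rule weyl_simple[OF i])
  have "0 \<le> strip (\<omega>, s i) j (j + 1)" if "1 \<le> j" "j \<le> n" for j
    using fund_weight_diff[of j n "j + 1" i] that
    by (auto simp: strip_def \<omega>_def transpose_def)
  then have "hyp_count n (\<omega>, s i) + hyp_count n (fin (inv (s i))) = hyp_count n (transl \<omega>)"
    using fund_weight_weights si by (intro hyp_count_left_minimal(2)) (auto simp: \<omega>_def)
  moreover have gen: "fin (s i) = aff_gen n i" using i by (simp add: aff_gen_fin)
  ultimately show count: "hyp_count n (\<omega>, s i) = hyp_count n (transl \<omega>) - 1"
    using count_gen[OF i(2)] by simp
  have mem: "(\<omega>, s i) \<in> ext_weyl n" using fund_weight_weights si by (simp add: ext_weylI \<omega>_def)
  have "aff_mult (\<omega>, s i) (aff_gen n i) = transl \<omega>"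
    unfolding gen[symmetric] by (simp add: aff_mult_def fin_def transl_def)
  then have "T (\<omega>, s i) * Ts i = T (transl \<omega>)"
    using T_mult_count[OF mem aff_gen_mem[OF i(2)]] count count_gen[OF i(2)] by simp
  then have "T (transl \<omega>) * Si i = T (\<omega>, s i) * (Ts i * Si i)"
    by (simp only: mult.assoc[symmetric])
  then show "T (transl \<omega>) * Si i = T (\<omega>, s i)"
    using T_gen_inverse[OF i(2)] by simp
qed

text \<open>Both sides are twice the i-th fundamental weight minus alpha_i; the right side expands
  this by the Cartan matrix of type A.\<close>

lemma fund_weight_reflect:
  assumes i: "1 \<le> i" "i \<le> n"
  shows "fund_weight n i + act (s i) (fund_weight n i) = fund_weight n (i - 1) + fund_weight n (i + 1)"
proof (rule weights_eqI)
  have si: "s i \<in> W" by (rule weyl_simple[OF i])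
  show "fund_weight n i + act (s i) (fund_weight n i) \<in> ambient n"
    "fund_weight n (i - 1) + fund_weight n (i + 1) \<in> ambient n"
    using si by (auto intro!: weights_ambient weights_add weights_act fund_weight_weights)
  fix a b assume ab: "a \<in> {1..n + 1}" "b \<in> {1..n + 1}"
  have sab: "s i a \<in> {1..n + 1}" "s i b \<in> {1..n + 1}" using ab weyl_in_range[OF si] by auto
  have "(fund_weight n i a - fund_weight n i b) + (fund_weight n i (s i a) - fund_weight n i (s i b))
     = (fund_weight n (i - 1) a - fund_weight n (i - 1) b) + (fund_weight n (i + 1) a - fund_weight n (i + 1) b)"
    unfolding fund_weight_diff[OF ab] fund_weight_diff[OF sab] using i
    by (auto simp: transpose_def)
  then show "(fund_weight n i + act (s i) (fund_weight n i)) a - (fund_weight n i + act (s i) (fund_weight n i)) b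
     = (fund_weight n (i - 1) + fund_weight n (i + 1)) a - (fund_weight n (i - 1) + fund_weight n (i + 1)) b"
    by (simp add: act_def)
qed

text \<open>The weight differs from twice the fundamental weight by alpha_i, whose pairing with the
  sum of all positive roots is 2.\<close>

lemma count_fund_weight_reflect:
  assumes i: "1 \<le> i" "i \<le> n"
  shows "hyp_count n (transl (fund_weight n (i - 1) + fund_weight n (i + 1)))
       = 2 * hyp_count n (transl (fund_weight n i)) - 2"
proof -
  let ?\<omega> = "fund_weight n i" and ?P = "pairs n - {(i, i + 1)}"
  have mem: "(i, i + 1) \<in> pairs n" using i by (simp add: pairs_def)
  have dom: "fund_weight n (i - 1) + fund_weight n (i + 1) \<in> dominant n"
    by (intro dominant_add fund_weight_dominant)
  have "(\<Sum>(a, b)\<in>?P. ?\<omega> (s i a) - ?\<omega> (s i b)) = (\<Sum>(a, b)\<in>?P. ?\<omega> a - ?\<omega> b)"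
    by (rule sum.reindex_bij_witness[of _ "\<lambda>(a, b). (s i a, s i b)" "\<lambda>(a, b). (s i a, s i b)"])
       (use pairs_simple[OF i] in auto)
  moreover have "?\<omega> i - ?\<omega> (i + 1) = 1"
    using fund_weight_diff[of i n "i + 1" i] i by auto
  ultimately show ?thesis
    unfolding hyp_count_dominant[OF dom] hyp_count_dominant[OF fund_weight_dominant]
    unfolding fund_weight_reflect[OF i, symmetric]
    by (simp add: sum.remove[OF finite_pairs mem] act_def case_prod_unfold sum.distrib sum_subtractf)
qed

text \<open>The element t_\<omega> s_i t_\<omega>, with \<omega> the i-th fundamental weight, is
  evaluated in two ways. If t_\<omega> has length m, it has length (m - 1) + m from its left
  factorisation and 1 + (2 m - 2) as s_i times a dominant translation fixed by s_i. The resulting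
  identity \<open>key\<close> is then divided by translations.\<close>

lemma bernstein_near:
  assumes i: "1 \<le> i" "i \<le> n"
  shows "Ts i * X (eps n (i + 1)) * Ts i = X (eps n i)"
proof -
  let ?A = "T (transl (fund_weight n i))" and ?B = "T (transl (fund_weight n (i - 1)))"
    and ?C = "T (transl (fund_weight n (i + 1)))"
    and ?A' = "Tinv (fund_weight n i)" and ?B' = "Tinv (fund_weight n (i - 1))"
  let ?\<omega>' = "fund_weight n (i - 1) + fund_weight n (i + 1)"
  note dom = fund_weight_dominant
  have dom': "?\<omega>' \<in> dominant n" by (intro dominant_add dom)
  have \<omega>': "?\<omega>' i = ?\<omega>' (i + 1)"
    using fund_weight_simple[OF i, of "i - 1"] fund_weight_simple[OF i, of "i + 1"] i by simp
  have inv: "?A * ?A' = 1" "?A' * ?A = 1" "?B * ?B' = 1" "?B' * ?B = 1"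
    by (simp_all add: T_inverse dominant_mem dom)
  have "?A * Si i * ?A = T (fund_weight n i, s i) * ?A"
    using T_fund_weight_simple(1)[OF i] by simp
  also have "\<dots> = T (aff_mult (fund_weight n i, s i) (transl (fund_weight n i)))"
  proof (rule T_mult_count[OF _ dominant_mem[OF dom]])
    show "(fund_weight n i, s i) \<in> ext_weyl n"
      using fund_weight_weights weyl_simple[OF i] by (intro ext_weylI)
    have "aff_mult (fund_weight n i, s i) (transl (fund_weight n i)) = (?\<omega>', s i)"
      using fund_weight_reflect[OF i] by (simp add: aff_mult_def transl_def)
    then show "hyp_count n (aff_mult (fund_weight n i, s i) (transl (fund_weight n i)))
        = hyp_count n (fund_weight n i, s i) + hyp_count n (transl (fund_weight n i))"
      using count_fund_weight_reflect[OF i] T_fund_weight_simple(2)[OF i]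
        count_simple_transl[of ?\<omega>', OF dom' \<omega>' i] by simp
  qed
  also have "aff_mult (fund_weight n i, s i) (transl (fund_weight n i)) = (?\<omega>', s i)"
    using fund_weight_reflect[OF i] by (simp add: aff_mult_def transl_def)
  also have "T (?\<omega>', s i) = Ts i * ?C * ?B"
    using T_simple_transl(1)[of ?\<omega>', OF dom' \<omega>' i] T_dominant_add[OF dom dom, of "i + 1" "i - 1"]
    by (simp add: add.commute mult.assoc)
  finally have key: "?A * Si i * ?A = Ts i * ?C * ?B" .
  have BT: "?B' * Ts i = Ts i * ?B'"
    using i by (intro inverse_commute[OF dominant_mem[OF dom]] T_fund_weight_commute) auto
  have "Ts i * X (eps n (i + 1)) * Ts i = Ts i * ?C * (?B * ?B') * ?A' * Ts i"
    using X_fraction[OF dom dom, of "i + 1" i] i inv by (simp add: eps_fund_weight mult.assoc)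
  also have "\<dots> = ?A * Si i * ?A * (?B' * ?A') * Ts i"
    unfolding key by (simp only: mult.assoc)
  also have "\<dots> = ?A * Si i * (?A * ?A') * ?B' * Ts i"
    unfolding Tinv_commute(2)[OF dom dom, of "i - 1" i] by (simp only: mult.assoc)
  also have "\<dots> = ?A * (Si i * Ts i) * ?B'"
    unfolding inv using BT by (simp add: mult.assoc)
  also have "\<dots> = X (eps n i)"
    using X_fraction[OF dom dom, of i "i - 1"] i T_gen_inverse[OF i(2)] by (simp add: eps_fund_weight)
  finally show ?thesis .
qed

section \<open>The elements \<open>X\<^sub>w\<close>\<close>

lemma Xf_inverse:
  assumes "w \<in> W"
  shows "T (fin (inv w)) * Xf w = 1" "Xf w * T (fin (inv w)) = 1"
  using T_inverse[OF fin_mem[OF weyl_inv[OF assms]]] by (simp_all add: X_fin_def)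

lemma Xf_id [simp]: "Xf id = 1"
  using Xf_inverse[OF weyl_id] by simp

text \<open>Inverting T of w^-1 s_i, which factors as T(w^-1) T_i, reverses the factors, so a letter
  added on the left of w appears as T_i^-1 on the left of X_w.\<close>

lemma Xf_up:
  assumes w: "w \<in> W" and i: "1 \<le> i" "i \<le> n" and up: "0 \<le> strip (fin w) i (i + 1)"
  shows "Xf (s i \<circ> w) = Si i * Xf w"
proof -
  have si: "s i \<in> W" by (rule weyl_simple[OF i])
  have inv: "inv (s i \<circ> w) = inv w \<circ> s i" using weyl_inv_comp[OF si w] by simp
  have gen: "fin (s i) = aff_gen n i" using i by (simp add: aff_gen_fin)
  have "len (inv w \<circ> s i) = len (inv w) + 1"
    using hyp_count_fin_inv[OF weyl_comp[OF si w]] hyp_count_fin_inv[OF w] hyp_count_simple[OF w i] up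
    unfolding inv by simp
  then have "T (fin (inv w)) * Ts i = T (fin (inv w \<circ> s i))"
    using T_mult_count[OF fin_mem[OF weyl_inv[OF w]] aff_gen_mem[OF i(2)]] count_gen[OF i(2)]
    by (simp add: fin_mult flip: gen)
  then have T: "T (fin (inv (s i \<circ> w))) = T (fin (inv w)) * Ts i" unfolding inv ..
  have "T (fin (inv w)) * Ts i * (Si i * Xf w) = T (fin (inv w)) * (Ts i * Si i) * Xf w"
    "Si i * Xf w * (T (fin (inv w)) * Ts i) = Si i * (Xf w * T (fin (inv w))) * Ts i"
    by (simp_all only: mult.assoc)
  then show ?thesis
    unfolding X_fin_def[of T "s i \<circ> w"] T
    using Xf_inverse[OF w] T_gen_inverse[OF i(2)] by (intro ring_inv_eq) simp_all
qed

lemma strip_down: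
  assumes "w \<in> W" "1 \<le> i" "i \<le> n" "strip (fin w) i (i + 1) < 0"
  shows "0 \<le> strip (fin (s i \<circ> w)) i (i + 1)"
proof -
  have "strip (fin w) i (i + 1) \<le> - 1"
    using assms(4) by (auto simp: strip_def fin_def split: if_splits)
  then show ?thesis
    using strip_fin[OF fin_mem[OF assms(1)] assms(2,3), of i "i + 1"]
      strip_swap[OF fin_mem[OF assms(1)], of i "i + 1"] assms(2)
    by (simp add: aff_gen_fin fin_mult)
qed

lemma Xf_down:
  assumes w: "w \<in> W" and i: "1 \<le> i" "i \<le> n" and down: "strip (fin w) i (i + 1) < 0"
  shows "Xf w = Si i * Xf (s i \<circ> w)"
  using Xf_up[OF weyl_comp[OF weyl_simple[OF i] w] i strip_down[OF w i down]] by simp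

lemma Si_square:
  assumes "i \<le> n"
  shows "Si i * Si i = 1 - scale qq (Si i)"
proof -
  have "Si i * Si i = Si i * Ts i - Si i * scale qq 1" by (simp only: right_diff_distrib)
  then show ?thesis using T_gen_inverse[OF assms] by (simp flip: scale_one_mult(2))
qed

lemma Si_Xf_down:
  assumes w: "w \<in> W" and i: "1 \<le> i" "i \<le> n" and down: "strip (fin w) i (i + 1) < 0"
  shows "Si i * Xf w = Xf (s i \<circ> w) - scale qq 1 * Xf w"
proof -
  have "Si i * Xf w = Si i * Si i * Xf (s i \<circ> w)"
    unfolding Xf_down[OF assms] by (simp only: mult.assoc)
  also have "\<dots> = Xf (s i \<circ> w) - scale qq 1 * (Si i * Xf (s i \<circ> w))"
    unfolding Si_square[OF i(2)] scale_one_mult(1)[of qq "Si i"]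
    by (simp only: left_diff_distrib mult_1_left mult.assoc)
  finally show ?thesis unfolding Xf_down[OF assms, symmetric] .
qed

text \<open>Lengths add in x v^-1 = t_\<gamma> and \<gamma> is dominant, so T_x is X^\<gamma>
  divided by T of v^-1. This is where the basis T_x meets the Bernstein elements.\<close>

lemma T_left_minimal:
  assumes mem: "(\<gamma>, v) \<in> ext_weyl n" and nonneg: "\<And>i. 1 \<le> i \<Longrightarrow> i \<le> n \<Longrightarrow> 0 \<le> strip (\<gamma>, v) i (i + 1)"
  shows "T (\<gamma>, v) = X \<gamma> * Xf v"
proof -
  have v: "v \<in> W" and \<gamma>: "\<gamma> \<in> weights n" using mem by (auto simp: ext_weyl_def)
  note min = hyp_count_left_minimal[OF \<gamma> v nonneg]
  have "aff_mult (\<gamma>, v) (fin (inv v)) = transl \<gamma>"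
    using v by (simp add: aff_mult_def fin_def transl_def)
  then have "T (\<gamma>, v) * T (fin (inv v)) = X \<gamma>"
    using T_mult_count[OF mem fin_mem[OF weyl_inv[OF v]]] min by (simp add: X_dominant)
  then have "X \<gamma> * Xf v = T (\<gamma>, v) * (T (fin (inv v)) * Xf v)"
    by (simp only: mult.assoc[symmetric])
  then show ?thesis using Xf_inverse[OF v] by simp
qed

end

section \<open>Evaluation of finitely supported functions\<close>

text \<open>The additive extension of f from single terms. The actions on monomials, polynomials and
  the group ring, the map \<open>\<Theta>\<close> and the operations on formal tensors are all
  instances, so additivity and multiplicativity are proved once.\<close>

definition pm_eval :: "('m \<Rightarrow> 'r \<Rightarrow> 'b) \<Rightarrow> ('m \<Rightarrow>\<^sub>0 'r::zero) \<Rightarrow> 'b::comm_monoid_add" where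
  "pm_eval f p = (\<Sum>m\<in>Poly_Mapping.keys p. f m (Poly_Mapping.lookup p m))"

lemma pm_eval_superset:
  assumes "finite A" "Poly_Mapping.keys p \<subseteq> A" "\<And>m. f m 0 = 0"
  shows "pm_eval f p = (\<Sum>m\<in>A. f m (Poly_Mapping.lookup p m))"
  unfolding pm_eval_def using assms
  by (intro sum.mono_neutral_left) (auto simp: in_keys_iff)

lemma pm_eval_single: "f m 0 = 0 \<Longrightarrow> pm_eval f (Poly_Mapping.single m r) = f m r"
  by (cases "r = 0") (simp_all add: pm_eval_def)

lemma pm_eval_zero [simp]: "pm_eval f 0 = 0"
  by (simp add: pm_eval_def)

lemma pm_eval_add:
  fixes f :: "'m \<Rightarrow> 'r::monoid_add \<Rightarrow> 'b::cancel_comm_monoid_add"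
  assumes add: "\<And>m r r'. f m (r + r') = f m r + f m r'"
  shows "pm_eval f (p + q) = pm_eval f p + pm_eval f q"
proof -
  have zero: "f m 0 = 0" for m using add[of m 0 0] by simp
  let ?A = "Poly_Mapping.keys p \<union> Poly_Mapping.keys q"
  have "pm_eval f (p + q) = (\<Sum>m\<in>?A. f m (Poly_Mapping.lookup (p + q) m))"
    using Poly_Mapping.keys_add[of p q] by (intro pm_eval_superset zero) auto
  also have "\<dots> = pm_eval f p + pm_eval f q"
    by (simp add: pm_eval_superset[where A = ?A and f = f, OF _ _ zero] lookup_add add sum.distrib)
  finally show ?thesis .
qed

lemma pm_eval_diff:
  fixes f :: "'m \<Rightarrow> 'r::ab_group_add \<Rightarrow> 'b::ab_group_add"
  assumes add: "\<And>m r r'. f m (r + r') = f m r + f m r'"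
  shows "pm_eval f (p - q) = pm_eval f p - pm_eval f q"
  using pm_eval_add[of f "p - q" q, OF add] by (simp add: algebra_simps)

lemma poly_mapping_sum_singles:
  fixes p :: "'m \<Rightarrow>\<^sub>0 'r::comm_monoid_add"
  shows "p = (\<Sum>m\<in>Poly_Mapping.keys p. Poly_Mapping.single m (Poly_Mapping.lookup p m))"
  by (rule poly_mapping_eqI)
     (simp add: lookup_sum lookup_single when_def in_keys_iff)

lemma poly_mapping_single_induct [case_names zero single add]:
  fixes p :: "'m \<Rightarrow>\<^sub>0 'r::comm_monoid_add"
  assumes zero: "P 0" and single: "\<And>m r. P (Poly_Mapping.single m r)"
    and add: "\<And>p q. P p \<Longrightarrow> P q \<Longrightarrow> P (p + q)"
  shows "P p"
proof -
  have "P (\<Sum>m\<in>A. Poly_Mapping.single m (Poly_Mapping.lookup p m))" for A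
    by (induction A rule: infinite_finite_induct) (use assms in auto)
  then show ?thesis using poly_mapping_sum_singles[of p] by metis
qed

lemma pm_eval_mult:
  fixes f :: "'m::monoid_add \<Rightarrow> 'r::{semiring_0} \<Rightarrow> 'b::{semiring_0_cancel}"
  assumes add: "\<And>m r r'. f m (r + r') = f m r + f m r'"
    and mult: "\<And>m m' r r'. f (m + m') (r * r') = f m r * f m' r'"
  shows "pm_eval f (p * q) = pm_eval f p * pm_eval f q"
proof -
  have zero: "f m 0 = 0" for m using add[of m 0 0] by simp
  show ?thesis
  proof (induction p rule: poly_mapping_single_induct)
    case (single m r)
    show ?case
      by (induction q rule: poly_mapping_single_induct)
         (simp_all add: mult_single pm_eval_single zero mult pm_eval_add[of f, OF add] distrib_left)
  qed (simp_all add: pm_eval_add[of f, OF add] distrib_right)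
qed

section \<open>Polynomials\<close>

text \<open>Since the \<open>e\<^sub>i\<close> sum to zero, they generate the weight lattice as a monoid, and the commutative
  subalgebra spanned by the \<open>X\<^sup>\<gamma>\<close> is a quotient of the polynomial ring in the \<open>X\<^bsup>e\<^sub>i\<^esup>\<close>. Working with
  polynomials has the advantage that they form an integral domain.\<close>

type_synonym mpoly = "(nat \<Rightarrow>\<^sub>0 nat) \<Rightarrow>\<^sub>0 laurent"

definition var :: "nat \<Rightarrow> mpoly" where "var j = Poly_Mapping.single (Poly_Mapping.single j 1) 1"
definition cst :: "laurent \<Rightarrow> mpoly" where "cst r = Poly_Mapping.single 0 r"

lemma cst_one: "cst 1 = 1"
  by (simp add: cst_def)

lemma var_neq: "i \<noteq> j \<Longrightarrow> var i - var j \<noteq> 0"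
proof
  assume "i \<noteq> j" and "var i - var j = 0"
  then have "Poly_Mapping.keys (var i) = Poly_Mapping.keys (var j)" by simp
  then have "Poly_Mapping.single i (1 :: nat) = Poly_Mapping.single j 1" by (simp add: var_def)
  then have "Poly_Mapping.keys (Poly_Mapping.single i (1 :: nat)) = Poly_Mapping.keys (Poly_Mapping.single j (1 :: nat))"
    by simp
  with \<open>i \<noteq> j\<close> show False by simp
qed

lemma mpoly_induct [case_names cst var add mult]:
  fixes p :: mpoly
  assumes cst: "\<And>r. P (cst r)" and var: "\<And>j. P (var j)"
    and add: "\<And>p q. P p \<Longrightarrow> P q \<Longrightarrow> P (p + q)" and mult: "\<And>p q. P p \<Longrightarrow> P q \<Longrightarrow> P (p * q)"
  shows "P p"
proof -
  have one: "P 1" using cst[of 1] by (simp add: cst_one)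
  have power: "P (Poly_Mapping.single (Poly_Mapping.single j k) 1)" for j k
  proof (induction k)
    case (Suc k)
    have "Poly_Mapping.single (Poly_Mapping.single j (Suc k)) 1
        = var j * Poly_Mapping.single (Poly_Mapping.single j k) (1 :: laurent)"
      by (simp add: var_def mult_single flip: single_add)
    then show ?case using mult[OF var Suc.IH] by simp
  qed (simp add: one)
  have monom: "P (Poly_Mapping.single m 1)" for m
  proof (induction m rule: poly_mapping_single_induct)
    case (add m m')
    have "Poly_Mapping.single (m + m') (1 :: laurent) = Poly_Mapping.single m 1 * Poly_Mapping.single m' 1"
      by (simp add: mult_single)
    then show ?case using mult[OF add.IH] by simp
  qed (simp_all add: one power)
  show ?thesis
  proof (induction p rule: poly_mapping_single_induct)
    case zero
    then show ?case using cst[of 0] by (simp add: cst_def)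
  next
    case (single m r)
    have "Poly_Mapping.single m r = cst r * Poly_Mapping.single m 1"
      by (simp add: cst_def mult_single)
    then show ?case using mult[OF cst monom] by simp
  qed (rule add)
qed

definition mono_act :: "(nat \<Rightarrow> nat) \<Rightarrow> (nat \<Rightarrow>\<^sub>0 nat) \<Rightarrow> nat \<Rightarrow>\<^sub>0 nat" where
  "mono_act w = pm_eval (\<lambda>j. Poly_Mapping.single (w j))"

definition poly_act :: "(nat \<Rightarrow> nat) \<Rightarrow> mpoly \<Rightarrow> mpoly" where
  "poly_act w = pm_eval (\<lambda>m. Poly_Mapping.single (mono_act w m))"

lemma mono_act_add: "mono_act w (m + m') = mono_act w m + mono_act w m'"
  unfolding mono_act_def by (rule pm_eval_add) (rule single_add)

lemma poly_act_add: "poly_act w (p + q) = poly_act w p + poly_act w q"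
  unfolding poly_act_def by (rule pm_eval_add) (rule single_add)

lemma poly_act_diff: "poly_act w (p - q) = poly_act w p - poly_act w q"
  unfolding poly_act_def by (rule pm_eval_diff) (rule single_add)

lemma poly_act_mult: "poly_act w (p * q) = poly_act w p * poly_act w q"
  unfolding poly_act_def by (rule pm_eval_mult) (simp_all add: single_add mult_single mono_act_add)

lemma poly_act_cst: "poly_act w (cst r) = cst r"
  by (simp add: poly_act_def cst_def pm_eval_single mono_act_def)

lemma poly_act_one [simp]: "poly_act w 1 = 1"
  using poly_act_cst[of w 1] by (simp add: cst_one)

lemma poly_act_var: "poly_act w (var j) = var (w j)"
  by (simp add: poly_act_def var_def pm_eval_single mono_act_def)

lemma poly_act_comp: "poly_act (v \<circ> w) p = poly_act v (poly_act w p)"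
  by (induction p rule: mpoly_induct) (simp_all add: poly_act_add poly_act_mult poly_act_cst poly_act_var)

lemma poly_act_id: "poly_act id p = p"
  by (induction p rule: mpoly_induct) (simp_all add: poly_act_add poly_act_mult poly_act_cst poly_act_var)

lemma poly_act_prod: "poly_act w (prod f A) = (\<Prod>a\<in>A. poly_act w (f a))"
  by (induction A rule: infinite_finite_induct) (simp_all add: poly_act_mult)

lemma poly_act_power: "poly_act w (p ^ k) = poly_act w p ^ k"
  by (induction k) (simp_all add: poly_act_mult)

definition off_diag :: "nat \<Rightarrow> (nat \<times> nat) set" where
  "off_diag n = {(i, j). i \<in> {1..n + 1} \<and> j \<in> {1..n + 1} \<and> i \<noteq> j}"

text \<open>Both orders of each pair occur, so a permutation of the variables permutes the factors
  and no sign arises.\<close>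

definition discr :: "nat \<Rightarrow> mpoly" where
  "discr n = (\<Prod>(i, j)\<in>off_diag n. var i - var j)"

lemma finite_off_diag: "finite (off_diag n)"
  by (rule finite_subset[of _ "{1..n + 1} \<times> {1..n + 1}"]) (auto simp: off_diag_def)

lemma poly_act_discr:
  assumes w: "w \<in> weyl n"
  shows "poly_act w (discr n) = discr n"
proof -
  have r: "Suc 0 \<le> w a" "w a \<le> Suc n" "Suc 0 \<le> inv w a" "inv w a \<le> Suc n"
    if "Suc 0 \<le> a" "a \<le> Suc n" for a
    using that weyl_in_range[OF w, of a] weyl_in_range[OF weyl_inv[OF w], of a] by auto
  have "poly_act w (discr n) = (\<Prod>(i, j)\<in>off_diag n. var (w i) - var (w j))"
    unfolding discr_def poly_act_prod by (intro prod.cong) (auto simp: poly_act_diff poly_act_var)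
  also have "\<dots> = (\<Prod>(i, j)\<in>off_diag n. var i - var j)"
    by (rule prod.reindex_bij_witness[of _ "\<lambda>(i, j). (inv w i, inv w j)" "\<lambda>(i, j). (w i, w j)"])
       (use w in \<open>auto simp: off_diag_def r weyl_eq_iff[OF w] weyl_eq_iff[OF weyl_inv[OF w]]\<close>)
  finally show ?thesis by (simp add: discr_def)
qed

lemma discr_factor:
  assumes "(i, j) \<in> off_diag n"
  obtains r where "discr n = (var i - var j) * r"
  using prod.remove[OF finite_off_diag assms, of "\<lambda>(i, j). var i - var j"] that
  unfolding discr_def by auto

definition mono_wt :: "nat \<Rightarrow> (nat \<Rightarrow>\<^sub>0 nat) \<Rightarrow> weight" where
  "mono_wt n m = lin n (\<lambda>i. int (Poly_Mapping.lookup m i))"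

lemma mono_wt_weights: "mono_wt n m \<in> weights n"
  by (simp add: mono_wt_def lin_weights)

lemma mono_wt_add: "mono_wt n (m + m') = mono_wt n m + mono_wt n m'"
  by (simp only: mono_wt_def lin_def lookup_add of_nat_add of_int_add distrib_right sum.distrib
      fun_eq_iff plus_fun_apply) simp

lemma mono_wt_zero [simp]: "mono_wt n 0 = 0"
  by (simp add: mono_wt_def lin_def fun_eq_iff)

lemma mono_wt_single:
  "mono_wt n (Poly_Mapping.single j 1) = (if j \<in> {1..n + 1} then eps n j else 0)"
proof -
  have "mono_wt n (Poly_Mapping.single j 1) = (\<lambda>a. \<Sum>i = 1..n + 1. if j = i then eps n i a else 0)"
    unfolding mono_wt_def lin_def by (intro ext sum.cong) (auto simp: lookup_single when_def)
  then show ?thesis by (simp only: sum.delta' finite_atLeastAtMost) (auto simp: fun_eq_iff)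
qed

lemma weight_is_mono_wt:
  assumes "\<gamma> \<in> weights n"
  obtains m where "\<gamma> = mono_wt n m"
proof -
  obtain c :: "nat \<Rightarrow> int" where c: "\<gamma> = lin n c"
    using assms unfolding weights_iff lin_def by blast
  \<comment> \<open>Adding K copies of the relation that the e_i sum to zero makes all coefficients
    nonnegative.\<close>
  define K where "K = (\<Sum>i = 1..n + 1. \<bar>c i\<bar>)"
  have K: "0 \<le> c i + K" if "i \<in> {1..n + 1}" for i
    using member_le_sum[of i "{1..n + 1}" "\<lambda>i. \<bar>c i\<bar>"] that unfolding K_def by auto
  define m where "m = (\<Sum>i = 1..n + 1. Poly_Mapping.single i (nat (c i + K)))"
  have lookup: "int (Poly_Mapping.lookup m i) = c i + K" if "i \<in> {1..n + 1}" for i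
  proof -
    have "Poly_Mapping.lookup m i = (\<Sum>j = 1..n + 1. if i = j then nat (c j + K) else 0)"
      unfolding m_def lookup_sum by (intro sum.cong) (auto simp: lookup_single when_def)
    also have "\<dots> = nat (c i + K)" using that by (simp only: sum.delta' finite_atLeastAtMost if_True)
    finally show ?thesis using K[OF that] by simp
  qed
  have "lin n c = mono_wt n m"
  proof (rule weights_eqI)
    fix a b assume ab: "a \<in> {1..n + 1}" "b \<in> {1..n + 1}"
    then show "lin n c a - lin n c b = mono_wt n m a - mono_wt n m b"
      unfolding mono_wt_def by (simp add: lin_diff lookup)
  qed (auto intro: weights_ambient lin_weights mono_wt_weights)
  then show thesis using that c by simp
qed

section \<open>Bernstein presentation\<close>

text \<open>Elements are built by ascending left multiplications, so that each step comes with the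
  hypotheses of \<open>Xf_up\<close>.\<close>

lemma weyl_induct [consumes 1, case_names id simple]:
  assumes "w \<in> weyl n" and id: "P id"
    and simple: "\<And>i w. w \<in> weyl n \<Longrightarrow> 1 \<le> i \<Longrightarrow> i \<le> n \<Longrightarrow> 0 \<le> strip (fin w) i (i + 1) \<Longrightarrow>
      hyp_count n (fin (transpose i (i + 1) \<circ> w)) = hyp_count n (fin w) + 1 \<Longrightarrow> P w \<Longrightarrow>
      P (transpose i (i + 1) \<circ> w)"
  shows "P w"
proof -
  obtain k where "hyp_count n (fin w) = real k" using hyp_count_nat[OF fin_mem[OF assms(1)]] .
  then show ?thesis using assms(1)
  proof (induction k arbitrary: w)
    case 0
    then show ?case using weyl_eq_id id by auto
  next
    case (Suc k)
    have "hyp_count n (fin id) = 0" by (simp add: hyp_count_eq_0_iff strip_def fin_def)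
    with Suc.prems have "w \<noteq> id" by (metis nat.distinct(1) of_nat_eq_0_iff)
    then obtain i where i: "1 \<le> i" "i \<le> n" "strip (fin w) i (i + 1) < 0"
      using weyl_descent[OF Suc.prems(2)] by blast
    let ?v = "transpose i (i + 1) \<circ> w"
    have v: "?v \<in> weyl n" using Suc.prems i by (intro weyl_comp weyl_simple)
    have len: "hyp_count n (fin ?v) = hyp_count n (fin w) - 1"
      using hyp_count_simple[OF Suc.prems(2) i(1,2)] i by simp
    have w: "transpose i (i + 1) \<circ> ?v = w" by (rule simple_cancel)
    have "0 \<le> strip (fin ?v) i (i + 1)"
      using hyp_count_simple[OF v i(1,2)] len unfolding w by (auto split: if_splits)
    moreover have "P ?v" using Suc.IH[OF _ v] len Suc.prems by (simp del: o_apply)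
    ultimately show ?case using simple[OF v i(1,2)] len unfolding w by simp
  qed
qed

context type_A_hecke
begin

section \<open>Polynomials evaluated in the Hecke algebra\<close>

definition \<Theta> :: "mpoly \<Rightarrow> 'h" where
  "\<Theta> = pm_eval (\<lambda>m r. scale r (X (mono_wt n m)))"

lemma \<Theta>_add: "\<Theta> (p + q) = \<Theta> p + \<Theta> q"
  unfolding \<Theta>_def by (rule pm_eval_add) (rule scale_left_distrib)

lemma \<Theta>_diff: "\<Theta> (p - q) = \<Theta> p - \<Theta> q"
  unfolding \<Theta>_def by (rule pm_eval_diff) (rule scale_left_distrib)

lemma \<Theta>_mult: "\<Theta> (p * q) = \<Theta> p * \<Theta> q"
  unfolding \<Theta>_def
  by (rule pm_eval_mult)
     (simp_all add: scale_left_distrib mono_wt_add X_add mono_wt_weights mult.commute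
        flip: scale_mult_left scale_mult_right)

lemma \<Theta>_zero [simp]: "\<Theta> 0 = 0"
  by (simp add: \<Theta>_def)

lemma \<Theta>_cst: "\<Theta> (cst r) = scale r 1"
  by (simp add: \<Theta>_def cst_def pm_eval_single)

lemma \<Theta>_uminus: "\<Theta> (- p) = - \<Theta> p"
  using \<Theta>_diff[of 0 p] by simp

lemma \<Theta>_one [simp]: "\<Theta> 1 = 1"
  using \<Theta>_cst[of 1] by (simp add: cst_one)

lemma \<Theta>_single: "\<Theta> (Poly_Mapping.single m r) = scale r (X (mono_wt n m))"
  by (simp add: \<Theta>_def pm_eval_single)

text \<open>Variables are indexed by all naturals, and \<open>mono_wt\<close> ignores exponents
  outside {1..n + 1}; the surplus variables therefore evaluate to 1.\<close>

lemma \<Theta>_var: "\<Theta> (var j) = (if j \<in> {1..n + 1} then X (eps n j) else 1)"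
  unfolding var_def \<Theta>_single mono_wt_single by simp

lemma \<Theta>_commute: "\<Theta> p * \<Theta> q = \<Theta> q * \<Theta> p"
  by (simp add: mult.commute flip: \<Theta>_mult)

lemma bernstein_var:
  assumes i: "1 \<le> i" "i \<le> n"
  shows "Si i * \<Theta> (var i) = \<Theta> (var (i + 1)) * Si i + \<Theta> (cst qq * var (i + 1))"
    "Si i * \<Theta> (var (i + 1)) = \<Theta> (var i) * Si i - \<Theta> (cst qq * var (i + 1))"
    "j \<noteq> i \<Longrightarrow> j \<noteq> i + 1 \<Longrightarrow> Si i * \<Theta> (var j) = \<Theta> (var j) * Si i"
proof -
  let ?a = "\<Theta> (var i)" and ?b = "\<Theta> (var (i + 1))"
  have near: "Ts i * ?b * Ts i = ?a" using bernstein_near[OF i] i by (simp add: \<Theta>_var)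
  have "Si i * ?a = (Si i * Ts i) * ?b * Ts i"
    unfolding near[symmetric] by (simp only: mult.assoc)
  also have "\<dots> = ?b * Ts i"
    using T_gen_inverse[OF i(2)] by simp
  finally show "Si i * ?a = ?b * Si i + \<Theta> (cst qq * var (i + 1))"
    by (simp add: \<Theta>_mult \<Theta>_cst right_diff_distrib scale_one_commute)
  have "Ts i * ?b = Ts i * ?b * (Ts i * Si i)" using T_gen_inverse[OF i(2)] by simp
  also have "\<dots> = ?a * Si i" unfolding near[symmetric] by (simp only: mult.assoc)
  finally show "Si i * ?b = ?a * Si i - \<Theta> (cst qq * var (i + 1))"
    by (simp add: \<Theta>_mult \<Theta>_cst left_diff_distrib)
  assume "j \<noteq> i" "j \<noteq> i + 1"
  then show "Si i * \<Theta> (var j) = \<Theta> (var j) * Si i"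
    using bernstein_far[OF i, of j]
    by (simp add: \<Theta>_var left_diff_distrib right_diff_distrib scale_one_commute)
qed

text \<open>The second conjunct determines \<open>p'\<close> as the Demazure operator applied to \<open>p\<close>.\<close>

lemma bernstein:
  assumes i: "1 \<le> i" "i \<le> n"
  obtains p' where "Si i * \<Theta> p = \<Theta> (poly_act (s i) p) * Si i + \<Theta> p'"
    "(var (i + 1) - var i) * p' = cst qq * var (i + 1) * (poly_act (s i) p - p)"
proof -
  have "\<exists>p'. Si i * \<Theta> p = \<Theta> (poly_act (s i) p) * Si i + \<Theta> p' \<and>
    (var (i + 1) - var i) * p' = cst qq * var (i + 1) * (poly_act (s i) p - p)"
  proof (induction p rule: mpoly_induct)
    case (cst r)
    show ?case
      by (rule exI[of _ 0]) (simp add: \<Theta>_cst poly_act_cst scale_one_commute)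
  next
    case (var j)
    consider "j = i" | "j = i + 1" | "j \<noteq> i" "j \<noteq> i + 1" by blast
    then show ?case
    proof cases
      case 1
      then show ?thesis
        using bernstein_var(1)[OF i]
        by (intro exI[of _ "cst qq * var (i + 1)"]) (simp add: poly_act_var mult.commute)
    next
      case 2
      have "(var (i + 1) - var i) * (- (cst qq * var (i + 1))) = cst qq * var (i + 1) * (var i - var (i + 1))"
        by (simp add: algebra_simps)
      then show ?thesis
        using bernstein_var(2)[OF i] 2
        by (intro exI[of _ "- (cst qq * var (i + 1))"]) (simp add: poly_act_var \<Theta>_uminus)
    next
      case 3
      then show ?thesis
        using bernstein_var(3)[OF i 3] by (intro exI[of _ 0]) (simp add: poly_act_var)
    qed
  next
    case (add p q)
    then obtain p' q' where
      p: "Si i * \<Theta> p = \<Theta> (poly_act (s i) p) * Si i + \<Theta> p'"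
        "(var (i + 1) - var i) * p' = cst qq * var (i + 1) * (poly_act (s i) p - p)"
      and q: "Si i * \<Theta> q = \<Theta> (poly_act (s i) q) * Si i + \<Theta> q'"
        "(var (i + 1) - var i) * q' = cst qq * var (i + 1) * (poly_act (s i) q - q)"
      by blast
    have "Si i * \<Theta> (p + q) = \<Theta> (poly_act (s i) (p + q)) * Si i + \<Theta> (p' + q')"
      unfolding \<Theta>_add poly_act_add distrib_left distrib_right p(1) q(1) by (simp only: ac_simps)
    moreover have "(var (i + 1) - var i) * (p' + q')
        = cst qq * var (i + 1) * (poly_act (s i) (p + q) - (p + q))"
      unfolding distrib_left p(2) q(2) poly_act_add by (simp add: algebra_simps)
    ultimately show ?case by blast
  next
    case (mult p q)
    then obtain p' q' where
      p: "Si i * \<Theta> p = \<Theta> (poly_act (s i) p) * Si i + \<Theta> p'"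
        "(var (i + 1) - var i) * p' = cst qq * var (i + 1) * (poly_act (s i) p - p)"
      and q: "Si i * \<Theta> q = \<Theta> (poly_act (s i) q) * Si i + \<Theta> q'"
        "(var (i + 1) - var i) * q' = cst qq * var (i + 1) * (poly_act (s i) q - q)"
      by blast
    \<comment> \<open>The correction term obeys the product rule of a derivation twisted by
      s_i.\<close>
    have "Si i * \<Theta> (p * q) = \<Theta> (poly_act (s i) p) * (Si i * \<Theta> q) + \<Theta> p' * \<Theta> q"
      unfolding \<Theta>_mult mult.assoc[symmetric] p(1) distrib_right by (simp only: mult.assoc)
    also have "\<dots> = \<Theta> (poly_act (s i) (p * q)) * Si i + \<Theta> (poly_act (s i) p * q' + p' * q)"
      unfolding q(1) poly_act_mult \<Theta>_mult \<Theta>_add distrib_left by (simp only: mult.assoc add.assoc)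
    finally have 1: "Si i * \<Theta> (p * q)
        = \<Theta> (poly_act (s i) (p * q)) * Si i + \<Theta> (poly_act (s i) p * q' + p' * q)" .
    have "(var (i + 1) - var i) * (poly_act (s i) p * q' + p' * q)
        = poly_act (s i) p * ((var (i + 1) - var i) * q') + (var (i + 1) - var i) * p' * q"
      by (simp only: distrib_left ac_simps)
    also have "\<dots> = cst qq * var (i + 1) * (poly_act (s i) (p * q) - p * q)"
      unfolding p(2) q(2) poly_act_mult by (simp add: algebra_simps)
    finally show ?case using 1 by blast
  qed
  then show thesis using that by blast
qed

text \<open>For an s_i-invariant polynomial the correction is annihilated by x_(i+1) - x_i, hence is
  zero because polynomials form a domain.\<close>

lemma Si_discr_commute:
  assumes i: "1 \<le> i" "i \<le> n"
  shows "Si i * \<Theta> (discr n) = \<Theta> (discr n) * Si i"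
proof -
  obtain p' where p': "Si i * \<Theta> (discr n) = \<Theta> (poly_act (s i) (discr n)) * Si i + \<Theta> p'"
    "(var (i + 1) - var i) * p' = cst qq * var (i + 1) * (poly_act (s i) (discr n) - discr n)"
    by (rule bernstein[OF i])
  have act: "poly_act (s i) (discr n) = discr n" by (rule poly_act_discr[OF weyl_simple[OF i]])
  have "(var (i + 1) - var i) * p' = 0" using p'(2) unfolding act by simp
  then have "p' = 0" using var_neq[of "i + 1" i] by simp
  then show ?thesis using p'(1) unfolding act by simp
qed

section \<open>Filtration by length\<close>

text \<open>The index is real because \<open>len\<close> is; below 0 the filtration is zero, so
  \<open>filt (len w - 1)\<close> also describes the empty lower part for the identity.\<close>

definition filt :: "real \<Rightarrow> 'h set" where
  "filt k = {h. \<exists>f. h = (\<Sum>v\<in>{v \<in> W. len v \<le> k}. \<Theta> (f v) * Xf v)}"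

lemma finite_len: "finite {v \<in> W. len v \<le> k}"
  by (simp add: finite_weyl)

lemma filt_zero: "0 \<in> filt k"
  unfolding filt_def by (rule CollectI, rule exI[of _ "\<lambda>_. 0"]) simp

lemma filt_add: "g \<in> filt k \<Longrightarrow> h \<in> filt k \<Longrightarrow> g + h \<in> filt k"
proof -
  assume "g \<in> filt k" "h \<in> filt k"
  then obtain f f' where "g = (\<Sum>v\<in>{v \<in> W. len v \<le> k}. \<Theta> (f v) * Xf v)"
    "h = (\<Sum>v\<in>{v \<in> W. len v \<le> k}. \<Theta> (f' v) * Xf v)"
    unfolding filt_def by blast
  then have "g + h = (\<Sum>v\<in>{v \<in> W. len v \<le> k}. \<Theta> (f v + f' v) * Xf v)"
    by (simp add: \<Theta>_add distrib_right sum.distrib)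
  then show ?thesis unfolding filt_def by (intro CollectI exI[of _ "\<lambda>v. f v + f' v"])
qed

lemma filt_\<Theta>: "h \<in> filt k \<Longrightarrow> \<Theta> p * h \<in> filt k"
proof -
  assume "h \<in> filt k"
  then obtain f where "h = (\<Sum>v\<in>{v \<in> W. len v \<le> k}. \<Theta> (f v) * Xf v)"
    unfolding filt_def by blast
  then have "\<Theta> p * h = (\<Sum>v\<in>{v \<in> W. len v \<le> k}. \<Theta> (p * f v) * Xf v)"
    by (simp add: \<Theta>_mult sum_distrib_left mult.assoc)
  then show ?thesis unfolding filt_def by (intro CollectI exI[of _ "\<lambda>v. p * f v"])
qed

lemma filt_scale: "h \<in> filt k \<Longrightarrow> scale r h \<in> filt k"
  using filt_\<Theta>[of h k "cst r"] unfolding \<Theta>_cst scale_one_mult(1)[of r h, symmetric] .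

lemma filt_diff: "g \<in> filt k \<Longrightarrow> h \<in> filt k \<Longrightarrow> g - h \<in> filt k"
  using filt_add[OF _ filt_scale[of h k "- 1"], of g] by simp

lemma filt_base:
  assumes "v \<in> W" "len v \<le> k"
  shows "\<Theta> p * Xf v \<in> filt k"
proof -
  have "(\<Sum>u\<in>{u \<in> W. len u \<le> k}. \<Theta> (if u = v then p else 0) * Xf u)
      = (\<Sum>u\<in>{u \<in> W. len u \<le> k}. if u = v then \<Theta> p * Xf v else 0)"
    by (intro sum.cong) auto
  also have "\<dots> = \<Theta> p * Xf v"
    using assms finite_len by (simp add: sum.delta)
  finally show ?thesis
    unfolding filt_def by (intro CollectI exI[of _ "\<lambda>u. if u = v then p else 0"]) simp
qed

lemma filt_base_one: "v \<in> W \<Longrightarrow> len v \<le> k \<Longrightarrow> Xf v \<in> filt k"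
  using filt_base[of v k 1] by simp

lemma filt_induct [consumes 1, case_names base zero add]:
  assumes "h \<in> filt k" and base: "\<And>p v. v \<in> W \<Longrightarrow> len v \<le> k \<Longrightarrow> P (\<Theta> p * Xf v)"
    and zero: "P 0" and add: "\<And>g h. P g \<Longrightarrow> P h \<Longrightarrow> P (g + h)"
  shows "P h"
proof -
  obtain f where h: "h = (\<Sum>v\<in>{v \<in> W. len v \<le> k}. \<Theta> (f v) * Xf v)"
    using assms(1) unfolding filt_def by blast
  have "P (\<Sum>v\<in>A. \<Theta> (f v) * Xf v)" if "A \<subseteq> {v \<in> W. len v \<le> k}" for A
    using that by (induction A rule: infinite_finite_induct) (use base zero add in auto)
  then show ?thesis unfolding h by blast
qed

lemma filt_mono:
  assumes "h \<in> filt k" "k \<le> l"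
  shows "h \<in> filt l"
  using assms(1) by (induction rule: filt_induct) (use assms(2) in \<open>auto intro: filt_base filt_zero filt_add\<close>)

text \<open>The Bernstein relation moves T_i^-1 to the right of the polynomial; next to X_v it
  either lengthens v by one letter or gives X_(s_i v) and X_v by the quadratic relation.\<close>

lemma filt_Si:
  assumes i: "1 \<le> i" "i \<le> n" and "h \<in> filt k"
  shows "Si i * h \<in> filt (k + 1)"
  using assms(3)
proof (induction rule: filt_induct)
  case (base p v)
  obtain p' where p': "Si i * \<Theta> p = \<Theta> (poly_act (s i) p) * Si i + \<Theta> p'"
    by (rule bernstein[OF i])
  have "Si i * (\<Theta> p * Xf v) = \<Theta> (poly_act (s i) p) * (Si i * Xf v) + \<Theta> p' * Xf v"
    unfolding mult.assoc[symmetric] p' distrib_right ..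
  moreover have "Si i * Xf v \<in> filt (k + 1)"
  proof (cases "0 \<le> strip (fin v) i (i + 1)")
    case True
    then have "Xf (s i \<circ> v) \<in> filt (k + 1)"
      using hyp_count_simple[OF base(1) i] base by (intro filt_base_one weyl_comp weyl_simple i) simp_all
    then show ?thesis unfolding Xf_up[OF base(1) i True] .
  next
    case False
    then have "Xf (s i \<circ> v) \<in> filt (k + 1)" "\<Theta> (cst qq) * Xf v \<in> filt (k + 1)"
      using hyp_count_simple[OF base(1) i] base
      by (intro filt_base_one filt_base weyl_comp weyl_simple i; simp)+
    then show ?thesis
      using Si_Xf_down[OF base(1) i] False filt_diff unfolding \<Theta>_cst by simp
  qed
  moreover have "\<Theta> p' * Xf v \<in> filt (k + 1)" using base by (intro filt_base) auto
  ultimately show ?case by (simp only: filt_add filt_\<Theta>)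
qed (simp_all add: filt_zero filt_add distrib_left)

text \<open>Finite simple reflections are split off on the left as long as they shorten x. What
  remains is shortest in its coset W x and factors as X^\<gamma> X_v.\<close>

lemma T_filt:
  assumes "x \<in> ext_weyl n"
  shows "\<exists>k. T x \<in> filt k"
proof -
  obtain k where "hyp_count n x = real k" using hyp_count_nat[OF assms] .
  then show ?thesis using assms
  proof (induction k arbitrary: x rule: less_induct)
    case (less k)
    show ?case
    proof (cases "\<exists>i. 1 \<le> i \<and> i \<le> n \<and> strip x i (i + 1) < 0")
      case True
      then obtain i where i: "1 \<le> i" "i \<le> n" "strip x i (i + 1) < 0" by blast
      let ?y = "aff_mult (aff_gen n i) x"
      have y: "?y \<in> ext_weyl n" using less.prems i by (intro ext_weyl_mult aff_gen_mem)
      have count: "hyp_count n ?y = hyp_count n x - 1"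
        using hyp_count_gen[OF less.prems(2) i(1,2)] i(3) by simp
      obtain k' where k': "hyp_count n ?y = real k'" using hyp_count_nat[OF y] .
      then have "k' < k" using count less.prems by simp
      then obtain l where l: "T ?y \<in> filt l" using less.IH[OF _ k' y] by blast
      have "T x = Ts i * T ?y"
        using T_gen_up[OF i(2) y] count by (simp add: aff_gen_cancel[OF i(2) less.prems(2)])
      also have "\<dots> = Si i * T ?y + scale qq (T ?y)"
        by (simp add: left_diff_distrib flip: scale_one_mult(1))
      also have "\<dots> \<in> filt (l + 1)"
        using l by (intro filt_add filt_Si i filt_scale filt_mono[OF l]) auto
      finally show ?thesis by blast
    next
      case False
      obtain \<gamma> v where x: "x = (\<gamma>, v)" by (cases x)
      have v: "v \<in> W" and \<gamma>: "\<gamma> \<in> weights n" using less.prems x by (auto simp: ext_weyl_def)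
      obtain m where m: "\<gamma> = mono_wt n m" using weight_is_mono_wt[OF \<gamma>] .
      have "T x = X \<gamma> * Xf v"
        unfolding x using False less.prems by (intro T_left_minimal) (auto simp: x not_less)
      also have "\<dots> = \<Theta> (Poly_Mapping.single m 1) * Xf v"
        by (simp add: \<Theta>_single m)
      also have "\<dots> \<in> filt (len v)" using v by (intro filt_base) auto
      finally show ?thesis by blast
    qed
  qed
qed

lemma all_filt: "\<exists>k. h \<in> filt k"
proof -
  have "subspace {h. \<exists>k. h \<in> filt k}"
  proof (rule subspaceI)
    fix g h assume "g \<in> {h. \<exists>k. h \<in> filt k}" "h \<in> {h. \<exists>k. h \<in> filt k}"
    then obtain k l where "g \<in> filt k" "h \<in> filt l" by blast
    then have "g + h \<in> filt (max k l)" by (intro filt_add) (auto elim: filt_mono)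
    then show "g + h \<in> {h. \<exists>k. h \<in> filt k}" by blast
  qed (use filt_zero filt_scale in blast)+
  then have "span (T ` ext_weyl n) \<subseteq> {h. \<exists>k. h \<in> filt k}"
    using T_filt by (intro span_minimal) auto
  then show ?thesis unfolding T_span by blast
qed

section \<open>Centrality of the discriminant and intertwiners\<close>

lemma Xf_discr_commute:
  assumes "w \<in> W"
  shows "Xf w * \<Theta> (discr n) = \<Theta> (discr n) * Xf w"
  using assms
proof (induction rule: weyl_induct)
  case (simple i w)
  have "Xf (s i \<circ> w) * \<Theta> (discr n) = Si i * (\<Theta> (discr n) * Xf w)"
    unfolding Xf_up[OF simple(1-4)] mult.assoc simple.IH ..
  also have "\<dots> = \<Theta> (discr n) * Xf (s i \<circ> w)"
    unfolding Xf_up[OF simple(1-4)] mult.assoc[symmetric] Si_discr_commute[OF simple(2,3)] ..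
  finally show ?case .
qed (simp only: Xf_id mult_1_left mult_1_right)

lemma discr_central: "h * \<Theta> (discr n) = \<Theta> (discr n) * h"
proof -
  obtain k where "h \<in> filt k" using all_filt by blast
  then show ?thesis
  proof (induction rule: filt_induct)
    case (base p v)
    have "\<Theta> p * Xf v * \<Theta> (discr n) = \<Theta> p * \<Theta> (discr n) * Xf v"
      unfolding mult.assoc Xf_discr_commute[OF base(1)] ..
    then show ?case unfolding \<Theta>_commute[of p] mult.assoc .
  qed (simp_all add: distrib_left distrib_right)
qed

text \<open>Along a reduced word each letter acts on p by its reflection; the Bernstein correction
  omits that letter and thus lands in lower length.\<close>

lemma Xf_\<Theta>:
  assumes "u \<in> W"
  shows "\<exists>f\<in>filt (len u - 1). Xf u * \<Theta> p = \<Theta> (poly_act u p) * Xf u + f"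
  using assms
proof (induction rule: weyl_induct)
  case id
  then show ?case by (intro bexI[of _ 0]) (simp_all only: filt_zero poly_act_id Xf_id mult_1_left mult_1_right add_0_right)
next
  case (simple i w)
  then obtain f where f: "f \<in> filt (len w - 1)" "Xf w * \<Theta> p = \<Theta> (poly_act w p) * Xf w + f" by blast
  obtain p' where p': "Si i * \<Theta> (poly_act w p) = \<Theta> (poly_act (s i) (poly_act w p)) * Si i + \<Theta> p'"
    by (rule bernstein[OF simple(2,3)])
  have "Xf (s i \<circ> w) * \<Theta> p = Si i * \<Theta> (poly_act w p) * Xf w + Si i * f"
    unfolding Xf_up[OF simple(1-4)] mult.assoc f(2) distrib_left ..
  also have "\<dots> = \<Theta> (poly_act (s i \<circ> w) p) * Xf (s i \<circ> w) + (\<Theta> p' * Xf w + Si i * f)"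
    unfolding p' Xf_up[OF simple(1-4)] poly_act_comp by (simp only: distrib_right mult.assoc add.assoc)
  finally show ?case
    using filt_Si[OF simple(2,3) f(1)] filt_base[OF simple(1), of "len w" p'] simple(5)
    by (intro bexI[of _ "\<Theta> p' * Xf w + Si i * f"] filt_add) (simp_all del: o_apply)
qed

text \<open>Multiplication by x_(i+1) - x_i turns the Bernstein correction of p into (q - q^-1)
  x_(i+1) (s_i p - p). The added term, a multiple of x_(i+1), contributes (q - q^-1) x_(i+1) p and
  leaves a multiple of s_i p, so that \<tau>_i intertwines p and s_i p exactly.\<close>

definition \<tau> :: "nat \<Rightarrow> 'h" where
  "\<tau> i = \<Theta> (var (i + 1) - var i) * Si i + \<Theta> (cst qq * var (i + 1))"

lemma \<tau>_\<Theta>: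
  assumes i: "1 \<le> i" "i \<le> n"
  shows "\<tau> i * \<Theta> p = \<Theta> (poly_act (s i) p) * \<tau> i"
proof -
  obtain p' where p': "Si i * \<Theta> p = \<Theta> (poly_act (s i) p) * Si i + \<Theta> p'"
    "(var (i + 1) - var i) * p' = cst qq * var (i + 1) * (poly_act (s i) p - p)"
    by (rule bernstein[OF i])
  have "\<tau> i * \<Theta> p = \<Theta> (var (i + 1) - var i) * \<Theta> (poly_act (s i) p) * Si i
      + \<Theta> ((var (i + 1) - var i) * p' + cst qq * var (i + 1) * p)"
    unfolding \<tau>_def distrib_right mult.assoc p'(1) distrib_left \<Theta>_add \<Theta>_mult by (simp only: add.assoc)
  also have "(var (i + 1) - var i) * p' + cst qq * var (i + 1) * p
      = poly_act (s i) p * (cst qq * var (i + 1))"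
    unfolding p'(2) by (simp add: algebra_simps)
  also have "\<Theta> (var (i + 1) - var i) * \<Theta> (poly_act (s i) p) = \<Theta> (poly_act (s i) p) * \<Theta> (var (i + 1) - var i)"
    by (rule \<Theta>_commute)
  finally show ?thesis
    unfolding \<tau>_def distrib_left \<Theta>_mult[of "poly_act (s i) p"] by (simp only: mult.assoc)
qed

text \<open>Here t is the product of the \<tau>_i along a reduced word. Each letter contributes one
  difference x_a - x_b to the leading coefficient p, which divides D; q collects the cofactors and k
  counts the letters.\<close>

lemma intertwiner:
  assumes "w \<in> W"
  shows "\<exists>t p q k. \<exists>f\<in>filt (len w - 1). (\<forall>r. t * \<Theta> r = \<Theta> (poly_act w r) * t) \<and>
    t = \<Theta> p * Xf w + f \<and> p * q = discr n ^ k"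
  using assms
proof (induction rule: weyl_induct)
  case id
  show ?case
    by (rule exI[of _ 1], rule exI[of _ 1], rule exI[of _ 1], rule exI[of _ 0], rule bexI[of _ 0])
       (simp_all only: filt_zero poly_act_id Xf_id \<Theta>_one mult_1_left mult_1_right add_0_right power_0, simp)
next
  case (simple i w)
  then obtain t p q k f where f: "f \<in> filt (len w - 1)" and t: "\<And>r. t * \<Theta> r = \<Theta> (poly_act w r) * t"
    "t = \<Theta> p * Xf w + f" and pq: "p * q = discr n ^ k"
    by blast
  let ?b = "var (i + 1) - var i" and ?c = "cst qq * var (i + 1)"
  obtain r where r: "discr n = ?b * r"
    by (rule discr_factor[of "i + 1" i n]) (use simple(2,3) in \<open>auto simp: off_diag_def\<close>)
  \<comment> \<open>Moving \<tau>_i past the old coefficients twists them by s_i; since D is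
    invariant, the twisted product is still a power of D, and \<open>r\<close> completes the new
    factor \<open>?b\<close> to D.\<close>
  let ?p = "poly_act (s i) p * ?b" and ?q = "poly_act (s i) q * r"
  let ?f = "\<Theta> (poly_act (s i) p * ?c) * Xf w + (\<Theta> ?b * (Si i * f) + \<Theta> ?c * f)"
  have "?p * ?q = poly_act (s i) (p * q) * (?b * r)"
    unfolding poly_act_mult by (simp only: ac_simps)
  also have "\<dots> = discr n ^ Suc k"
    unfolding pq poly_act_power poly_act_discr[OF weyl_simple[OF simple(2,3)]] r[symmetric] by simp
  finally have 1: "?p * ?q = discr n ^ Suc k" .
  have "\<tau> i * t * \<Theta> r = \<Theta> (poly_act (s i \<circ> w) r) * (\<tau> i * t)" for r
    unfolding mult.assoc t(1) poly_act_comp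
    by (simp only: mult.assoc[symmetric] \<tau>_\<Theta>[OF simple(2,3)])
  moreover have "\<tau> i * t = \<Theta> ?p * Xf (s i \<circ> w) + ?f"
  proof -
    have "\<tau> i * t = \<Theta> (poly_act (s i) p) * (\<tau> i * Xf w) + \<tau> i * f"
      unfolding t(2) distrib_left mult.assoc[symmetric] \<tau>_\<Theta>[OF simple(2,3)] ..
    also have "\<dots> = \<Theta> ?p * (Si i * Xf w) + ?f"
      unfolding \<tau>_def \<Theta>_mult by (simp only: distrib_left distrib_right mult.assoc add.assoc)
    finally show ?thesis unfolding Xf_up[OF simple(1-4)] .
  qed
  moreover have "?f \<in> filt (len (s i \<circ> w) - 1)"
  proof (intro filt_add filt_base filt_\<Theta> simple(1))
    show "Si i * f \<in> filt (len (s i \<circ> w) - 1)"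
      using filt_Si[OF simple(2,3) f] simple(5) by simp
    show "f \<in> filt (len (s i \<circ> w) - 1)"
      using filt_mono[OF f] simple(5) by simp
  qed (use simple(5) in simp)
  ultimately show ?case using 1 by blast
qed

end

section \<open>Rows of the tableau\<close>

lemma psum_Suc: "k < length lam \<Longrightarrow> psum lam (Suc k) = psum lam k + lam ! k"
  by (simp add: psum_def take_Suc_conv_app_nth)

lemma psum_mono: "k \<le> l \<Longrightarrow> psum lam k \<le> psum lam l"
proof (induction rule: dec_induct)
  case (step m)
  then show ?case
    by (cases "m < length lam") (simp_all add: psum_Suc, simp add: psum_def)
qed simp

text \<open>Rows are numbered from 1, since \<open>psum lam 0\<close> is 0, whereas
  \<open>same_row\<close> numbers them from 0; hence the values \<open>Suc k\<close> below.\<close>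

definition row :: "nat list \<Rightarrow> nat \<Rightarrow> nat" where
  "row lam i = (LEAST k. i \<le> psum lam k)"

lemma row_eqI: "psum lam k < i \<Longrightarrow> i \<le> psum lam (Suc k) \<Longrightarrow> row lam i = Suc k"
  unfolding row_def by (rule Least_equality) (auto, metis leD le_less_trans not_less_eq_eq psum_mono)

locale tableau =
  fixes n :: nat and lam :: "nat list"
  assumes part: "partition_of lam (n + 1)"
begin

abbreviation sr :: "nat \<Rightarrow> nat \<Rightarrow> bool" where "sr \<equiv> same_row lam"
abbreviation J :: "nat set" where "J \<equiv> J_of n lam"
abbreviation Q :: "weight set" where "Q \<equiv> Q_of n lam"
abbreviation G :: "(nat \<Rightarrow> nat) set" where "G \<equiv> G_of n lam"

lemma psum_length: "psum lam (length lam) = n + 1"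
  using part by (simp add: psum_def partition_of_def)

lemma row_bounds:
  assumes "i \<in> {1..n + 1}"
  obtains k where "k < length lam" "row lam i = Suc k" "psum lam k < i" "i \<le> psum lam (Suc k)"
proof -
  have le: "i \<le> psum lam (length lam)" using assms psum_length by simp
  have 1: "i \<le> psum lam (row lam i)" unfolding row_def by (rule LeastI[of _ "length lam"]) (rule le)
  have 2: "row lam i \<le> length lam" unfolding row_def by (rule Least_le) (rule le)
  have "row lam i \<noteq> 0"
  proof
    assume "row lam i = 0"
    then have "i \<le> psum lam 0" using 1 by simp
    then show False using assms by (simp add: psum_def)
  qed
  then obtain k where k: "row lam i = Suc k" using not0_implies_Suc by blast
  have "\<not> i \<le> psum lam k" using not_less_Least[of k "\<lambda>k. i \<le> psum lam k"] k by (simp add: row_def)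
  then show thesis using that k 1 2 by simp
qed

lemma same_row_iff: "sr i j \<longleftrightarrow> i \<in> {1..n + 1} \<and> j \<in> {1..n + 1} \<and> row lam i = row lam j"
proof
  assume "sr i j"
  then obtain k where k: "k < length lam" "psum lam k < i" "i \<le> psum lam (Suc k)"
    "psum lam k < j" "j \<le> psum lam (Suc k)"
    by (auto simp: same_row_def)
  have "psum lam (Suc k) \<le> n + 1" using psum_mono[of "Suc k" "length lam" lam] k psum_length by simp
  then show "i \<in> {1..n + 1} \<and> j \<in> {1..n + 1} \<and> row lam i = row lam j"
    using k row_eqI by auto
next
  assume "i \<in> {1..n + 1} \<and> j \<in> {1..n + 1} \<and> row lam i = row lam j"
  moreover then obtain k where "k < length lam" "row lam i = Suc k" "psum lam k < i" "i \<le> psum lam (Suc k)"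
    using row_bounds[of i] by blast
  moreover obtain l where "row lam j = Suc l" "psum lam l < j" "j \<le> psum lam (Suc l)"
    using row_bounds[of j] calculation by blast
  ultimately show "sr i j" by (auto simp: same_row_def)
qed

lemma row_mono:
  assumes "j \<in> {1..n + 1}" "i \<le> j"
  shows "row lam i \<le> row lam j"
proof -
  obtain k where k: "row lam j = Suc k" "j \<le> psum lam (Suc k)" using row_bounds[OF assms(1)] by blast
  then have "i \<le> psum lam (row lam j)" using assms(2) by simp
  then show ?thesis unfolding row_def[of lam i] by (rule Least_le)
qed

lemma same_row_refl: "i \<in> {1..n + 1} \<Longrightarrow> sr i i"
  by (simp add: same_row_iff)

lemma same_row_sym: "sr i j \<Longrightarrow> sr j i"
  by (simp add: same_row_iff)

lemma same_row_trans: "sr i j \<Longrightarrow> sr j k \<Longrightarrow> sr i k"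
  by (simp add: same_row_iff)

lemma same_row_between: "sr i k \<Longrightarrow> i \<le> j \<Longrightarrow> j \<le> k \<Longrightarrow> sr i j"
  using row_mono[of j i] row_mono[of k j] by (auto simp: same_row_iff)

text \<open>The indices removed in \<open>J_of\<close> are the row ends, and the last row end is n +
  1; what is left are the entries with a right neighbour in their row.\<close>

lemma J_iff: "j \<in> J \<longleftrightarrow> 1 \<le> j \<and> j \<le> n \<and> sr j (j + 1)"
proof
  assume "j \<in> J"
  then have j: "j \<in> {1..n + 1}" and ne: "\<And>k. k \<in> {1..length lam} \<Longrightarrow> j \<noteq> psum lam k"
    by (auto simp: J_of_def)
  obtain k where k: "k < length lam" "psum lam k < j" "j \<le> psum lam (Suc k)"
    using row_bounds[OF j] by blast
  then have "j \<noteq> psum lam (Suc k)" using ne[of "Suc k"] by simp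
  then have "j + 1 \<le> psum lam (Suc k)" using k by simp
  then show "1 \<le> j \<and> j \<le> n \<and> sr j (j + 1)"
    using k j psum_mono[of "Suc k" "length lam" lam] psum_length by (auto simp: same_row_def)
next
  assume j: "1 \<le> j \<and> j \<le> n \<and> sr j (j + 1)"
  then obtain k where k: "k < length lam" "psum lam k < j" "j + 1 \<le> psum lam (Suc k)"
    by (auto simp: same_row_def)
  have "j \<noteq> psum lam l" for l
    using k psum_mono[of l k lam] psum_mono[of "Suc k" l lam] by (cases "l \<le> k") auto
  then show "j \<in> J" using j by (auto simp: J_of_def)
qed

lemma J_subset: "J \<subseteq> {1..n}"
  by (auto simp: J_iff)

lemma increasing_on_rows:
  fixes f :: "nat \<Rightarrow> nat"
  assumes "\<And>j. j \<in> J \<Longrightarrow> f j < f (j + 1)"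
  shows "sr a b \<Longrightarrow> a < b \<Longrightarrow> f a < f b"
proof (induction b)
  case (Suc b)
  have ab: "a \<le> b" using Suc.prems by simp
  have "sr a b" using same_row_between[of a "Suc b" b] Suc.prems ab by simp
  then have "sr b (Suc b)" using Suc.prems same_row_sym same_row_trans by blast
  then have "b \<in> J" using \<open>sr a b\<close> by (auto simp: J_iff same_row_iff)
  then have "f b < f (Suc b)" using assms by simp
  then show ?case using Suc.IH[OF \<open>sr a b\<close>] ab by (cases "a = b") auto
qed simp

section \<open>Minimal coset representatives\<close>

lemma parabolic_rows:
  assumes "w \<in> parabolic J"
  shows "w \<in> weyl n" "a \<in> {1..n + 1} \<Longrightarrow> sr a (w a)"
proof -
  obtain "is" where w: "w = weyl_word is" and "is": "set is \<subseteq> J" using assms by (auto simp: parabolic_def)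
  then show "w \<in> weyl n" using weyl_word_mem[of "is" n] J_subset by auto
  show "a \<in> {1..n + 1} \<Longrightarrow> sr a (w a)"
    using "is" unfolding w
  proof (induction "is")
    case Nil
    then show ?case unfolding weyl_word_Nil using same_row_refl by simp
  next
    case (Cons j "is")
    then have "sr a (weyl_word is a)" by simp
    moreover have "sr j (j + 1)" using Cons.prems J_iff by simp
    ultimately show ?case
      unfolding weyl_word_Cons by (auto simp: transpose_def same_row_iff)
  qed
qed

text \<open>Comparison with s_j u for j in \<open>J\<close> shows that the inverse of u increases
  along rows. Conversely, for such u all inversions counted in its length come from pairs in
  different rows, and W_lambda permutes these pairs, so w u has at least as many inversions.\<close>

lemma min_reps_iff:
  "u \<in> min_reps n lam \<longleftrightarrow> u \<in> weyl n \<and> (\<forall>a b. sr a b \<longrightarrow> a < b \<longrightarrow> inv u a < inv u b)"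
proof
  assume u: "u \<in> min_reps n lam"
  then have uW: "u \<in> weyl n" by (simp add: min_reps_def)
  have "inv u j < inv u (j + 1)" if "j \<in> J" for j
  proof -
    have j: "1 \<le> j" "j \<le> n" using that J_iff by auto
    have "weyl_word [j] \<in> parabolic J" using that unfolding parabolic_def by (intro CollectI exI[of _ "[j]"]) simp
    moreover have "weyl_word [j] = transpose j (j + 1)" unfolding weyl_word_Cons weyl_word_Nil by (rule comp_id)
    ultimately have "weyl_length n u \<le> weyl_length n (transpose j (j + 1) \<circ> u)"
      using u by (auto simp: min_reps_def)
    then have "real (weyl_length n u) \<le> real (weyl_length n (transpose j (j + 1) \<circ> u))"
      by (rule of_nat_mono)
    then have "hyp_count n (fin u) \<le> hyp_count n (fin (transpose j (j + 1) \<circ> u))"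
      unfolding weyl_length_eq[OF uW] weyl_length_eq[OF weyl_comp[OF weyl_simple[OF j] uW]] .
    then have "0 \<le> strip (fin u) j (j + 1)"
      unfolding hyp_count_simple[OF uW j] by (simp split: if_splits)
    then have "\<not> inv u (j + 1) < inv u j" by (auto simp: strip_def fin_def split: if_splits)
    moreover have "inv u j \<noteq> inv u (j + 1)" using weyl_eq_iff[OF weyl_inv[OF uW]] by simp
    ultimately show ?thesis by linarith
  qed
  then show "u \<in> weyl n \<and> (\<forall>a b. sr a b \<longrightarrow> a < b \<longrightarrow> inv u a < inv u b)"
    using uW increasing_on_rows[of "inv u"] by blast
next
  assume asm: "u \<in> weyl n \<and> (\<forall>a b. sr a b \<longrightarrow> a < b \<longrightarrow> inv u a < inv u b)"
  have "weyl_length n u \<le> weyl_length n (w \<circ> u)" if "w \<in> parabolic J" for w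
  proof -
    have w: "w \<in> weyl n" by (rule parabolic_rows[OF that])
    have rows: "row lam (w a) = row lam a \<and> w a \<in> {1..n + 1}" if "a \<in> {1..n + 1}" for a
      using parabolic_rows(2)[OF \<open>w \<in> parabolic J\<close> that] by (simp only: same_row_iff)
    have rows': "row lam (inv w a) = row lam a \<and> inv w a \<in> {1..n + 1}" if "a \<in> {1..n + 1}" for a
      using rows[of "inv w a"] that w weyl_in_range[OF weyl_inv[OF w], of a] by simp
    let ?D = "{(a, b) \<in> pairs n. row lam a \<noteq> row lam b}"
    let ?f = "\<lambda>v (a, b). if inv v b < inv v a then 1 else 0 :: real"
    \<comment> \<open>Rows are consecutive intervals, so a map preserving each row keeps the order
      of entries from different rows.\<close>
    have order: "x a < x b \<and> 1 \<le> x a \<and> x b \<le> n + 1 \<and> row lam (x a) \<noteq> row lam (x b)"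
      if "(a, b) \<in> ?D" and x: "\<And>a. a \<in> {1..n + 1} \<Longrightarrow> row lam (x a) = row lam a \<and> x a \<in> {1..n + 1}"
      for x :: "nat \<Rightarrow> nat" and a b
    proof -
      have ab: "a \<in> {1..n + 1}" "b \<in> {1..n + 1}" "a < b" "row lam a \<noteq> row lam b"
        using that(1) by (auto simp: pairs_def)
      then have "row lam a < row lam b" using row_mono[of b a] by auto
      then have "\<not> x b \<le> x a" using row_mono[of "x a" "x b"] x[OF ab(1)] x[OF ab(2)] by auto
      then show ?thesis using x[OF ab(1)] x[OF ab(2)] ab(4) by auto
    qed
    have "hyp_count n (fin u) = sum (?f u) ?D"
      unfolding hyp_count_fin_sum
    proof (rule sum.mono_neutral_cong_right)
      show "\<forall>p\<in>pairs n - ?D. (case p of (a, b) \<Rightarrow> if inv u b < inv u a then 1 else 0) = (0 :: real)"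
      proof
        fix p assume p: "p \<in> pairs n - ?D"
        obtain a b where ab: "p = (a, b)" by (cases p)
        have "sr a b" "a < b" using p unfolding ab by (auto simp: pairs_def same_row_iff)
        then have "inv u a < inv u b" using asm by blast
        then show "(case p of (a, b) \<Rightarrow> if inv u b < inv u a then 1 else 0) = (0 :: real)" by (simp add: ab)
      qed
    qed auto
    also have "\<dots> = sum (?f (w \<circ> u)) ?D"
    proof (rule sum.reindex_bij_witness[of _ "\<lambda>(a, b). (inv w a, inv w b)" "\<lambda>(a, b). (w a, w b)"])
      fix p assume p: "p \<in> ?D"
      obtain a b where ab: "p = (a, b)" by (cases p)
      show "(case p of (a, b) \<Rightarrow> (w a, w b)) \<in> ?D"
        using order[of a b w] p rows unfolding ab by (simp add: pairs_def)
      show "(case p of (a, b) \<Rightarrow> (inv w a, inv w b)) \<in> ?D"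
        using order[of a b "inv w"] p rows' unfolding ab by (simp add: pairs_def)
      show "?f (w \<circ> u) (case p of (a, b) \<Rightarrow> (w a, w b)) = ?f u p"
        using w asm unfolding ab by (simp add: weyl_inv_comp[of _ n])
    qed (use w in auto)
    also have "\<dots> \<le> hyp_count n (fin (w \<circ> u))"
      unfolding hyp_count_fin_sum by (rule sum_mono2) (auto split: if_splits)
    finally have "real (weyl_length n u) \<le> real (weyl_length n (w \<circ> u))"
      using asm w by (simp add: weyl_length_eq weyl_comp del: o_apply)
    then show ?thesis by simp
  qed
  then show "u \<in> min_reps n lam" using asm by (simp add: min_reps_def)
qed

section \<open>The symmetry group\<close>

definition row_pairs :: "(nat \<times> nat) set" where
  "row_pairs = {(a, b). sr a b \<and> a < b}"

lemma eps_diff_inj: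
  assumes "i \<in> {1..n + 1}" "j \<in> {1..n + 1}" "i \<noteq> j" "i' \<noteq> j'"
    and eq: "eps n i - eps n j = eps n i' - eps n j'"
  shows "i = i' \<and> j = j'"
proof -
  have "(if a = i then 1 else 0) - (if a = j then 1 else 0) = (if a = i' then 1 else 0) - (if a = j' then 1 else (0 :: real))"
    if "a \<in> {1..n + 1}" for a
    using fun_cong[OF eq, of a] that by (simp add: eps_def)
  from this[OF assms(1)] this[OF assms(2)] show ?thesis
    using assms(3,4) by (auto split: if_splits)
qed

lemma pos_roots_of_eq: "pos_roots_of n lam = (\<lambda>(a, b). eps n a - eps n b) ` row_pairs"
proof
  show "pos_roots_of n lam \<subseteq> (\<lambda>(a, b). eps n a - eps n b) ` row_pairs"
  proof
    fix \<alpha> assume "\<alpha> \<in> pos_roots_of n lam"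
    then have "\<alpha> \<in> roots_of n lam" "\<alpha> \<in> pos_roots n" by (simp_all add: pos_roots_of_def)
    then obtain i j i' j' where
      ij: "\<alpha> = eps n i - eps n j" "i \<in> {1..n + 1}" "j \<in> {1..n + 1}" "i \<noteq> j" "sr i j" and
      ij': "\<alpha> = eps n i' - eps n j'" "i' < j'"
      unfolding roots_of_def pos_roots_def by blast
    then have "i = i' \<and> j = j'" by (intro eps_diff_inj) auto
    then have "\<alpha> = (\<lambda>(a, b). eps n a - eps n b) (i, j)" "(i, j) \<in> row_pairs"
      using ij ij' by (auto simp: row_pairs_def)
    then show "\<alpha> \<in> (\<lambda>(a, b). eps n a - eps n b) ` row_pairs" by blast
  qed
  show "(\<lambda>(a, b). eps n a - eps n b) ` row_pairs \<subseteq> pos_roots_of n lam"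
  proof (clarsimp simp: row_pairs_def)
    fix a b assume "sr a b" "a < b"
    then have "eps n a - eps n b \<in> roots_of n lam" "eps n a - eps n b \<in> pos_roots n"
      unfolding roots_of_def pos_roots_def
      by (intro CollectI exI[of _ a] exI[of _ b]; simp add: same_row_iff)+
    then show "eps n a - eps n b \<in> pos_roots_of n lam" by (simp add: pos_roots_of_def)
  qed
qed

lemma row_pairs_inj: "inj_on (\<lambda>(a, b). eps n a - eps n b) row_pairs"
proof (rule inj_onI)
  fix p q assume pq: "p \<in> row_pairs" "q \<in> row_pairs"
    and eq: "(case p of (a, b) \<Rightarrow> eps n a - eps n b) = (case q of (a, b) \<Rightarrow> eps n a - eps n b)"
  obtain a b a' b' where [simp]: "p = (a, b)" "q = (a', b')" by (cases p, cases q)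
  have "a = a' \<and> b = b'"
    by (rule eps_diff_inj) (use pq eq in \<open>simp_all add: row_pairs_def same_row_iff\<close>)
  then show "p = q" by simp
qed

lemma alcove_of_iff:
  "v \<in> alcove_of n lam \<longleftrightarrow>
     v \<in> ambient n \<and> (\<forall>a b. sr a b \<longrightarrow> a < b \<longrightarrow> 0 \<le> v a - v b \<and> v a - v b \<le> 1)"
proof -
  have "inprod n v (eps n a - eps n b) = v a - v b" if "sr a b" for a b
    using that by (intro inprod_eps_diff) (auto simp: same_row_iff)
  then show ?thesis
    unfolding alcove_of_def pos_roots_of_eq by (auto simp: row_pairs_def)
qed

lemma G_weyl: "g \<in> G \<Longrightarrow> g \<in> weyl n"
  by (simp add: G_of_def)

lemma G_inv:
  assumes "g \<in> G"
  shows "inv g \<in> G"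
proof -
  have g: "g \<in> weyl n" and im: "act g ` alcove_of n lam = alcove_of n lam" using assms by (auto simp: G_of_def)
  have "act (inv g) ` alcove_of n lam = act (inv g) ` act g ` alcove_of n lam" unfolding im ..
  also have "\<dots> = alcove_of n lam" using g by (simp add: image_image)
  finally show ?thesis using weyl_inv[OF g] by (simp add: G_of_def)
qed

text \<open>The alcove is probed at two points: one constant on every row shows that two entries of
  a row stay in a common row, and an interior point shows that their order is kept.\<close>

lemma G_inv_rows:
  assumes g: "g \<in> G" and ab: "sr a b" "a < b"
  shows "sr (inv g a) (inv g b) \<and> inv g a < inv g b"
proof -
  let ?h = "inv g"
  have gW: "g \<in> weyl n" using g G_weyl by blast
  have h: "?h a \<in> {1..n + 1}" "?h b \<in> {1..n + 1}"
    using weyl_in_range[OF weyl_inv[OF gW]] ab by (auto simp: same_row_iff)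
  have bound: "0 \<le> v (?h a) - v (?h b) \<and> v (?h a) - v (?h b) \<le> 1" if "v \<in> alcove_of n lam" for v
  proof -
    have "act g v \<in> alcove_of n lam" using g that by (auto simp: G_of_def)
    then show ?thesis using ab by (auto simp: alcove_of_iff act_def)
  qed
  have "row lam (?h a) = row lam (?h b)"
  proof (rule ccontr)
    assume ne: "row lam (?h a) \<noteq> row lam (?h b)"
    \<comment> \<open>The value 2 is chosen to exceed the alcove bound 1; subtracting the mean puts
      the point into V without changing differences.\<close>
    define c where "c x = (if row lam x = row lam (?h a) then 2 else 0 :: real)" for x
    define v where "v x = (if x \<in> {1..n + 1} then c x - sum c {1..n + 1} / real (n + 1) else 0)" for x
    have "(\<Sum>x = 1..n + 1. v x) = (\<Sum>x = 1..n + 1. c x - sum c {1..n + 1} / real (n + 1))"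
      by (intro sum.cong) (auto simp: v_def)
    also have "\<dots> = 0" by (simp only: sum_subtractf sum_constant card_atLeastAtMost) simp
    finally have "v \<in> ambient n" by (simp add: ambient_def v_def)
    then have "v \<in> alcove_of n lam" by (auto simp: alcove_of_iff v_def c_def same_row_iff)
    moreover have "v (?h a) - v (?h b) = 2" using ne h by (simp add: v_def c_def)
    ultimately show False using bound by fastforce
  qed
  then have "sr (?h a) (?h b)" using h by (simp add: same_row_iff)
  moreover have "interior_point n \<in> alcove_of n lam"
    using interior_point_ambient interior_point_diff by (auto simp: alcove_of_iff same_row_iff less_imp_le)
  then have "\<not> ?h b < ?h a"
    using bound[of "interior_point n"] interior_point_diff[of "?h b" "?h a" n] h by auto
  moreover have "?h a \<noteq> ?h b" using ab weyl_eq_iff[OF weyl_inv[OF gW]] by auto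
  ultimately show ?thesis by auto
qed

lemma G_rows: "g \<in> G \<Longrightarrow> sr a b \<Longrightarrow> a < b \<Longrightarrow> sr (g a) (g b) \<and> g a < g b"
  using G_inv_rows[OF G_inv, of g a b] weyl_inv_inv[OF G_weyl] by simp

lemma G_min_reps: "g \<in> G \<Longrightarrow> u \<in> min_reps n lam \<Longrightarrow> g \<circ> u \<in> min_reps n lam"
  using G_inv_rows[of g] by (auto simp: min_reps_iff weyl_comp weyl_inv_comp[OF G_weyl] G_weyl)

lemma two_rho: "2 * rho_of n lam x = (\<Sum>(a, b)\<in>row_pairs. eps n a x - eps n b x)"
  unfolding rho_of_def pos_roots_of_eq sum.reindex[OF row_pairs_inj] by (simp add: case_prod_unfold)

text \<open>G permutes the positive roots of the rows and hence fixes their sum. This keeps the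
  powers of -q^-1 in the character unchanged under G.\<close>

lemma G_two_rho:
  assumes g: "g \<in> G"
  shows "inprod n (act g \<gamma>) (\<lambda>x. 2 * rho_of n lam x) = inprod n \<gamma> (\<lambda>x. 2 * rho_of n lam x)"
proof -
  note gW = G_weyl[OF g]
  have eps: "eps n i (g x) = eps n (inv g i) x" for i x
    using fun_cong[OF act_eps[OF weyl_inv[OF gW]], of i x] weyl_inv_inv[OF gW] by (simp add: act_def)
  have "2 * rho_of n lam (g x) = 2 * rho_of n lam x" for x
  proof -
    have "(\<Sum>(a, b)\<in>row_pairs. eps n (inv g a) x - eps n (inv g b) x) = (\<Sum>(a, b)\<in>row_pairs. eps n a x - eps n b x)"
      by (rule sum.reindex_bij_witness[of _ "\<lambda>(a, b). (g a, g b)" "\<lambda>(a, b). (inv g a, inv g b)"])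
         (use gW G_rows[OF g] G_inv_rows[OF g] in \<open>auto simp: row_pairs_def\<close>)
    then show ?thesis unfolding two_rho eps .
  qed
  then have "inprod n \<gamma> (\<lambda>x. 2 * rho_of n lam x) = (\<Sum>x = 1..n + 1. \<gamma> (inv g (g x)) * (2 * rho_of n lam (g x)))"
    using gW by (simp add: inprod_def)
  also have "\<dots> = inprod n (act g \<gamma>) (\<lambda>x. 2 * rho_of n lam x)"
    unfolding inprod_def act_def by (rule weyl_sum[OF gW])
  finally show ?thesis ..
qed

section \<open>The group ring\<close>

lemma zspan_subset:
  assumes "finite B" "B \<subseteq> S" "0 \<in> S" and diff: "\<And>u v. u \<in> S \<Longrightarrow> v \<in> S \<Longrightarrow> u - v \<in> S"
  shows "zspan B \<subseteq> S"
proof -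
  have add: "u + v \<in> S" if "u \<in> S" "v \<in> S" for u v
    using diff[OF that(1) diff[OF assms(3) that(2)]] by simp
  have mult: "(\<lambda>x. of_int k * b x) \<in> S" if "b \<in> S" for k :: int and b :: weight
  proof (induction k rule: int_induct[of _ 0])
    case base
    then show ?case using assms(3) by (simp add: zero_fun_def)
  next
    case (step1 i)
    have "(\<lambda>x. of_int (i + 1) * b x) = (\<lambda>x. of_int i * b x) + b" by (simp add: fun_eq_iff algebra_simps)
    then show ?case using add[OF step1(2) that] by simp
  next
    case (step2 i)
    have "(\<lambda>x. of_int (i - 1) * b x) = (\<lambda>x. of_int i * b x) - b" by (simp add: fun_eq_iff algebra_simps)
    then show ?case using diff[OF step2(2) that] by simp
  qed
  have "(\<lambda>x. \<Sum>b\<in>B. of_int (c b) * b x) \<in> S" for c :: "weight \<Rightarrow> int"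
    using assms(1,2)
  proof (induction B rule: finite_induct)
    case empty
    then show ?case using assms(3) by (simp add: zero_fun_def)
  next
    case (insert b B)
    have "(\<lambda>x. \<Sum>b\<in>insert b B. of_int (c b) * b x) = (\<lambda>x. of_int (c b) * b x) + (\<lambda>x. \<Sum>b\<in>B. of_int (c b) * b x)"
      using insert.hyps by (simp add: fun_eq_iff)
    then show ?case using add[OF mult insert.IH] insert.prems by simp
  qed
  then show ?thesis by (auto simp: zspan_def)
qed

section \<open>The sublattice Q_lambda\<close>

lemma Q_zero: "0 \<in> Q"
  unfolding Q_of_def zspan_def by (rule CollectI, rule exI[of _ "\<lambda>_. 0"]) (simp add: fun_eq_iff)

lemma Q_diff:
  assumes "u \<in> Q" "v \<in> Q"
  shows "u - v \<in> Q"
proof -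
  obtain c d :: "weight \<Rightarrow> int" where "u = (\<lambda>x. \<Sum>b\<in>simple_root n ` J. of_int (c b) * b x)"
    "v = (\<lambda>x. \<Sum>b\<in>simple_root n ` J. of_int (d b) * b x)"
    using assms unfolding Q_of_def zspan_def by blast
  then have "u - v = (\<lambda>x. \<Sum>b\<in>simple_root n ` J. of_int (c b - d b) * b x)"
    by (simp add: fun_eq_iff algebra_simps sum_subtractf)
  then show ?thesis unfolding Q_of_def zspan_def by (intro CollectI exI[of _ "\<lambda>b. c b - d b"])
qed

lemma Q_add: "u \<in> Q \<Longrightarrow> v \<in> Q \<Longrightarrow> u + v \<in> Q"
  using Q_diff[of u "0 - v"] Q_diff[OF Q_zero] by simp

lemma finite_J: "finite J"
  by (rule finite_subset[OF J_subset]) simp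

lemma Q_subset:
  "simple_root n ` J \<subseteq> S \<Longrightarrow> 0 \<in> S \<Longrightarrow> (\<And>u v. u \<in> S \<Longrightarrow> v \<in> S \<Longrightarrow> u - v \<in> S) \<Longrightarrow> Q \<subseteq> S"
  unfolding Q_of_def using finite_J by (intro zspan_subset) auto

lemma simple_root_Q:
  assumes "j \<in> J"
  shows "simple_root n j \<in> Q"
proof -
  have "(\<lambda>x. \<Sum>b\<in>simple_root n ` J. of_int (if b = simple_root n j then 1 else 0) * b x) = simple_root n j"
  proof
    fix x
    have "(\<Sum>b\<in>simple_root n ` J. of_int (if b = simple_root n j then 1 else 0) * b x)
        = (\<Sum>b\<in>simple_root n ` J. if b = simple_root n j then b x else 0)"
      by (intro sum.cong) auto
    also have "\<dots> = simple_root n j x" using assms finite_J by (simp add: sum.delta)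
    finally show "(\<Sum>b\<in>simple_root n ` J. of_int (if b = simple_root n j then 1 else 0) * b x) = simple_root n j x" .
  qed
  then show ?thesis unfolding Q_of_def zspan_def by (intro CollectI exI) (rule sym)
qed

lemma row_root_Q: "sr a b \<Longrightarrow> a < b \<Longrightarrow> eps n a - eps n b \<in> Q"
proof (induction b)
  case (Suc b)
  have ab: "a \<le> b" using Suc.prems by simp
  have sr: "sr a b" using same_row_between[of a "Suc b" b] Suc.prems ab by simp
  then have "sr b (Suc b)" using Suc.prems same_row_sym same_row_trans by blast
  then have "b \<in> J" using sr by (auto simp: J_iff same_row_iff)
  then have b: "eps n b - eps n (Suc b) \<in> Q" using simple_root_Q[of b] by (simp add: simple_root_def)
  show ?case
  proof (cases "a = b")
    case False
    then have "a < b" using ab by simp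
    then have "eps n a - eps n b \<in> Q" by (rule Suc.IH[OF sr])
    then have "(eps n a - eps n b) + (eps n b - eps n (Suc b)) \<in> Q" using b by (rule Q_add)
    then show ?thesis by (simp only: diff_add_cancel add_diff_eq)
  qed (simp only: b)
qed simp

text \<open>A simple root of a row goes to a positive root of some row, which telescopes into simple
  roots of that row; the inverse of g gives the other inclusion.\<close>

lemma G_Q:
  assumes g: "g \<in> G"
  shows "act g ` Q = Q"
proof -
  have sub: "Q \<subseteq> {v. act g v \<in> Q}" if g: "g \<in> G" for g
  proof (rule Q_subset)
    show "simple_root n ` J \<subseteq> {v. act g v \<in> Q}"
      using G_rows[OF g] row_root_Q J_iff
      by (auto simp: simple_root_def act_diff act_eps[OF G_weyl[OF g]] simp del: Suc_eq_plus1)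
  qed (auto simp: Q_zero act_diff Q_diff)
  have "v = act g (act (inv g) v)" for v using G_weyl[OF g] by simp
  then show ?thesis using sub[OF g] sub[OF G_inv[OF g]] by blast
qed

section \<open>The group ring of cosets and the action of G\<close>

abbreviation K :: "zring set" where "K \<equiv> zeta_ring n lam"
abbreviation unit :: zring where "unit \<equiv> zeta n lam 0"

lemma coset_add: "(\<gamma> +o Q) + (\<delta> +o Q) = (\<gamma> + \<delta>) +o Q"
proof -
  have "Q + Q = Q"
    using Q_add Q_zero by (force simp: set_plus_def)
  then show ?thesis by (simp add: set_plus_rearrange)
qed

lemma Q_coset: "Q + (\<gamma> +o Q) = \<gamma> +o Q"
  using coset_add[of 0 \<gamma>] by simp

lemma K_zero: "0 \<in> K"
  by (simp add: zeta_ring_def)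

lemma K_add: "a \<in> K \<Longrightarrow> b \<in> K \<Longrightarrow> a + b \<in> K"
  unfolding zeta_ring_def using Poly_Mapping.keys_add[of a b] by blast

lemma K_diff: "a \<in> K \<Longrightarrow> b \<in> K \<Longrightarrow> a - b \<in> K"
  unfolding zeta_ring_def using keys_diff[of a b] by blast

lemma K_sum: "(\<And>i. i \<in> A \<Longrightarrow> f i \<in> K) \<Longrightarrow> sum f A \<in> K"
  by (induction A rule: infinite_finite_induct) (auto simp: K_zero K_add)

lemma K_mult: "a \<in> K \<Longrightarrow> b \<in> K \<Longrightarrow> a * b \<in> K"
proof -
  assume "a \<in> K" "b \<in> K"
  then have "{\<kappa> + \<kappa>' |\<kappa> \<kappa>'. \<kappa> \<in> Poly_Mapping.keys a \<and> \<kappa>' \<in> Poly_Mapping.keys b} \<subseteq> (\<lambda>\<gamma>. \<gamma> +o Q) ` weights n"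
    unfolding zeta_ring_def using coset_add weights_add by blast
  with keys_mult have "Poly_Mapping.keys (a * b) \<subseteq> (\<lambda>\<gamma>. \<gamma> +o Q) ` weights n"
    by (rule order_trans)
  then show ?thesis by (simp add: zeta_ring_def)
qed

lemma K_single: "\<gamma> \<in> weights n \<Longrightarrow> Poly_Mapping.single (\<gamma> +o Q) r \<in> K"
  by (auto simp: zeta_ring_def)

lemma K_zeta: "\<gamma> \<in> weights n \<Longrightarrow> zeta n lam \<gamma> \<in> K"
  by (simp add: zeta_def K_single)

lemma unit_K: "unit \<in> K"
  by (simp add: K_zeta weights_zero)

lemma unit_eq: "unit = Poly_Mapping.single Q 1"
  by (simp add: zeta_def)

lemma zscale_eq: "zscale r a = Poly_Mapping.single 0 r * a"
  unfolding zscale_def by (rule mult_map_scale_conv_mult)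

lemma zscale_zeta: "zscale r (zeta n lam \<gamma>) = Poly_Mapping.single (\<gamma> +o Q) r"
  by (simp add: zscale_eq zeta_def mult_single)

text \<open>The support Q of \<open>unit\<close> is absorbed by cosets but not by arbitrary sets, so
  neutrality holds on \<open>K\<close> only.\<close>

lemma unit_mult:
  assumes "a \<in> K"
  shows "unit * a = a"
proof -
  have "unit * a = (\<Sum>\<kappa>\<in>Poly_Mapping.keys a. unit * Poly_Mapping.single \<kappa> (Poly_Mapping.lookup a \<kappa>))"
    by (subst poly_mapping_sum_singles[of a]) (rule sum_distrib_left)
  also have "\<dots> = (\<Sum>\<kappa>\<in>Poly_Mapping.keys a. Poly_Mapping.single \<kappa> (Poly_Mapping.lookup a \<kappa>))"
  proof (rule sum.cong[OF refl])
    fix \<kappa> assume "\<kappa> \<in> Poly_Mapping.keys a"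
    then obtain \<gamma> where "\<kappa> = \<gamma> +o Q" using assms by (auto simp: zeta_ring_def)
    then show "unit * Poly_Mapping.single \<kappa> (Poly_Mapping.lookup a \<kappa>) = Poly_Mapping.single \<kappa> (Poly_Mapping.lookup a \<kappa>)"
      by (simp add: unit_eq mult_single Q_coset)
  qed
  finally show ?thesis using poly_mapping_sum_singles[of a] by simp
qed

lemma zact_eval: "zact g = pm_eval (\<lambda>\<kappa>. Poly_Mapping.single (act g ` \<kappa>))"
  by (simp add: fun_eq_iff zact_def pm_eval_def)

lemma zact_add: "zact g (a + b) = zact g a + zact g b"
  unfolding zact_eval by (rule pm_eval_add) (rule single_add)

lemma zact_diff: "zact g (a - b) = zact g a - zact g b"
  unfolding zact_eval by (rule pm_eval_diff) (rule single_add)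

lemma zact_zero: "zact g 0 = 0"
  by (simp add: zact_def)

lemma zact_sum: "zact g (sum f A) = (\<Sum>i\<in>A. zact g (f i))"
  by (induction A rule: infinite_finite_induct) (simp_all add: zact_zero zact_add)

lemma act_image_add: "act g ` (\<kappa> + \<kappa>') = act g ` \<kappa> + act g ` \<kappa>'"
  by (force simp: set_plus_def act_add)

lemma zact_mult: "zact g (a * b) = zact g a * zact g b"
  unfolding zact_eval by (rule pm_eval_mult) (simp_all add: single_add mult_single act_image_add)

lemma act_coset:
  assumes "g \<in> G"
  shows "act g ` (\<gamma> +o Q) = act g \<gamma> +o Q"
proof -
  have "act g ` (\<gamma> +o Q) = act g \<gamma> +o act g ` Q"
    by (force simp: elt_set_plus_def act_add)
  then show ?thesis by (simp add: G_Q[OF assms])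
qed

lemma zact_single:
  "g \<in> G \<Longrightarrow> zact g (Poly_Mapping.single (\<gamma> +o Q) r) = Poly_Mapping.single (act g \<gamma> +o Q) r"
  by (simp add: zact_eval pm_eval_single act_coset)

lemma zact_K:
  assumes "g \<in> G" "a \<in> K"
  shows "zact g a \<in> K"
  unfolding zact_def
proof (rule K_sum)
  fix \<kappa> assume "\<kappa> \<in> Poly_Mapping.keys a"
  then obtain \<gamma> where "\<kappa> = \<gamma> +o Q" and \<gamma>: "\<gamma> \<in> weights n" using assms(2) by (auto simp: zeta_ring_def)
  then have "act g ` \<kappa> = act g \<gamma> +o Q"
    using act_coset[OF assms(1)] by simp
  then show "Poly_Mapping.single (act g ` \<kappa>) (Poly_Mapping.lookup a \<kappa>) \<in> K"
    using K_single[OF weights_act[OF G_weyl[OF assms(1)] \<gamma>]] by simp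
qed

text \<open>An additive real function of weights that vanishes on Q_lambda. It grades the group ring
  by a torsion-free group even when P/Q_lambda has torsion.\<close>

definition row_sum :: "nat \<Rightarrow> weight \<Rightarrow> real" where
  "row_sum i v = (\<Sum>x\<in>{x. sr i x}. v x)"

lemma finite_row: "finite {x. sr i x}"
  by (rule finite_subset[of _ "{1..n + 1}"]) (auto simp: same_row_iff)

lemma row_sum_diff: "row_sum i (u - v) = row_sum i u - row_sum i v"
  by (simp add: row_sum_def sum_subtractf)

lemma row_sum_add: "row_sum i (u + v) = row_sum i u + row_sum i v"
  by (simp add: row_sum_def sum.distrib)

lemma row_sum_eps:
  assumes "a \<in> {1..n + 1}" "b \<in> {1..n + 1}"
  shows "row_sum i (eps n a - eps n b) = (if sr i a then 1 else 0) - (if sr i b then 1 else 0)"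
proof -
  have "row_sum i (eps n a - eps n b) = (\<Sum>x\<in>{x. sr i x}. (if x = a then 1 else 0) - (if x = b then 1 else 0))"
    unfolding row_sum_def by (intro sum.cong) (auto simp: eps_def same_row_iff)
  then show ?thesis using finite_row by (simp add: sum_subtractf sum.delta)
qed

lemma row_sum_Q:
  assumes "v \<in> Q"
  shows "row_sum i v = 0"
proof -
  have "Q \<subseteq> {v. row_sum i v = 0}"
  proof (rule Q_subset)
    show "simple_root n ` J \<subseteq> {v. row_sum i v = 0}"
    proof clarsimp
      fix j assume "j \<in> J"
      then have "sr j (j + 1)" "1 \<le> j" "j \<le> n" by (auto simp: J_iff)
      then have "sr i j \<longleftrightarrow> sr i (j + 1)" using same_row_trans same_row_sym by blast
      then show "row_sum i (simple_root n j) = 0"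
        using row_sum_eps[of j "j + 1" i] \<open>1 \<le> j\<close> \<open>j \<le> n\<close> by (simp add: simple_root_def)
    qed
  qed (auto simp: row_sum_diff, simp add: row_sum_def)
  then show ?thesis using assms by blast
qed

text \<open>A finite nonempty support has a coset of maximal row sum M; written as a shift of
  another coset in the support, it exhibits row sum M + 1 there.\<close>

lemma shift_keys_empty:
  assumes z: "z \<in> K" and \<delta>: "\<delta> \<in> weights n" "row_sum i \<delta> = - 1"
    and sub: "Poly_Mapping.keys z \<subseteq> (\<lambda>\<kappa>. (\<delta> +o Q) + \<kappa>) ` Poly_Mapping.keys z"
  shows "z = 0"
proof (rule ccontr)
  \<comment> \<open>The choice of representative is harmless, because the row sum is constant on
    cosets of Q.\<close>
  define F where "F \<kappa> = row_sum i (SOME v. v \<in> \<kappa>)" for \<kappa>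
  have F: "F (\<gamma> +o Q) = row_sum i \<gamma>" for \<gamma>
  proof -
    have "\<gamma> + 0 \<in> \<gamma> +o Q" using Q_zero by (intro set_plus_intro2)
    then have "(SOME v. v \<in> \<gamma> +o Q) \<in> \<gamma> +o Q" by (rule someI[of "\<lambda>v. v \<in> \<gamma> +o Q"])
    then obtain q where "q \<in> Q" "(SOME v. v \<in> \<gamma> +o Q) = \<gamma> + q" by (auto simp: elt_set_plus_def)
    then show ?thesis by (simp add: F_def row_sum_add row_sum_Q)
  qed
  assume "z \<noteq> 0"
  then have ne: "Poly_Mapping.keys z \<noteq> {}" by simp
  define M where "M = Max (F ` Poly_Mapping.keys z)"
  have "M \<in> F ` Poly_Mapping.keys z" unfolding M_def using ne by (intro Max_in) auto
  then obtain \<kappa> where \<kappa>: "\<kappa> \<in> Poly_Mapping.keys z" "F \<kappa> = M" by blast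
  then obtain \<kappa>' where \<kappa>': "\<kappa>' \<in> Poly_Mapping.keys z" "\<kappa> = (\<delta> +o Q) + \<kappa>'" using sub by blast
  obtain \<gamma> where "\<kappa>' = \<gamma> +o Q" using z \<kappa>'(1) by (auto simp: zeta_ring_def)
  then have "F \<kappa>' = M + 1" using \<kappa>(2) \<delta>(2) unfolding \<kappa>'(2) by (simp add: coset_add F row_sum_add)
  moreover have "F \<kappa>' \<le> M" unfolding M_def using \<kappa>'(1) by (intro Max_ge) auto
  ultimately show False by simp
qed

end

section \<open>The character of the Levi subalgebra\<close>

lemma qpow_mult: "qpow a * qpow b = qpow (a + b)"
  by (simp add: qpow_def mult_single)

lemma qpow_neq_1: "a \<noteq> 0 \<Longrightarrow> qpow a - 1 \<noteq> 0"
proof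
  assume "a \<noteq> 0" "qpow a - 1 = 0"
  then have "Poly_Mapping.keys (qpow a) = Poly_Mapping.keys (1 :: laurent)" by simp
  with \<open>a \<noteq> 0\<close> show False by (simp add: qpow_def)
qed

text \<open>Coefficientwise cancellation in the domain of Laurent polynomials; this works also when
  the group ring has zero divisors.\<close>

lemma const_mult_eq_0:
  fixes z :: zring
  assumes "Poly_Mapping.single 0 r * z = 0" "r \<noteq> 0"
  shows "z = 0"
proof -
  have "Poly_Mapping.map ((*) r) z = 0" using assms(1) by (simp add: mult_map_scale_conv_mult)
  then have "\<forall>k\<in>Poly_Mapping.keys z. r * Poly_Mapping.lookup z k = 0" by (simp add: map_eq_zero_iff)
  then have "Poly_Mapping.lookup z k = 0" for k
    using assms(2) by (cases "k \<in> Poly_Mapping.keys z") (auto simp: in_keys_iff)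
  then show ?thesis by (intro poly_mapping_eqI) simp
qed

locale levi_rep = type_A_hecke scale n T + tableau n lam
  for scale :: "laurent \<Rightarrow> 'h::ring_1 \<Rightarrow> 'h" and n :: nat and T :: "aff \<Rightarrow> 'h" and lam :: "nat list" +
  fixes \<psi> :: "'h \<Rightarrow> zring"
  assumes psi: "is_psi n scale T lam \<psi>"
begin

abbreviation L :: "'h set" where "L \<equiv> levi_subalgebra n scale T lam"

lemma psi_K: "x \<in> L \<Longrightarrow> \<psi> x \<in> K"
  and psi_one: "\<psi> 1 = unit"
  and psi_add: "x \<in> L \<Longrightarrow> y \<in> L \<Longrightarrow> \<psi> (x + y) = \<psi> x + \<psi> y"
  and psi_mult: "x \<in> L \<Longrightarrow> y \<in> L \<Longrightarrow> \<psi> (x * y) = \<psi> x * \<psi> y"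
  and psi_scale: "x \<in> L \<Longrightarrow> \<psi> (scale r x) = zscale r (\<psi> x)"
  and psi_T: "j \<in> J \<Longrightarrow> \<psi> (Ts j) = zscale (- qpow (- 1)) unit"
  and psi_X: "\<gamma> \<in> weights n \<Longrightarrow> \<psi> (X \<gamma>) =
    zscale (neg_qinv_pow \<lfloor>inprod n \<gamma> (\<lambda>j. 2 * rho_of n lam j)\<rfloor>) (zeta n lam \<gamma>)"
  using psi unfolding is_psi_def by blast+

lemma L_\<Theta>: "\<Theta> p \<in> L"
proof (induction p rule: mpoly_induct)
  case (var j)
  show ?case
    unfolding \<Theta>_var by (simp add: weights_eps levi_subalgebra.X_gen levi_subalgebra.one)
qed (simp_all add: \<Theta>_cst \<Theta>_add \<Theta>_mult levi_subalgebra.one levi_subalgebra.scale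
  levi_subalgebra.add levi_subalgebra.mult)

lemma L_Si:
  assumes "j \<in> J"
  shows "Si j \<in> L"
proof -
  have "Ts j + scale (- qq) 1 \<in> L"
    using assms by (intro levi_subalgebra.add levi_subalgebra.T_gen levi_subalgebra.scale levi_subalgebra.one)
  then show ?thesis by (simp only: scale_minus_left add_uminus_conv_diff)
qed

definition \<Psi> :: "mpoly \<Rightarrow> zring" where "\<Psi> p = \<psi> (\<Theta> p)"

lemma \<Psi>_K: "\<Psi> p \<in> K"
  by (simp add: \<Psi>_def psi_K L_\<Theta>)

lemma \<Psi>_add: "\<Psi> (p + q) = \<Psi> p + \<Psi> q"
  by (simp add: \<Psi>_def \<Theta>_add psi_add L_\<Theta>)

lemma \<Psi>_diff: "\<Psi> (p - q) = \<Psi> p - \<Psi> q"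
  using \<Psi>_add[of "p - q" q] by (simp add: algebra_simps)

lemma \<Psi>_mult: "\<Psi> (p * q) = \<Psi> p * \<Psi> q"
  by (simp add: \<Psi>_def \<Theta>_mult psi_mult L_\<Theta>)

lemma \<Psi>_cst: "\<Psi> (cst r) = Poly_Mapping.single Q r"
  using psi_scale[OF levi_subalgebra.one] by (simp add: \<Psi>_def \<Theta>_cst psi_one zscale_zeta)

lemma \<Psi>_one: "\<Psi> 1 = unit"
  by (simp add: \<Psi>_def psi_one)

text \<open>Both sides are ring homomorphisms in p, so it suffices to compare them on constants and
  variables, where \<open>G_two_rho\<close> matches the coefficients.\<close>

lemma zact_\<Psi>:
  assumes g: "g \<in> G"
  shows "zact g (\<Psi> p) = \<Psi> (poly_act g p)"
proof (induction p rule: mpoly_induct)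
  case (cst r)
  then show ?case using zact_single[OF g, of 0 r] by (simp add: \<Psi>_cst poly_act_cst)
next
  case (var j)
  show ?case
  proof (cases "j \<in> {1..n + 1}")
    case True
    then have g_j: "g j \<in> {1..n + 1}" using weyl_in_range[OF G_weyl[OF g]] by blast
    have "inprod n (eps n (g j)) (\<lambda>j. 2 * rho_of n lam j) = inprod n (eps n j) (\<lambda>j. 2 * rho_of n lam j)"
      using G_two_rho[OF g, of "eps n j"] by (simp add: act_eps[OF G_weyl[OF g]])
    then show ?thesis
      using True g_j unfolding \<Psi>_def poly_act_var \<Theta>_var
      by (simp only: if_True psi_X weights_eps zscale_zeta zact_single[OF g] act_eps[OF G_weyl[OF g]])
  next
    case False
    then have "g j \<notin> {1..n + 1}" using weyl_in_range[OF G_weyl[OF g]] by blast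
    then show ?thesis
      using False zact_single[OF g, of 0 1] unfolding \<Psi>_def poly_act_var \<Theta>_var
      by (simp only: if_False psi_one unit_eq) simp
  qed
qed (simp_all add: \<Psi>_add \<Psi>_mult zact_add zact_mult poly_act_add poly_act_mult)

lemma \<Psi>_var_coset:
  assumes "j \<in> {1..n + 1}"
  obtains r where "\<Psi> (var j) = Poly_Mapping.single (eps n j +o Q) r"
  using assms that unfolding \<Psi>_def \<Theta>_var by (simp add: psi_X weights_eps zscale_zeta)

lemma \<Psi>_var_inverse:
  assumes j: "j \<in> {1..n + 1}"
  obtains r where "Poly_Mapping.single ((0 - eps n j) +o Q) r * \<Psi> (var j) = unit"
proof -
  have w: "eps n j \<in> weights n" "0 - eps n j \<in> weights n"
    using j weights_eps weights_zero weights_diff by blast+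
  have "\<psi> (X (0 - eps n j)) * \<psi> (X (eps n j)) = \<psi> (X ((0 - eps n j) + eps n j))"
    unfolding X_add[OF w(2,1)] by (simp add: psi_mult levi_subalgebra.X_gen w del: diff_0)
  also have "\<dots> = unit" by (simp add: psi_one)
  finally have "\<psi> (X (0 - eps n j)) * \<Psi> (var j) = unit"
    using j unfolding \<Psi>_def \<Theta>_var by (simp only: if_True)
  then show thesis using that unfolding psi_X[OF w(2)] zscale_zeta by blast
qed

text \<open>The relation \<open>X\<^bsup>e\<^sub>j\<^esup> = T\<^sub>j X\<^bsup>e\<^sub>j\<^sub>+\<^sub>1\<^esup> T\<^sub>j\<close> makes the values of the character on a row a geometric sequence.\<close>

lemma \<Psi>_same_row:
  "sr a b \<Longrightarrow> a < b \<Longrightarrow> \<exists>k. k \<noteq> 0 \<and> \<Psi> (var a) = Poly_Mapping.single 0 (qpow k) * \<Psi> (var b)"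
proof -
  have step: "\<Psi> (var j) = Poly_Mapping.single 0 (qpow (- 2)) * \<Psi> (var (j + 1))" if "j \<in> J" for j
  proof -
    have j: "1 \<le> j" "j \<le> n" using that by (auto simp: J_iff)
    have "\<Psi> (var j) = \<psi> (Ts j * \<Theta> (var (j + 1)) * Ts j)"
      using bernstein_near[OF j] j by (simp add: \<Psi>_def \<Theta>_var)
    also have "\<dots> = \<psi> (Ts j) * \<Psi> (var (j + 1)) * \<psi> (Ts j)"
      using that by (simp add: \<Psi>_def psi_mult L_\<Theta> levi_subalgebra.T_gen levi_subalgebra.mult)
    also have "\<dots> = Poly_Mapping.single 0 (- qpow (- 1)) * Poly_Mapping.single 0 (- qpow (- 1))
        * (unit * (unit * \<Psi> (var (j + 1))))"
      unfolding psi_T[OF that] zscale_eq by (simp only: ac_simps)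
    also have "\<dots> = Poly_Mapping.single 0 (qpow (- 2)) * \<Psi> (var (j + 1))"
      by (simp add: unit_mult \<Psi>_K mult_single qpow_mult)
    finally show ?thesis .
  qed
  \<comment> \<open>The claim is strengthened to negative exponents, which cannot cancel when the
    ratios q^-2 of neighbours are multiplied.\<close>
  have "sr a b \<Longrightarrow> a < b \<Longrightarrow> \<exists>k<0. \<Psi> (var a) = Poly_Mapping.single 0 (qpow k) * \<Psi> (var b)"
  proof (induction b)
    case (Suc b)
    have ab: "a \<le> b" using Suc.prems by simp
    have sr: "sr a b" using same_row_between[of a "Suc b" b] Suc.prems ab by simp
    then have "sr b (Suc b)" using Suc.prems same_row_sym same_row_trans by blast
    then have b: "\<Psi> (var b) = Poly_Mapping.single 0 (qpow (- 2)) * \<Psi> (var (Suc b))"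
      using sr step[of b] by (auto simp: J_iff same_row_iff)
    show ?case
    proof (cases "a = b")
      case True
      then show ?thesis using b by (intro exI[of _ "- 2"]) simp
    next
      case False
      then obtain k where "k < 0" "\<Psi> (var a) = Poly_Mapping.single 0 (qpow k) * \<Psi> (var b)"
        using Suc.IH[OF sr] ab by auto
      moreover have "Poly_Mapping.single 0 (qpow k) * Poly_Mapping.single 0 (qpow (- 2))
          = (Poly_Mapping.single 0 (qpow (k + - 2)) :: zring)"
        by (simp only: mult_single qpow_mult add_0)
      ultimately show ?thesis
        unfolding b by (intro exI[of _ "k + - 2"]) (simp only: mult.assoc[symmetric], simp)
    qed
  qed simp
  then show "sr a b \<Longrightarrow> a < b \<Longrightarrow> \<exists>k. k \<noteq> 0 \<and> \<Psi> (var a) = Poly_Mapping.single 0 (qpow k) * \<Psi> (var b)"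
    by (metis less_irrefl)
qed

text \<open>After division by the invertible value at b, the equation reads (q^k - 1) z = 0 with k
  nonzero.\<close>

lemma factor_regular_row:
  assumes ab: "sr a b" "a < b" and z: "z \<in> K" "\<Psi> (var a) * z = \<Psi> (var b) * z"
  shows "z = 0"
proof -
  obtain k where k: "k \<noteq> 0" "\<Psi> (var a) = Poly_Mapping.single 0 (qpow k) * \<Psi> (var b)"
    using \<Psi>_same_row[OF ab] by blast
  obtain r where r: "Poly_Mapping.single ((0 - eps n b) +o Q) r * \<Psi> (var b) = unit" (is "?y * _ = _")
    using \<Psi>_var_inverse[of b] ab by (auto simp: same_row_iff)
  have "Poly_Mapping.single 0 (qpow k - 1) = (Poly_Mapping.single 0 (qpow k) - 1 :: zring)"
    by (simp only: single_diff single_one)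
  then have "Poly_Mapping.single 0 (qpow k - 1) * z = (Poly_Mapping.single 0 (qpow k) - 1) * (unit * z)"
    by (simp only: unit_mult[OF z(1)])
  also have "\<dots> = ?y * (\<Psi> (var a) * z - \<Psi> (var b) * z)"
    unfolding k(2) r[symmetric] by (simp only: algebra_simps mult_1_left)
  also have "\<dots> = 0" using z by simp
  finally show ?thesis using const_mult_eq_0 qpow_neq_1[OF k(1)] by blast
qed

text \<open>Within a row the two values differ by a power of q. Across rows, z equals its product
  with a multiple of \<zeta> at e_j - e_i, and this weight has sum -1 over the row of i, so the
  support of z cannot reproduce itself.\<close>

lemma factor_regular:
  assumes ij: "(i, j) \<in> off_diag n" and z: "z \<in> K" "\<Psi> (var i - var j) * z = 0"
  shows "z = 0"
proof -
  have R: "i \<in> {1..n + 1}" "j \<in> {1..n + 1}" "i \<noteq> j" using ij by (auto simp: off_diag_def)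
  have eq: "\<Psi> (var i) * z = \<Psi> (var j) * z" using z(2) by (simp add: \<Psi>_diff left_diff_distrib)
  show ?thesis
  proof (cases "sr i j")
    case True
    then consider "sr i j" "i < j" | "sr j i" "j < i" using R(3) same_row_sym by (meson nat_neq_iff)
    then show ?thesis using factor_regular_row z(1) eq by cases metis+
  next
    case False
    obtain r where r: "Poly_Mapping.single ((0 - eps n i) +o Q) r * \<Psi> (var i) = unit" (is "?y * _ = _")
      using \<Psi>_var_inverse[OF R(1)] by blast
    obtain r' where r': "\<Psi> (var j) = Poly_Mapping.single (eps n j +o Q) r'"
      using \<Psi>_var_coset[OF R(2)] by blast
    have "z = ?y * (\<Psi> (var i) * z)" using unit_mult[OF z(1)] unfolding r[symmetric] by (simp only: mult.assoc)
    also have "\<dots> = Poly_Mapping.single (((0 - eps n i) + eps n j) +o Q) (r * r') * z"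
      unfolding eq r' by (simp only: mult.assoc[symmetric] mult_single coset_add)
    also have "(0 - eps n i) + eps n j = eps n j - eps n i" by simp
    finally have "Poly_Mapping.keys z = Poly_Mapping.keys (Poly_Mapping.single ((eps n j - eps n i) +o Q) (r * r') * z)"
      by (rule arg_cong)
    also have "\<dots> \<subseteq> {\<kappa> + \<kappa>' |\<kappa> \<kappa>'.
        \<kappa> \<in> Poly_Mapping.keys (Poly_Mapping.single ((eps n j - eps n i) +o Q) (r * r')) \<and> \<kappa>' \<in> Poly_Mapping.keys z}"
      by (rule keys_mult)
    also have "\<dots> \<subseteq> (\<lambda>\<kappa>. ((eps n j - eps n i) +o Q) + \<kappa>) ` Poly_Mapping.keys z"
      by (auto split: if_splits)
    finally show ?thesis
      using row_sum_eps[OF R(2,1), of i] False same_row_refl[OF R(1)] weights_diff[OF weights_eps[OF R(2)] weights_eps[OF R(1)]]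
      by (intro shift_keys_empty[OF z(1)]) auto
  qed
qed

lemma discr_regular:
  assumes "z \<in> K" "\<Psi> (discr n) * z = 0"
  shows "z = 0"
proof -
  have "A \<subseteq> off_diag n \<Longrightarrow> \<Psi> (\<Prod>(i, j)\<in>A. var i - var j) * z = 0 \<Longrightarrow> z = 0" if "finite A" for A
    using that
  proof (induction A rule: finite_induct)
    case empty
    then show ?case using unit_mult[OF assms(1)] by (simp add: \<Psi>_one)
  next
    case (insert p A)
    obtain i j where p: "p = (i, j)" by (cases p)
    have "\<Psi> (var i - var j) * (\<Psi> (\<Prod>(i, j)\<in>A. var i - var j) * z) = 0"
      using insert.prems(2) insert.hyps by (simp add: p \<Psi>_mult mult.assoc)
    then have "\<Psi> (\<Prod>(i, j)\<in>A. var i - var j) * z = 0"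
      using factor_regular[of i j] K_mult[OF \<Psi>_K assms(1)] insert.prems(1) p by blast
    then show ?case using insert.IH insert.prems(1) by blast
  qed
  then show ?thesis using assms(2) finite_off_diag unfolding discr_def by blast
qed

section \<open>Invariants and cancellation of the discriminant\<close>

abbreviation Inv :: "zring set" where "Inv \<equiv> zeta_invariants n lam"

lemma Inv_zero: "0 \<in> Inv"
  by (simp add: zeta_invariants_def K_zero zact_zero)

lemma Inv_add: "a \<in> Inv \<Longrightarrow> b \<in> Inv \<Longrightarrow> a + b \<in> Inv"
  by (simp add: zeta_invariants_def K_add zact_add)

lemma Inv_diff: "a \<in> Inv \<Longrightarrow> b \<in> Inv \<Longrightarrow> a - b \<in> Inv"
  by (simp add: zeta_invariants_def K_diff zact_diff)

text \<open>The scalar d is itself invariant, so d annihilates the difference of g z and z and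
  regularity removes it.\<close>

lemma Inv_cancel:
  assumes z: "z \<in> K" and inv: "\<Psi> (discr n) * z \<in> Inv"
  shows "z \<in> Inv"
proof -
  have "zact g z = z" if g: "g \<in> G" for g
  proof -
    have "\<Psi> (discr n) * zact g z = zact g (\<Psi> (discr n) * z)"
      by (simp add: zact_mult zact_\<Psi>[OF g] poly_act_discr[OF G_weyl[OF g]])
    also have "\<dots> = \<Psi> (discr n) * z" using inv g by (simp add: zeta_invariants_def)
    finally have "\<Psi> (discr n) * (zact g z - z) = 0" by (simp add: right_diff_distrib)
    then have "zact g z - z = 0" by (rule discr_regular[OF K_diff[OF zact_K[OF g z] z]])
    then show ?thesis by simp
  qed
  then show ?thesis using z by (simp add: zeta_invariants_def)
qed

section \<open>Coordinates in the induced module\<close>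

abbreviation FT :: "('h \<Rightarrow>\<^sub>0 zring) set" where "FT \<equiv> formal_tensors n lam"
abbreviation NT :: "('h \<Rightarrow>\<^sub>0 zring) set" where "NT \<equiv> tensor_null n scale T lam \<psi>"
abbreviation reps :: "(nat \<Rightarrow> nat) set" where "reps \<equiv> min_reps n lam"
abbreviation coords :: "('h \<Rightarrow>\<^sub>0 zring) \<Rightarrow> ((nat \<Rightarrow> nat) \<Rightarrow> zring) \<Rightarrow> bool" where
  "coords \<equiv> is_coords n scale T lam \<psi>"

lemma NT_uminus: "m \<in> NT \<Longrightarrow> - m \<in> NT"
  using tensor_null.diff[OF tensor_null.zero] by force

lemma NT_add: "m \<in> NT \<Longrightarrow> m' \<in> NT \<Longrightarrow> m + m' \<in> NT"
  using tensor_null.diff[OF _ NT_uminus] by force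

lemma FT_single: "a \<in> K \<Longrightarrow> Poly_Mapping.single h a \<in> FT"
  by (simp add: formal_tensors_def lookup_single when_def K_zero)

lemma FT_add: "m \<in> FT \<Longrightarrow> m' \<in> FT \<Longrightarrow> m + m' \<in> FT"
  by (simp add: formal_tensors_def lookup_add K_add)

lemma FT_zero: "0 \<in> FT"
  by (simp add: formal_tensors_def K_zero)

lemma FT_sum: "(\<And>i. i \<in> A \<Longrightarrow> f i \<in> FT) \<Longrightarrow> sum f A \<in> FT"
  by (induction A rule: infinite_finite_induct) (auto simp: FT_zero FT_add)

lemma finite_reps: "finite reps"
  using finite_weyl by (rule finite_subset[rotated]) (auto simp: min_reps_def)

section \<open>Scalar action and right action on formal tensors\<close>

definition smul :: "zring \<Rightarrow> ('h \<Rightarrow>\<^sub>0 zring) \<Rightarrow> 'h \<Rightarrow>\<^sub>0 zring" where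
  "smul b = pm_eval (\<lambda>h a. Poly_Mapping.single h (a * b))"

definition rmul :: "'h \<Rightarrow> ('h \<Rightarrow>\<^sub>0 zring) \<Rightarrow> 'h \<Rightarrow>\<^sub>0 zring" where
  "rmul k = pm_eval (\<lambda>h. Poly_Mapping.single (h * k))"

lemma smul_add: "smul b (m + m') = smul b m + smul b m'"
  unfolding smul_def by (rule pm_eval_add) (simp add: distrib_right single_add)

lemma smul_diff: "smul b (m - m') = smul b m - smul b m'"
  unfolding smul_def by (rule pm_eval_diff) (simp add: distrib_right single_add)

lemma smul_single: "smul b (Poly_Mapping.single h a) = Poly_Mapping.single h (a * b)"
  by (simp add: smul_def pm_eval_single)

lemma smul_zero: "smul b 0 = 0"
  by (simp add: smul_def)

lemma smul_sum: "smul b (sum f A) = (\<Sum>i\<in>A. smul b (f i))"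
  by (induction A rule: infinite_finite_induct) (simp_all add: smul_zero smul_add)

lemma rmul_add: "rmul k (m + m') = rmul k m + rmul k m'"
  unfolding rmul_def by (rule pm_eval_add) (rule single_add)

lemma rmul_diff: "rmul k (m - m') = rmul k m - rmul k m'"
  unfolding rmul_def by (rule pm_eval_diff) (rule single_add)

lemma rmul_single: "rmul k (Poly_Mapping.single h a) = Poly_Mapping.single (h * k) a"
  by (simp add: rmul_def pm_eval_single)

lemma rmul_zero: "rmul k 0 = 0"
  by (simp add: rmul_def)

lemma rmul_sum: "rmul k (sum f A) = (\<Sum>i\<in>A. rmul k (f i))"
  by (induction A rule: infinite_finite_induct) (simp_all add: rmul_zero rmul_add)

text \<open>Generators go to generators; in the balanced relation the new scalar passes \<psi> l
  because the group ring is commutative. Stability under scalars here and under H in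
  \<open>rmul_NT\<close> makes coordinates linear and right multiplication a matrix.\<close>

lemma smul_NT:
  assumes "m \<in> NT" "b \<in> K"
  shows "smul b m \<in> NT"
  using assms(1)
proof induction
  case (balanced a l h)
  then show ?case
    using tensor_null.balanced[OF K_mult[OF balanced(1) assms(2)] balanced(2), where h = h]
    by (simp add: smul_diff smul_single ac_simps)
qed (simp_all add: smul_zero smul_diff smul_single tensor_null.zero tensor_null.diff
  tensor_null.biadditive K_mult assms(2))

lemma rmul_NT:
  assumes "m \<in> NT"
  shows "rmul k m \<in> NT"
  using assms
proof induction
  case (balanced a l h)
  then show ?case
    using tensor_null.balanced[OF balanced, where h = "h * k"]
    by (simp add: rmul_diff rmul_single mult.assoc)
qed (simp_all add: rmul_zero rmul_diff rmul_single tensor_null.zero tensor_null.diff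
  tensor_null.biadditive distrib_right)

end

locale levi_basis = levi_rep scale n T lam \<psi>
  for scale :: "laurent \<Rightarrow> 'h::ring_1 \<Rightarrow> 'h" and n :: nat and T :: "aff \<Rightarrow> 'h"
    and lam :: "nat list" and \<psi> :: "'h \<Rightarrow> zring" +
  assumes basis: "\<forall>m\<in>FT. \<exists>!c. coords m c"
begin

definition co :: "('h \<Rightarrow>\<^sub>0 zring) \<Rightarrow> (nat \<Rightarrow> nat) \<Rightarrow> zring" where
  "co m = (THE c. coords m c)"

lemma co_coords: "m \<in> FT \<Longrightarrow> coords m (co m)"
  unfolding co_def by (rule theI'[OF bspec[OF basis]])

lemma co_eqI: "m \<in> FT \<Longrightarrow> coords m c \<Longrightarrow> co m = c"
  unfolding co_def using bspec[OF basis] by (rule the1_equality)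

lemma co_K: "m \<in> FT \<Longrightarrow> co m u \<in> K"
  using co_coords[of m] by (cases "u \<in> reps") (auto simp: is_coords_def K_zero)

lemma co_NT: "m \<in> FT \<Longrightarrow> m - (\<Sum>u\<in>reps. Poly_Mapping.single (Xf u) (co m u)) \<in> NT"
  using co_coords[of m] by (simp add: is_coords_def)

lemma co_cong:
  assumes "m \<in> FT" "m' \<in> FT" "m - m' \<in> NT"
  shows "co m = co m'"
proof (rule co_eqI[OF assms(1)])
  have "m - (\<Sum>u\<in>reps. Poly_Mapping.single (Xf u) (co m' u)) \<in> NT"
    using NT_add[OF assms(3) co_NT[OF assms(2)]] by simp
  then show "coords m (co m')" using co_coords[OF assms(2)] by (simp add: is_coords_def)
qed

lemma co_add:
  assumes "m \<in> FT" "m' \<in> FT"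
  shows "co (m + m') = (\<lambda>u. co m u + co m' u)"
proof (rule co_eqI[OF FT_add[OF assms]])
  have "m + m' - (\<Sum>u\<in>reps. Poly_Mapping.single (Xf u) (co m u + co m' u)) \<in> NT"
    using NT_add[OF co_NT[OF assms(1)] co_NT[OF assms(2)]]
    by (simp add: single_add sum.distrib algebra_simps)
  then show "coords (m + m') (\<lambda>u. co m u + co m' u)"
    using co_coords[OF assms(1)] co_coords[OF assms(2)] by (simp add: is_coords_def K_add)
qed

lemma co_zero: "co 0 = (\<lambda>u. 0)"
  by (rule co_eqI[OF FT_zero]) (simp add: is_coords_def K_zero tensor_null.zero)

lemma co_sum: "(\<And>i. i \<in> A \<Longrightarrow> f i \<in> FT) \<Longrightarrow> co (sum f A) = (\<lambda>u. \<Sum>i\<in>A. co (f i) u)"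
  by (induction A rule: infinite_finite_induct) (simp_all add: co_zero co_add FT_sum)

section \<open>Coordinates of pure tensors\<close>

definition E :: "'h \<Rightarrow> zring \<Rightarrow> (nat \<Rightarrow> nat) \<Rightarrow> zring" where
  "E h a = co (Poly_Mapping.single h a)"

lemma E_K: "a \<in> K \<Longrightarrow> E h a u \<in> K"
  by (simp add: E_def co_K FT_single)

lemma E_add: "a \<in> K \<Longrightarrow> E (h + h') a u = E h a u + E h' a u"
proof -
  assume a: "a \<in> K"
  have "Poly_Mapping.single (h + h') a - (Poly_Mapping.single h a + Poly_Mapping.single h' a) \<in> NT"
    using tensor_null.biadditive[OF a, of h h'] by (simp add: algebra_simps)
  then have "E (h + h') a = co (Poly_Mapping.single h a + Poly_Mapping.single h' a)"
    unfolding E_def using a by (intro co_cong FT_add FT_single)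
  then show ?thesis using a by (simp add: E_def co_add FT_single)
qed

lemma E_zero: "a \<in> K \<Longrightarrow> E 0 a u = 0"
  using E_add[of a 0 0 u] by simp

lemma E_balanced:
  assumes "a \<in> K" "l \<in> L"
  shows "E (l * h) a = E h (a * \<psi> l)"
  using co_cong[OF FT_single FT_single tensor_null.balanced[OF assms]] assms
  by (simp add: E_def K_mult psi_K)

lemma E_smul:
  assumes "a \<in> K" "b \<in> K"
  shows "E h (a * b) u = E h a u * b"
proof -
  let ?m = "Poly_Mapping.single h a"
  have "smul b (?m - (\<Sum>u\<in>reps. Poly_Mapping.single (Xf u) (co ?m u))) \<in> NT"
    using assms by (intro smul_NT co_NT FT_single)
  then have "Poly_Mapping.single h (a * b) - (\<Sum>u\<in>reps. Poly_Mapping.single (Xf u) (co ?m u * b)) \<in> NT"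
    by (simp add: smul_diff smul_sum smul_single)
  then have "coords (Poly_Mapping.single h (a * b)) (\<lambda>u. co ?m u * b)"
    using co_coords[of ?m] assms by (simp add: is_coords_def FT_single K_mult)
  then show ?thesis
    using co_eqI[of "Poly_Mapping.single h (a * b)"] assms by (simp add: E_def FT_single K_mult)
qed

lemma E_unit: "a \<in> K \<Longrightarrow> E h a u = E h unit u * a"
  using E_smul[OF unit_K, of a h u] by (simp add: unit_mult)

lemma E_Xf:
  assumes "v \<in> reps" "a \<in> K"
  shows "E (Xf v) a = (\<lambda>u. if u = v then a else 0)"
  unfolding E_def
proof (rule co_eqI[OF FT_single[OF assms(2)]])
  have "(\<Sum>u\<in>reps. Poly_Mapping.single (Xf u) (if u = v then a else 0))
      = (\<Sum>u\<in>reps. if u = v then Poly_Mapping.single (Xf v) a else 0)"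
    by (intro sum.cong) auto
  also have "\<dots> = Poly_Mapping.single (Xf v) a"
    using assms(1) finite_reps by (simp add: sum.delta)
  finally show "coords (Poly_Mapping.single (Xf v) a) (\<lambda>u. if u = v then a else 0)"
    using assms by (auto simp: is_coords_def K_zero tensor_null.zero)
qed

text \<open>Right multiplication by k is applied to the expansion of the first tensor in the basis.
  For h = X_u times an element of H this is the product rule for matrices, whence the symmetry of
  the trace.\<close>

lemma E_mult:
  assumes a: "a \<in> K"
  shows "E (h * k) a u = (\<Sum>v\<in>reps. E h a v * E (Xf v * k) unit u)"
proof -
  let ?m = "Poly_Mapping.single h a"
  let ?r = "\<Sum>v\<in>reps. Poly_Mapping.single (Xf v * k) (E h a v)"
  have "rmul k (?m - (\<Sum>v\<in>reps. Poly_Mapping.single (Xf v) (co ?m v))) \<in> NT"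
    using a by (intro rmul_NT co_NT FT_single)
  then have "Poly_Mapping.single (h * k) a - ?r \<in> NT"
    by (simp add: rmul_diff rmul_sum rmul_single E_def)
  then have "E (h * k) a = co ?r"
    unfolding E_def[of "h * k"] using a by (intro co_cong FT_single FT_sum E_K)
  also have "\<dots> = (\<lambda>u. \<Sum>v\<in>reps. E (Xf v * k) (E h a v) u)"
    using a by (simp add: co_sum FT_single E_K E_def[of "Xf _ * k"])
  finally show ?thesis
    using E_unit[OF E_K[OF a]] by (simp add: mult.commute)
qed

section \<open>The trace\<close>

definition tr :: "'h \<Rightarrow> zring" where
  "tr h = (\<Sum>u\<in>reps. E (Xf u * h) unit u)"

lemma chi_eq_tr: "chi n scale T lam \<psi> h = tr h"
  unfolding chi_def tr_def E_def co_def using basis by (rule if_P)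

lemma tr_K: "tr h \<in> K"
  unfolding tr_def by (intro K_sum E_K unit_K)

lemma tr_add: "tr (g + h) = tr g + tr h"
  by (simp add: tr_def distrib_left E_add unit_K sum.distrib)

lemma tr_zero: "tr 0 = 0"
  using tr_add[of 0 0] by simp

lemma tr_diff: "tr (g - h) = tr g - tr h"
  using tr_add[of "g - h" h] by (simp add: algebra_simps)

lemma tr_commute: "tr (g * h) = tr (h * g)"
proof -
  have tr: "tr (g * h) = (\<Sum>u\<in>reps. \<Sum>v\<in>reps. E (Xf u * g) unit v * E (Xf v * h) unit u)" for g h
    unfolding tr_def mult.assoc[symmetric] by (intro sum.cong refl E_mult unit_K)
  show ?thesis
    unfolding tr[of g h] tr[of h g] by (subst sum.swap) (simp add: mult.commute)
qed

text \<open>A central l moves to the left of every X_u and, lying in \<open>L\<close>, crosses the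
  tensor sign as the scalar \<psi> l.\<close>

lemma tr_central:
  assumes "l \<in> L" and comm: "\<And>h. h * l = l * h"
  shows "tr (l * h) = \<psi> l * tr h"
proof -
  have "E (Xf u * (l * h)) unit u = \<psi> l * E (Xf u * h) unit u" for u
  proof -
    have "Xf u * (l * h) = l * (Xf u * h)" by (simp only: mult.assoc[symmetric] comm)
    then show ?thesis
      using E_balanced[OF unit_K assms(1)] E_smul[OF unit_K psi_K[OF assms(1)]] by (simp add: mult.commute)
  qed
  then show ?thesis by (simp add: tr_def sum_distrib_left)
qed

lemma tr_discr: "tr (\<Theta> (discr n) * h) = \<Psi> (discr n) * tr h"
  unfolding \<Psi>_def by (rule tr_central[OF L_\<Theta> discr_central])

text \<open>If v is not a minimal representative, a letter s_j with j in \<open>J\<close> splits off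
  on the left and is absorbed by \<psi>, which shortens v. The process ends at a basis vector of
  length below that of u.\<close>

lemma E_Xf_shorter:
  assumes "v \<in> W" "u \<in> reps" "len v < len u" "a \<in> K"
  shows "E (Xf v) a u = 0"
proof -
  obtain k where "len v = real k" using hyp_count_nat[OF fin_mem[OF assms(1)]] .
  then show ?thesis using assms(1,3,4)
  proof (induction k arbitrary: v a rule: less_induct)
    case (less k)
    show ?case
    proof (cases "v \<in> reps")
      case True
      then show ?thesis using E_Xf[OF True less.prems(4)] less.prems(3) by auto
    next
      case False
      then have "\<not> (\<forall>j\<in>J. inv v j < inv v (j + 1))"
        using increasing_on_rows[of "inv v"] less.prems(2) min_reps_iff by blast
      then obtain j where j: "j \<in> J" "\<not> inv v j < inv v (j + 1)" by blast
      have jn: "1 \<le> j" "j \<le> n" using j(1) J_iff by auto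
      have "inv v j \<noteq> inv v (j + 1)" using weyl_eq_iff[OF weyl_inv[OF less.prems(2)]] by simp
      then have down: "strip (fin v) j (j + 1) < 0" using j(2) by (simp add: strip_def fin_def)
      let ?v = "s j \<circ> v"
      have v: "?v \<in> W" using weyl_comp[OF weyl_simple[OF jn] less.prems(2)] .
      have len: "len ?v = len v - 1" using hyp_count_simple[OF less.prems(2) jn] down by simp
      obtain k' where k': "len ?v = real k'" using hyp_count_nat[OF fin_mem[OF v]] .
      have "E (Xf v) a u = E (Xf ?v) (a * \<psi> (Si j)) u"
        unfolding Xf_down[OF less.prems(2) jn down]
        using E_balanced[OF less.prems(4) L_Si[OF j(1)]] by simp
      also have "\<dots> = 0"
        using k' len less.prems L_Si[OF j(1)]
        by (intro less.IH[OF _ k' v] K_mult psi_K) (simp_all del: o_apply)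
      finally show ?thesis .
    qed
  qed
qed

lemma E_filt:
  assumes "h \<in> filt k" "u \<in> reps" "k < len u"
  shows "E h unit u = 0"
  using assms(1)
proof (induction rule: filt_induct)
  case (base p v)
  then have "len v < len u" using assms(3) by simp
  then show ?case
    unfolding E_balanced[OF unit_K L_\<Theta>]
    by (rule E_Xf_shorter[OF base(1) assms(2) _ K_mult[OF unit_K psi_K[OF L_\<Theta>]]])
qed (simp_all only: E_zero E_add unit_K add_0_right)

text \<open>The action of a polynomial on the basis is triangular with respect to length; the lower
  terms do not reach the diagonal, whose entries are the values of \<Psi> at the permuted
  polynomials.\<close>

lemma tr_\<Theta>: "tr (\<Theta> p) = (\<Sum>u\<in>reps. \<Psi> (poly_act u p))"
  unfolding tr_def
proof (rule sum.cong[OF refl])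
  fix u assume u: "u \<in> reps"
  then have "u \<in> W" by (simp add: min_reps_def)
  then obtain f where f: "f \<in> filt (len u - 1)" "Xf u * \<Theta> p = \<Theta> (poly_act u p) * Xf u + f"
    using Xf_\<Theta> by blast
  have "E (Xf u * \<Theta> p) unit u = E (\<Theta> (poly_act u p) * Xf u) unit u"
    unfolding f(2) E_add[OF unit_K] using E_filt[OF f(1) u] by (simp only: add_0_right)
  also have "\<dots> = E (Xf u) (unit * \<Psi> (poly_act u p)) u"
    unfolding \<Psi>_def E_balanced[OF unit_K L_\<Theta>] ..
  also have "\<dots> = \<Psi> (poly_act u p)"
    unfolding unit_mult[OF \<Psi>_K] E_Xf[OF u \<Psi>_K] by simp
  finally show "E (Xf u * \<Theta> p) unit u = \<Psi> (poly_act u p)" .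
qed

lemma tr_\<Theta>_invariant: "tr (\<Theta> p) \<in> Inv"
proof -
  have "zact g (tr (\<Theta> p)) = tr (\<Theta> p)" if g: "g \<in> G" for g
  proof -
    have "zact g (tr (\<Theta> p)) = (\<Sum>u\<in>reps. \<Psi> (poly_act (g \<circ> u) p))"
      by (simp add: tr_\<Theta> zact_sum zact_\<Psi>[OF g] poly_act_comp)
    also have "\<dots> = (\<Sum>u\<in>reps. \<Psi> (poly_act u p))"
    proof (rule sum.reindex_bij_witness[of _ "\<lambda>u. inv g \<circ> u" "\<lambda>u. g \<circ> u"])
      fix u assume u: "u \<in> reps"
      show "g \<circ> u \<in> reps" "inv g \<circ> u \<in> reps" using G_min_reps g G_inv u by blast+
      show "inv g \<circ> (g \<circ> u) = u" "g \<circ> (inv g \<circ> u) = u"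
        using G_weyl[OF g] by (simp_all add: comp_assoc[symmetric])
    qed simp
    finally show ?thesis by (simp add: tr_\<Theta>)
  qed
  then show ?thesis by (simp add: zeta_invariants_def tr_K)
qed

lemma tr_intertwiner:
  assumes w: "w \<in> W" "w \<noteq> id" and t: "\<And>r. t * \<Theta> r = \<Theta> (poly_act w r) * t"
  shows "tr (\<Theta> p * t) = 0"
proof -
  obtain i where i: "w i \<noteq> i" using w(2) by (auto simp: fun_eq_iff)
  have R: "i \<in> {1..n + 1}" using w(1) i by (auto simp: weyl_def permutes_def)
  then have "(i, w i) \<in> off_diag n" using weyl_in_range[OF w(1), of i] i by (simp add: off_diag_def)
  then obtain r where r: "discr n = (var i - var (w i)) * r" by (rule discr_factor)
  have zero: "tr (\<Theta> ((var i - var (w i)) * q) * t) = 0" for q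
  proof -
    \<comment> \<open>The factor x_(w i) passes to the right through t and becomes x_i; the trace
      then returns it to the front, unchanged.\<close>
    have "\<Theta> (var (w i)) * \<Theta> q * t = \<Theta> q * (\<Theta> (poly_act w (var i)) * t)"
      unfolding poly_act_var by (simp only: \<Theta>_commute[of "var (w i)"] mult.assoc)
    also have "\<dots> = \<Theta> q * t * \<Theta> (var i)" unfolding t[symmetric] by (simp only: mult.assoc)
    finally have "tr (\<Theta> (var (w i)) * \<Theta> q * t) = tr (\<Theta> (var i) * (\<Theta> q * t))"
      using tr_commute[of "\<Theta> q * t"] by simp
    then show ?thesis by (simp add: \<Theta>_mult \<Theta>_diff left_diff_distrib tr_diff mult.assoc)
  qed
  have "\<Psi> (discr n) * tr (\<Theta> p * t) = tr (\<Theta> (discr n * p) * t)"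
    unfolding tr_discr[symmetric] \<Theta>_mult by (simp only: mult.assoc)
  also have "\<dots> = 0" using zero[of "r * p"] unfolding r by (simp only: mult.assoc)
  finally show ?thesis using discr_regular[OF tr_K] by blast
qed

lemma tr_discr_power: "tr (\<Theta> (discr n ^ k) * h) \<in> Inv \<Longrightarrow> tr h \<in> Inv"
proof (induction k)
  case (Suc k)
  have "\<Psi> (discr n) * tr (\<Theta> (discr n ^ k) * h) \<in> Inv"
    using Suc.prems unfolding tr_discr[symmetric] by (simp add: \<Theta>_mult mult.assoc)
  then show ?case using Suc.IH Inv_cancel[OF tr_K] by blast
qed simp

lemma tr_Xf_invariant:
  assumes "w \<in> W"
  shows "tr (\<Theta> p * Xf w) \<in> Inv"
proof -
  obtain k where "len w = real k" using hyp_count_nat[OF fin_mem[OF assms]] .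
  then show ?thesis using assms
  proof (induction k arbitrary: w p rule: less_induct)
    case (less k)
    show ?case
    proof (cases "w = id")
      case True
      then show ?thesis using tr_\<Theta>_invariant by (simp only: Xf_id mult_1_right)
    next
      case False
      obtain t p' q l f where f: "f \<in> filt (len w - 1)" and t: "\<And>r. t * \<Theta> r = \<Theta> (poly_act w r) * t"
        "t = \<Theta> p' * Xf w + f" and pq: "p' * q = discr n ^ l"
        using intertwiner[OF less.prems(2)] by blast
      have lower: "tr (\<Theta> r * f) \<in> Inv" for r
        using f
      proof (induction rule: filt_induct)
        case (base r' v)
        obtain k' where k': "len v = real k'" using hyp_count_nat[OF fin_mem[OF base(1)]] .
        then have "k' < k" using base(2) less.prems(1) by simp
        then have "tr (\<Theta> (r * r') * Xf v) \<in> Inv" by (rule less.IH[OF _ k' base(1)])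
        then show ?case by (simp only: \<Theta>_mult mult.assoc)
      qed (simp_all add: tr_zero Inv_zero distrib_left tr_add Inv_add)
      \<comment> \<open>Multiplying t by q p raises the leading coefficient p' to a power of D times
        p. The trace of the product vanishes, so the trace of the leading term is minus that of
        lower terms.\<close>
      have "q * p * p' = discr n ^ l * p" unfolding pq[symmetric] by (simp only: ac_simps)
      then have "\<Theta> (q * p) * \<Theta> p' = \<Theta> (discr n ^ l) * \<Theta> p" by (simp only: flip: \<Theta>_mult)
      then have "\<Theta> (q * p) * t = \<Theta> (discr n ^ l) * (\<Theta> p * Xf w) + \<Theta> (q * p) * f"
        unfolding t(2) distrib_left mult.assoc[symmetric] by (simp only:)
      then have "tr (\<Theta> (discr n ^ l) * (\<Theta> p * Xf w)) = 0 - tr (\<Theta> (q * p) * f)"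
        using tr_intertwiner[OF less.prems(2) False t(1), of "q * p"] by (simp add: tr_add eq_neg_iff_add_eq_0)
      then have "tr (\<Theta> (discr n ^ l) * (\<Theta> p * Xf w)) \<in> Inv"
        using Inv_diff[OF Inv_zero lower] by simp
      then show ?thesis by (rule tr_discr_power)
    qed
  qed
qed

lemma tr_invariant: "tr h \<in> Inv"
proof -
  obtain k where "h \<in> filt k" using all_filt by blast
  then show ?thesis
    by (induction rule: filt_induct) (simp_all add: tr_Xf_invariant tr_zero Inv_zero tr_add Inv_add)
qed

end

theorem theorem3p8:
  fixes n :: nat
    and lam :: "nat list"
    and scale :: "laurent \<Rightarrow> 'h::ring_1 \<Rightarrow> 'h"
    and T :: "aff \<Rightarrow> 'h"
    and \<psi> :: "'h \<Rightarrow> zring"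
    and h :: 'h
  assumes "n \<ge> 1"
    and "partition_of lam (n + 1)"
    and "hecke_algebra scale n T"
    and "is_psi n scale T lam \<psi>"
  shows "f_fun n scale T lam \<psi> h \<in> zeta_invariants n lam"
proof -
  interpret hecke_algebra scale n T by (rule assms(3))
  interpret levi_rep scale n T lam \<psi>
    by unfold_locales (use assms in auto)
  show ?thesis
  proof (cases "\<forall>m\<in>formal_tensors n lam. \<exists>!c. is_coords n scale T lam \<psi> m c")
    case True
    then interpret levi_basis scale n T lam \<psi> by unfold_locales
    show ?thesis unfolding f_fun_def chi_eq_tr by (rule tr_invariant)
  next
    case False
    then have "f_fun n scale T lam \<psi> h = 0" by (simp only: f_fun_def chi_def if_False)
    then show ?thesis using Inv_zero by simp
  qed
qed

end
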